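(* Let $N\geq 2$ and let $\Omega\subset\mathbb{R}^N$ be a bounded open set of class $C^1$. Then there exists $s_0\in(1/2,1)$ such that for every $s\in(1/2,s_0)$ the infimum $$S_{N,s}(\Omega)=\inf_{u\in H^s_0(\Omega),\,u\neq 0}\frac{Q_{N,s,\Omega}(u)}{\|u\|^2_{L^{2^*_s}(\Omega)}}$$ is achieved.
   Context: For $s\in(0,1)$, $c_{N,s}>0$ denotes the standard normalization constant of the fractional Laplacian $(-\Delta)^s$ on $\mathbb{R}^N$, and $2^*_s=\frac{2N}{N-2s}$. For an open set $\Omega\subset\mathbb{R}^N$, $Q_{N,s,\Omega}(u)=\frac{c_{N,s}}{2}\int_\Omega\int_\Omega\frac{(u(x)-u(y))^2}{|x-y|^{N+2s}}\,dx\,dy$, $H^s(\Omega)$ is the space of $u\in L^2(\Omega)$ with $Q_{N,s,\Omega}(u)<\infty$, normed by $\|u\|^2_{H^s(\Omega)}=\|u\|^2_{L^2(\Omega)}+Q_{N,s,\Omega}(u)$, and $H^s_0(\Omega)$ is the completion of $C^\infty_c(\Omega)$ with respect to this norm. *)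

theory Defs
  imports "HOL-Analysis.Analysis"
begin

text \<open>Standard normalization constant of the fractional Laplacian on R^N:
  c_{N,s} = s 4^s Gamma(N/2+s) / (pi^{N/2} Gamma(1-s)).\<close>
definition c_frac :: "nat \<Rightarrow> real \<Rightarrow> real" where
  "c_frac N s = s * 4 powr s * Gamma (real N / 2 + s) / (pi powr (real N / 2) * Gamma (1 - s))"

definition crit_exp :: "nat \<Rightarrow> real \<Rightarrow> real" where
  "crit_exp N s = 2 * real N / (real N - 2 * s)"

definition Q_frac :: "real \<Rightarrow> 'a::euclidean_space set \<Rightarrow> ('a \<Rightarrow> real) \<Rightarrow> ennreal" where
  "Q_frac s \<Omega> u = ennreal (c_frac DIM('a) s / 2) *
     (\<integral>\<^sup>+ z \<in> \<Omega> \<times> \<Omega>. ennreal ((u (fst z) - u (snd z))\<^sup>2 /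
        norm (fst z - snd z) powr (real DIM('a) + 2 * s)) \<partial>(lebesgue \<Otimes>\<^sub>M lebesgue))"

definition L2sq :: "'a::euclidean_space set \<Rightarrow> ('a \<Rightarrow> real) \<Rightarrow> ennreal" where
  "L2sq \<Omega> u = (\<integral>\<^sup>+ x \<in> \<Omega>. ennreal ((u x)\<^sup>2) \<partial>lebesgue)"

text \<open>L^p(Omega) norm, p > 0 (used for p = 2^*_s; finite on H^s_0 by Sobolev embedding).\<close>
definition Lp_norm :: "real \<Rightarrow> 'a::euclidean_space set \<Rightarrow> ('a \<Rightarrow> real) \<Rightarrow> real" where
  "Lp_norm p \<Omega> u = (enn2real (\<integral>\<^sup>+ x \<in> \<Omega>. ennreal (\<bar>u x\<bar> powr p) \<partial>lebesgue)) powr (1 / p)"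

definition Hs_normsq :: "real \<Rightarrow> 'a::euclidean_space set \<Rightarrow> ('a \<Rightarrow> real) \<Rightarrow> ennreal" where
  "Hs_normsq s \<Omega> u = L2sq \<Omega> u + Q_frac s \<Omega> u"

definition Hs_space :: "real \<Rightarrow> 'a::euclidean_space set \<Rightarrow> ('a \<Rightarrow> real) set" where
  "Hs_space s \<Omega> = {u. set_borel_measurable lebesgue \<Omega> u \<and> L2sq \<Omega> u < \<infinity> \<and> Q_frac s \<Omega> u < \<infinity>}"

text \<open>C^infinity functions R^N -> R: differentiable everywhere, and all partial derivatives
  are again C^infinity (greatest fixed point = all iterated partial derivatives exist).\<close>
coinductive smooth_fun :: "('a::euclidean_space \<Rightarrow> real) \<Rightarrow> bool" where
  "(\<forall>x. f differentiable (at x)) \<Longrightarrow>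
   (\<forall>b\<in>Basis. smooth_fun (\<lambda>x. frechet_derivative f (at x) b)) \<Longrightarrow> smooth_fun f"

definition Cc_inf :: "'a::euclidean_space set \<Rightarrow> ('a \<Rightarrow> real) set" where
  "Cc_inf \<Omega> = {\<phi>. smooth_fun \<phi> \<and> compact (closure {x. \<phi> x \<noteq> 0}) \<and> closure {x. \<phi> x \<noteq> 0} \<subseteq> \<Omega>}"

text \<open>H^s_0(Omega): the closure of C^infinity_c(Omega) in H^s(Omega) (= its completion,
  realized inside the complete space H^s(Omega)).\<close>
definition Hs0_space :: "real \<Rightarrow> 'a::euclidean_space set \<Rightarrow> ('a \<Rightarrow> real) set" where
  "Hs0_space s \<Omega> = {u \<in> Hs_space s \<Omega>. \<exists>\<phi>. (\<forall>k. \<phi> k \<in> Cc_inf \<Omega>) \<and>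
       ((\<lambda>k. Hs_normsq s \<Omega> (\<lambda>x. \<phi> k x - u x)) \<longlonglongrightarrow> 0)}"

definition ae_zero_on :: "'a::euclidean_space set \<Rightarrow> ('a \<Rightarrow> real) \<Rightarrow> bool" where
  "ae_zero_on \<Omega> u \<longleftrightarrow> (AE x in lebesgue. x \<in> \<Omega> \<longrightarrow> u x = 0)"

text \<open>Bounded open set of class C^1: near every boundary point, after choosing a unit direction e,
  Omega is the supergraph {x . x.e > gamma(x - (x.e) e)} of a C^1 function gamma on the hyperplane
  orthogonal to e (gamma given as a C^1 function on the whole space, only its restriction to
  the hyperplane matters).\<close>
definition C1_domain :: "'a::euclidean_space set \<Rightarrow> bool" where
  "C1_domain \<Omega> \<longleftrightarrow> open \<Omega> \<and> bounded \<Omega> \<and>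
    (\<forall>p \<in> frontier \<Omega>. \<exists>r>0. \<exists>e::'a. \<exists>\<gamma>::'a \<Rightarrow> real. \<exists>\<gamma>'::'a \<Rightarrow> 'a.
       norm e = 1 \<and>
       (\<forall>x. (\<gamma> has_derivative (\<lambda>h. \<gamma>' x \<bullet> h)) (at x)) \<and> continuous_on UNIV \<gamma>' \<and>
       (\<forall>x \<in> ball p r. x \<in> \<Omega> \<longleftrightarrow> x \<bullet> e > \<gamma> (x - (x \<bullet> e) *\<^sub>R e)))"

definition S_frac :: "real \<Rightarrow> 'a::euclidean_space set \<Rightarrow> real" where
  "S_frac s \<Omega> = Inf {enn2real (Q_frac s \<Omega> u) / (Lp_norm (crit_exp DIM('a) s) \<Omega> u)\<^sup>2 |
                        u. u \<in> Hs0_space s \<Omega> \<and> \<not> ae_zero_on \<Omega> u}"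

end

theory Submission
  imports Defs
begin

text \<open>
  Poincare--Sobolev inequality. If \<open>\<Omega>\<close> satisfies \<open>|\<Omega> \<inter> B(x,t)| \<ge> c t\<^sup>N\<close>, compare \<open>u x\<close> with its average over
  \<open>\<Omega> \<inter> B(x,r)\<close> and telescope the averages over dyadic radii up to \<open>diam \<Omega>\<close>. With \<open>g x\<close> the inner Gagliardo integral
  and \<open>E\<close> the full one, this gives \<open>|u x - avg u| \<le> C (r\<^sup>s sqrt (g x) + r\<^bsup>s-N/2\<^esup> sqrt E)\<close>; the optimal \<open>r\<close> turns the right-hand
  side, raised to the critical power, into a multiple of \<open>g x\<close>. The constant does not depend on \<open>s\<close> near \<open>1/2\<close>.

  Small infimum. The boundary of a \<open>C\<^sup>1\<close> domain has zero \<open>H\<^sup>1\<^sup>/\<^sup>2\<close> capacity, so some \<open>\<phi>\<close> in \<open>C\<^sub>c\<^sup>\<infinity>(\<Omega>)\<close> equals \<open>1\<close> on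
  a fixed ball and has arbitrarily small \<open>H\<^sup>1\<^sup>/\<^sup>2\<close> energy; since \<open>|h|\<^sup>-\<^sup>N\<^sup>-\<^sup>2\<^sup>s\<close> is log-convex in \<open>s\<close>, the energy stays small
  for \<open>s\<close> slightly above \<open>1/2\<close>.

  Compactness. For a normalized minimizing sequence put \<open>v = (u\<^sub>m + u\<^sub>n)/2\<close>, \<open>w = (u\<^sub>m - u\<^sub>n)/2\<close>. The parallelogram law for the
  energy and the second-order inequality \<open>1 \<le> \<integral>|v|\<^sup>p + C \<parallel>w\<parallel>\<^sub>p\<^sup>2\<close> show that the energy of \<open>w\<close> is at most \<open>o(1) + C S \<parallel>w\<parallel>\<^sub>p\<^sup>2\<close>,
  whereas the Poincare--Sobolev inequality bounds \<open>\<parallel>w\<parallel>\<^sub>p\<^sup>2\<close> by \<open>C\<close> times that energy plus the squared mean of \<open>w\<close>. As the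
  infimum \<open>S\<close> is small and the means converge along a subsequence, the sequence is Cauchy.
\<close>

section \<open>Elementary inequalities\<close>

text \<open>The embedding into the critical L^p is not compact, so a minimizing sequence may
  concentrate. The way out is a gap between two constants. Modulo constant functions the
  Poincare-Sobolev inequality holds with one constant for all s in (1/2, 3/4), depending only on the
  dimension and on the density constant of the domain. At s = 1/2 the function 1 behaves like a
  limit of test functions, so the quotient is as small as desired there, and it stays below any
  threshold fixed beforehand once s is close enough to 1/2. The order of choices is therefore:
  constant, threshold, test function, and only then s. Below the threshold a minimizing sequence can
  fail to be Cauchy only through its means, and those are real numbers, so Bolzano-Weierstrass
  supplies all the compactness. The normalization constant of the energy multiplies both sides of
  the comparison and cancels. The bound s < 3/4 keeps the constants uniform: for N >= 2 the critical
  exponent lies in (2, 8] and N/2 - s stays above 1/4, so the telescoping sums grow at a fixed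
  geometric rate.\<close>

lemma powr_interpolation:
  fixes x q :: real
  assumes "0 \<le> x" "0 < a" "0 \<le> \<theta>" "\<theta> \<le> 1" "q = (1 - \<theta>) * a + \<theta> * b"  "0 < b"
  shows "x powr q \<le> (1 - \<theta>) * x powr a + \<theta> * x powr b"
proof (cases "x = 0")
  case False
  then have "x > 0" using assms by simp
  have "x powr q = (x powr a) powr (1 - \<theta>) * (x powr b) powr \<theta>"
    by (simp add: powr_powr assms(5) powr_add [symmetric] algebra_simps)
  also have "\<dots> \<le> (1 - \<theta>) * x powr a + \<theta> * x powr b"
    using assms \<open>x > 0\<close> by (intro Youngs_inequality_0) auto
  finally show ?thesis .
qed auto

lemma powr_eq_powr_square:
  "\<bar>x::real\<bar> powr (2 * q) = (x\<^sup>2) powr q"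
proof (cases "x = 0")
  case False
  then have "\<bar>x\<bar> powr (2 * q) = (\<bar>x\<bar> powr 2) powr q" by (simp only: powr_powr)
  also have "\<bar>x\<bar> powr 2 = x\<^sup>2" using False by (simp add: powr_numeral)
  finally show ?thesis .
qed simp

text \<open>Averaging over b and -b cancels the first-order term of the expansion of |a + b|^(2q),
  so the error is quadratic in b. What matters is a constant uniform in q: dividing by m = a^2 + b^2
  turns both squares into numbers with sum 2, and q is then interpolated between 1 and 4. The 32 is
  28 from this upper bound plus 4 from Bernoulli's inequality.\<close>

lemma powr_parallelogram_bound:
  fixes a b q :: real
  assumes "1 < q" "q \<le> 4"
  shows "((\<bar>a + b\<bar>) powr (2 * q) + \<bar>a - b\<bar> powr (2 * q)) / 2
     \<le> \<bar>a\<bar> powr (2 * q) + 32 * (b\<^sup>2 * (a\<^sup>2 + b\<^sup>2) powr (q - 1))"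
proof (cases "a\<^sup>2 + b\<^sup>2 = 0")
  case True
  then show ?thesis by simp
next
  case False
  define m where "m = a\<^sup>2 + b\<^sup>2"
  have m: "m > 0" using False by (simp add: m_def sum_power2_gt_zero_iff)
  \<comment> \<open>At exponent 1 the sum X + Y is exactly 2, and at exponent 4 the sum of powers is
    a polynomial in \<open>d\<close>; \<open>\<theta>\<close> is the position of q between these
    two.\<close>
  define \<theta> where "\<theta> = (q - 1) / 3"
  have th: "0 \<le> \<theta>" "\<theta> \<le> 1" and q: "q = (1 - \<theta>) * 1 + \<theta> * 4" using assms by (auto simp: \<theta>_def field_simps)
  define X where "X = (a + b)\<^sup>2 / m"
  define Y where "Y = (a - b)\<^sup>2 / m"
  define x where "x = b\<^sup>2 / m"
  have x01: "0 \<le> x" "x \<le> 1" using m by (auto simp: x_def m_def)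
  have XY0: "X \<ge> 0" "Y \<ge> 0" using m by (auto simp: X_def Y_def)
  have "X + Y = (2 * m) / m" unfolding X_def Y_def add_divide_distrib[symmetric]
    by (simp add: m_def power2_eq_square algebra_simps)
  then have sum: "X + Y = 2" using m by simp
  have diff: "(X - Y)\<^sup>2 \<le> 16 * x"
  proof -
    have "X - Y = 4 * a * b / m" unfolding X_def Y_def using m by (simp add: field_simps) (simp add: power2_eq_square algebra_simps)
    then have "(X - Y)\<^sup>2 = 16 * x * (a\<^sup>2 / m)" by (simp add: x_def power2_eq_square)
    also have "\<dots> \<le> 16 * x * 1" using x01 m by (intro mult_left_mono) (auto simp: m_def)
    finally show ?thesis by simp
  qed
  define d where "d = (X - Y) / 2"
  have Xd: "X = 1 + d" "Y = 1 - d" using sum by (auto simp: d_def field_simps)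
  have d2: "d\<^sup>2 \<le> 4 * x" using diff by (simp add: d_def power_divide)
  have "Y \<ge> 0" "X \<ge> 0" by fact+
  then have "\<bar>d\<bar> \<le> 1" using Xd by auto
  then have d21: "d\<^sup>2 \<le> 1" by (simp add: abs_square_le_1)
  have four: "X powr 4 + Y powr 4 \<le> 2 + 14 * d\<^sup>2"
  proof -
    have "X powr 4 + Y powr 4 = X ^ 4 + Y ^ 4"
      using XY0 by (simp add: powr_numeral)
    also have "\<dots> = 2 + 12 * d\<^sup>2 + 2 * (d\<^sup>2 * d\<^sup>2)" unfolding Xd by (simp add: power4_eq_xxxx power2_eq_square algebra_simps)
    also have "\<dots> \<le> 2 + 12 * d\<^sup>2 + 2 * (d\<^sup>2 * 1)" using d21 by (intro add_mono mult_left_mono) auto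
    finally show ?thesis by simp
  qed
  have "X powr q + Y powr q \<le> (1 - \<theta>) * (X + Y) + \<theta> * (X powr 4 + Y powr 4)"
    using powr_interpolation[OF XY0(1) _ th q] powr_interpolation[OF XY0(2) _ th q] XY0
    by (simp add: algebra_simps)
  also have "\<dots> \<le> (1 - \<theta>) * 2 + \<theta> * (2 + 14 * d\<^sup>2)"
    unfolding sum using mult_left_mono[OF four th(1)] by linarith
  also have "\<dots> = 2 + \<theta> * (14 * d\<^sup>2)" by (simp add: algebra_simps)
  also have "\<dots> \<le> 2 + 1 * (14 * (4 * x))" using th d2 by (intro add_mono mult_mono) auto
  finally have XYq: "(X powr q + Y powr q) / 2 \<le> 1 + 28 * x" by simp
  \<comment> \<open>Trades the leading 1 for \<open>(a\<^sup>2 / m) powr q\<close>, which becomes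
    the term |a|^(2q) of the claim: as 1 - x lies in [0, 1] and q <= 4, its q-th power is at least
    its fourth.\<close>
  have "1 - 4 * x \<le> (1 - x) ^ 4" using Bernoulli_inequality[of "-x" 4] x01 by simp
  also have "\<dots> = (1 - x) powr 4" using x01 by (simp add: powr_numeral)
  also have "\<dots> \<le> (1 - x) powr q"
    using powr_mono'[of q 4 "1 - x"] x01 assms by simp
  finally have bern: "1 \<le> (1 - x) powr q + 4 * x" by simp
  have one_x: "1 - x = a\<^sup>2 / m" using m by (simp add: x_def field_simps) (simp add: m_def)
  have scale: "m powr q * (z / m) powr q = z powr q" if "z \<ge> 0" for z
    using m that by (simp add: powr_divide)
  have mx: "m powr q * x = b\<^sup>2 * m powr (q - 1)" using m by (simp add: x_def powr_diff)
  have "(((a + b)\<^sup>2) powr q + ((a - b)\<^sup>2) powr q) / 2 = m powr q * ((X powr q + Y powr q) / 2)"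
    unfolding X_def Y_def by (simp add: distrib_left scale add_divide_distrib)
  also have "\<dots> \<le> m powr q * (1 + 28 * x)" by (intro mult_left_mono XYq) auto
  also have "\<dots> \<le> m powr q * (((1 - x) powr q + 4 * x) + 28 * x)" using bern by (intro mult_left_mono) auto
  also have "\<dots> = m powr q * (a\<^sup>2 / m) powr q + 32 * (m powr q * x)" by (simp add: algebra_simps one_x)
  also have "\<dots> = (a\<^sup>2) powr q + 32 * (b\<^sup>2 * m powr (q - 1))" by (simp add: scale mx)
  finally show ?thesis by (simp add: powr_eq_powr_square m_def)
qed

text \<open>The parameter t is later chosen just above the L^p norm of w, which makes the three
  terms of the bracket contribute at most 1 each after integration. The mixed term
  \<open>w\<^sup>2 * m powr (q - 1)\<close> is split by a crude Young inequality for X = w^2 / t^2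
  and m that replaces the smaller of the two by the larger.\<close>

lemma powr_half_sum_bound:
  fixes a b q t :: real
  assumes q: "1 < q" "q \<le> 4" and t: "0 < t"
  defines "v \<equiv> (a + b) / 2" and "w \<equiv> (a - b) / 2"
  shows "(\<bar>a\<bar> powr (2 * q) + \<bar>b\<bar> powr (2 * q)) / 2
     \<le> \<bar>v\<bar> powr (2 * q) + 32 * t\<^sup>2 * (\<bar>w\<bar> powr (2 * q) / t powr (2 * q) + \<bar>a\<bar> powr (2 * q) + \<bar>b\<bar> powr (2 * q))"
proof -
  have ab: "a = v + w" "b = v - w" by (simp_all add: v_def w_def field_simps)
  define m where "m = v\<^sup>2 + w\<^sup>2"
  have m0: "m \<ge> 0" by (simp add: m_def)
  have mab: "m = (a\<^sup>2 + b\<^sup>2) / 2" by (simp add: m_def v_def w_def power2_eq_square field_simps)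
  have mq: "m powr q \<le> \<bar>a\<bar> powr (2 * q) + \<bar>b\<bar> powr (2 * q)"
  proof (cases "a\<^sup>2 \<le> b\<^sup>2")
    case True
    then have "m powr q \<le> (b\<^sup>2) powr q" using q m0 by (intro powr_mono2) (auto simp: mab)
    then show ?thesis by (simp add: powr_eq_powr_square add_increasing)
  next
    case False
    then have "m powr q \<le> (a\<^sup>2) powr q" using q m0 by (intro powr_mono2) (auto simp: mab)
    then show ?thesis by (simp add: powr_eq_powr_square add_increasing2)
  qed
  define X where "X = w\<^sup>2 / t\<^sup>2"
  have X0: "X \<ge> 0" by (simp add: X_def)
  have Xq: "X powr q = \<bar>w\<bar> powr (2 * q) / t powr (2 * q)"
    using t powr_eq_powr_square[of t q] by (simp add: X_def powr_eq_powr_square powr_divide)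
  have young: "X * m powr (q - 1) \<le> X powr q + m powr q"
  proof (cases "X = 0 \<or> m = 0")
    case True
    then show ?thesis by auto
  next
    case False
    then have pos: "X > 0" "m > 0" using X0 m0 by auto
    have Xe: "X powr q = X * X powr (q - 1)" "m powr q = m * m powr (q - 1)"
      using pos by (auto simp: powr_diff)
    show ?thesis
    proof (cases "X \<le> m")
      case True
      then have "X * m powr (q - 1) \<le> m powr q" unfolding Xe by (intro mult_right_mono) auto
      then show ?thesis by (simp add: add_increasing)
    next
      case False
      then have "X * m powr (q - 1) \<le> X powr q" unfolding Xe
        using pos q by (intro mult_left_mono powr_mono2) auto
      then show ?thesis by (simp add: add_increasing2)
    qed
  qed
  have "(\<bar>a\<bar> powr (2 * q) + \<bar>b\<bar> powr (2 * q)) / 2 \<le> \<bar>v\<bar> powr (2 * q) + 32 * (w\<^sup>2 * m powr (q - 1))"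
    using powr_parallelogram_bound[OF q, of v w] by (simp add: ab[symmetric] m_def)
  also have "w\<^sup>2 * m powr (q - 1) = t\<^sup>2 * (X * m powr (q - 1))" using t by (simp add: X_def)
  also have "\<dots> \<le> t\<^sup>2 * (X powr q + (\<bar>a\<bar> powr (2 * q) + \<bar>b\<bar> powr (2 * q)))"
    using young mq by (intro mult_left_mono) auto
  finally show ?thesis by (simp add: Xq mult_ac add.assoc)
qed

lemma (in finite_measure) L1_Cauchy_AE_subsequence:
  fixes f :: "nat \<Rightarrow> 'a \<Rightarrow> real"
  assumes f [measurable]: "\<And>n. f n \<in> borel_measurable M"
    and C: "\<And>e::real. e > 0 \<Longrightarrow> \<exists>N. \<forall>m\<ge>N. \<forall>n\<ge>N. (\<integral>\<^sup>+x. ennreal \<bar>f m x - f n x\<bar> \<partial>M) \<le> ennreal e"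
  shows "\<exists>r u. strict_mono r \<and> u \<in> borel_measurable M \<and> (AE x in M. (\<lambda>n. f (r n) x) \<longlonglongrightarrow> u x)"
proof -
  have "\<forall>k. \<exists>N. \<forall>m\<ge>N. \<forall>n\<ge>N. (\<integral>\<^sup>+x. ennreal \<bar>f m x - f n x\<bar> \<partial>M) \<le> ennreal ((1/2)^k)"
    using C by auto
  then obtain N where N: "\<And>k m n. m \<ge> N k \<Longrightarrow> n \<ge> N k \<Longrightarrow> (\<integral>\<^sup>+x. ennreal \<bar>f m x - f n x\<bar> \<partial>M) \<le> ennreal ((1/2)^k)"
    by metis
  define r where "r k = (\<Sum>i\<le>k. N i) + k" for k
  have r: "strict_mono r" by (rule strict_monoI_Suc) (simp add: r_def)
  have rN: "r k \<ge> N k" "r (Suc k) \<ge> N k" for k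
    by (auto simp: r_def intro: le_SucI trans_le_add1 member_le_sum)
  define g where "g k x = \<bar>f (r (Suc k)) x - f (r k) x\<bar>" for k x
  have [measurable]: "g k \<in> borel_measurable M" for k unfolding g_def[abs_def] by measurable
  have "(\<integral>\<^sup>+x. (\<Sum>k. ennreal (g k x)) \<partial>M) = (\<Sum>k. \<integral>\<^sup>+x. ennreal (g k x) \<partial>M)"
    by (rule nn_integral_suminf) measurable
  also have "\<dots> \<le> (\<Sum>k. ennreal ((1/2)^k))"
    unfolding g_def by (intro suminf_le N rN summableI)
  also have "\<dots> = ennreal 2" by (rule suminf_ennreal_eq) (use geometric_sums[of "1/2::real"] in auto)
  also have "\<dots> < \<infinity>" by simp
  finally have "AE x in M. (\<Sum>k. ennreal (g k x)) \<noteq> \<infinity>"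
    by (intro nn_integral_PInf_AE) auto
  then have conv: "AE x in M. convergent (\<lambda>n. f (r n) x)"
  proof eventually_elim
    case (elim x)
    then have "summable (\<lambda>k. g k x)" by (intro summable_suminf_not_top) (auto simp: g_def)
    then have "summable (\<lambda>k. f (r (Suc k)) x - f (r k) x)"
      unfolding g_def by (rule summable_rabs_cancel)
    then have "convergent (\<lambda>n. \<Sum>k<n. f (r (Suc k)) x - f (r k) x)"
      by (simp add: summable_iff_convergent)
    then have "convergent (\<lambda>n. f (r n) x - f (r 0) x)"
      using sum_lessThan_telescope[of "\<lambda>n. f (r n) x"] by simp
    from convergent_add[OF this convergent_const[of "f (r 0) x"]]
    show ?case by simp
  qed
  define u where "u x = lim (\<lambda>n. f (r n) x)" for x
  have "u \<in> borel_measurable M" unfolding u_def by measurable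
  moreover from conv have "AE x in M. (\<lambda>n. f (r n) x) \<longlonglongrightarrow> u x"
    by eventually_elim (simp add: u_def convergent_LIMSEQ_iff)
  ultimately show ?thesis using r by blast
qed

section \<open>Nonlocal energies and minimizing sequences\<close>

lemma abs_add_powr_le:
  fixes a b p :: real
  assumes "0 < p"
  shows "\<bar>a + b\<bar> powr p \<le> 2 powr p * (\<bar>a\<bar> powr p + \<bar>b\<bar> powr p)"
proof -
  have "\<bar>a + b\<bar> powr p \<le> (2 * max \<bar>a\<bar> \<bar>b\<bar>) powr p"
    using assms by (intro powr_mono2) auto
  also have "\<dots> = 2 powr p * max \<bar>a\<bar> \<bar>b\<bar> powr p" by (simp add: powr_mult)
  also have "\<dots> \<le> 2 powr p * (\<bar>a\<bar> powr p + \<bar>b\<bar> powr p)"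
    by (intro mult_left_mono) (auto simp: max_def)
  finally show ?thesis .
qed

text \<open>Either b keeps the share 1 - \<theta> of a, or the difference exceeds the share
  \<theta>. In this form it shows that a limit of functions of norm 1 has norm at least 1: first a -
  b tends to 0, then \<theta>.\<close>

lemma abs_powr_le_split:
  fixes a b p \<theta> :: real
  assumes "0 < p" "0 < \<theta>" "\<theta> < 1"
  shows "\<bar>a\<bar> powr p \<le> \<bar>b\<bar> powr p / (1 - \<theta>) powr p + \<bar>a - b\<bar> powr p / \<theta> powr p"
proof (cases "\<bar>b\<bar> \<ge> (1 - \<theta>) * \<bar>a\<bar>")
  case True
  then have "((1 - \<theta>) * \<bar>a\<bar>) powr p \<le> \<bar>b\<bar> powr p" using assms by (intro powr_mono2) auto
  then have "\<bar>a\<bar> powr p \<le> \<bar>b\<bar> powr p / (1 - \<theta>) powr p"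
    using assms unfolding powr_mult by (simp add: pos_le_divide_eq mult.commute)
  moreover have "0 \<le> \<bar>a - b\<bar> powr p / \<theta> powr p" by simp
  ultimately show ?thesis by linarith
next
  case False
  then have "\<theta> * \<bar>a\<bar> \<le> \<bar>a - b\<bar>" by (simp add: algebra_simps)
  then have "(\<theta> * \<bar>a\<bar>) powr p \<le> \<bar>a - b\<bar> powr p" using assms by (intro powr_mono2) auto
  then have "\<bar>a\<bar> powr p \<le> \<bar>a - b\<bar> powr p / \<theta> powr p" using assms by (simp add: powr_mult field_simps)
  moreover have "0 \<le> \<bar>b\<bar> powr p / (1 - \<theta>) powr p" by simp
  ultimately show ?thesis by linarith
qed

lemma nn_integral_real_cmult:
  fixes f :: "'a \<Rightarrow> real"
  assumes [measurable]: "f \<in> borel_measurable M" and "0 \<le> a"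
  shows "(\<integral>\<^sup>+x. ennreal (a * f x) \<partial>M) = ennreal a * (\<integral>\<^sup>+x. ennreal (f x) \<partial>M)"
  using assms by (simp add: ennreal_mult' nn_integral_cmult)

lemma nn_integral_real_lincomb:
  fixes f g :: "'a \<Rightarrow> real"
  assumes [measurable]: "f \<in> borel_measurable M" "g \<in> borel_measurable M"
    and "0 \<le> a" "0 \<le> b" "\<And>x. 0 \<le> f x" "\<And>x. 0 \<le> g x"
  shows "(\<integral>\<^sup>+x. ennreal (a * f x + b * g x) \<partial>M)
     = ennreal a * (\<integral>\<^sup>+x. ennreal (f x) \<partial>M) + ennreal b * (\<integral>\<^sup>+x. ennreal (g x) \<partial>M)"
  using assms by (simp add: ennreal_mult' nn_integral_cmult nn_integral_add ennreal_plus)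

lemma nn_integral_real_lincomb_le:
  fixes f g h :: "'a \<Rightarrow> real"
  assumes "f \<in> borel_measurable M" "g \<in> borel_measurable M"
    and "0 \<le> a" "0 \<le> b" "\<And>x. 0 \<le> f x" "\<And>x. 0 \<le> g x"
    and "\<And>x. x \<in> space M \<Longrightarrow> h x \<le> a * f x + b * g x"
  shows "(\<integral>\<^sup>+x. ennreal (h x) \<partial>M)
     \<le> ennreal a * (\<integral>\<^sup>+x. ennreal (f x) \<partial>M) + ennreal b * (\<integral>\<^sup>+x. ennreal (g x) \<partial>M)"
  unfolding nn_integral_real_lincomb[OF assms(1-6), symmetric]
  by (intro nn_integral_mono ennreal_leI assms(7))

text \<open>Measure and kernel are left abstract: the compactness argument sees the energy only as a
  nonnegative quadratic form given by a kernel. The range of p is that of the critical exponent for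
  N >= 2 and s < 3/4; with p = 2q it is the range 1 < q <= 4 of
  \<open>powr_half_sum_bound\<close>.\<close>

locale nonlocal_energy = finite_measure M for M :: "'a measure" +
  fixes k :: "'a \<times> 'a \<Rightarrow> real" and p :: real
  assumes k_measurable [measurable]: "k \<in> borel_measurable (M \<Otimes>\<^sub>M M)"
    and k_nonneg: "\<And>z. 0 \<le> k z"
    and p: "2 < p" "p \<le> 8"
begin

definition energy :: "('a \<Rightarrow> real) \<Rightarrow> ennreal" where
  "energy u = (\<integral>\<^sup>+z. ennreal ((u (fst z) - u (snd z))\<^sup>2 * k z) \<partial>(M \<Otimes>\<^sub>M M))"

definition power_int :: "('a \<Rightarrow> real) \<Rightarrow> ennreal" where
  "power_int u = (\<integral>\<^sup>+x. ennreal (\<bar>u x\<bar> powr p) \<partial>M)"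

lemma energy_cmult:
  assumes [measurable]: "u \<in> borel_measurable M"
  shows "energy (\<lambda>x. c * u x) = ennreal (c\<^sup>2) * energy u"
proof -
  have "(c * a - c * b)\<^sup>2 * d = c\<^sup>2 * ((a - b)\<^sup>2 * d)" for a b d :: real
    by (simp add: power2_eq_square algebra_simps)
  then show ?thesis
    unfolding energy_def by (subst nn_integral_real_cmult [symmetric], simp, simp, intro nn_integral_cong arg_cong[where f=ennreal])
qed

lemma energy_parallelogram:
  assumes [measurable]: "u \<in> borel_measurable M" "v \<in> borel_measurable M"
  shows "energy (\<lambda>x. (u x + v x) / 2) + energy (\<lambda>x. (u x - v x) / 2) = ennreal (1/2) * energy u + ennreal (1/2) * energy v"
proof -
  have "1 * ((((a + b) / 2 - (a' + b') / 2)\<^sup>2 * d)) + 1 * ((((a - b) / 2 - (a' - b') / 2)\<^sup>2 * d))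
     = (1/2) * ((a - a')\<^sup>2 * d) + (1/2) * ((b - b')\<^sup>2 * d)" for a b a' b' d :: real
    by (simp add: power2_eq_square field_simps)
  note eq = this
  let ?v = "\<lambda>x. (u x + v x) / 2" and ?w = "\<lambda>x. (u x - v x) / 2"
  have "energy ?v + energy ?w = ennreal 1 * energy ?v + ennreal 1 * energy ?w" by simp
  also have "\<dots> = ennreal (1/2) * energy u + ennreal (1/2) * energy v"
    unfolding energy_def
    by (subst (1 2) nn_integral_real_lincomb [symmetric]) (auto simp: k_nonneg eq[simplified] intro!: nn_integral_cong)
  finally show ?thesis .
qed

lemma energy_add_le:
  assumes [measurable]: "u \<in> borel_measurable M" "v \<in> borel_measurable M"
  shows "energy (\<lambda>x. u x + v x) \<le> ennreal 2 * energy u + ennreal 2 * energy v"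
  unfolding energy_def
proof (rule nn_integral_real_lincomb_le)
  fix z
  define a b a' b' where "a = u (fst z)" "b = v (fst z)" "a' = u (snd z)" "b' = v (snd z)"
  have "((a + b) - (a' + b'))\<^sup>2 \<le> 2 * (a - a')\<^sup>2 + 2 * (b - b')\<^sup>2"
    using zero_le_power2[of "(a - a') - (b - b')"] by (simp add: power2_eq_square algebra_simps)
  from mult_right_mono[OF this k_nonneg[of z]]
  show "((u (fst z) + v (fst z)) - (u (snd z) + v (snd z)))\<^sup>2 * k z \<le> 2 * ((u (fst z) - u (snd z))\<^sup>2 * k z) + 2 * ((v (fst z) - v (snd z))\<^sup>2 * k z)"
    by (simp add: algebra_simps a_b_a'_b'_def)
qed (auto simp: k_nonneg)

lemma power_int_cmult:
  assumes [measurable]: "u \<in> borel_measurable M"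
  shows "power_int (\<lambda>x. c * u x) = ennreal (\<bar>c\<bar> powr p) * power_int u"
  unfolding power_int_def
  by (subst nn_integral_cmult [symmetric]) (auto simp: ennreal_mult'' abs_mult powr_mult)

lemma power_int_eq_0_iff:
  assumes [measurable]: "u \<in> borel_measurable M"
  shows "power_int u = 0 \<longleftrightarrow> (AE x in M. u x = 0)"
  unfolding power_int_def by (subst nn_integral_0_iff_AE) (auto simp: powr_eq_0_iff)

text \<open>Plays the role of Hoelder's inequality on a finite measure space: below |y| = t the
  value is at most \<open>t powr r\<close>, and above it the larger exponent p dominates. It is
  applied with r = 1 to control means and with r = 2 to control the L^2 part of the norm.\<close>

lemma young_integral_bound:
  assumes [measurable]: "u \<in> borel_measurable M" and t: "0 < t" "power_int u \<le> ennreal (t powr p)" and r: "0 < r" "r \<le> p"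
  shows "(\<integral>\<^sup>+x. ennreal (\<bar>u x\<bar> powr r) \<partial>M) \<le> ennreal (t powr r * (measure M (space M) + 1))"
proof -
  have *: "\<bar>y\<bar> powr r \<le> t powr r * (1 + \<bar>y\<bar> powr p / t powr p)" for y :: real
  proof (cases "\<bar>y\<bar> \<le> t")
    case True
    then have "\<bar>y\<bar> powr r \<le> t powr r" using r by (intro powr_mono2) auto
    then show ?thesis using t by (simp add: distrib_left add_increasing2)
  next
    case False
    have "(\<bar>y\<bar> / t) powr r \<le> (\<bar>y\<bar> / t) powr p" using False t r by (intro powr_mono) auto
    then have "\<bar>y\<bar> powr r \<le> t powr r * (\<bar>y\<bar> powr p / t powr p)" using t by (simp add: powr_divide field_simps)
    then show ?thesis using t by (simp add: distrib_left add_increasing)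
  qed
  have "(\<integral>\<^sup>+x. ennreal (\<bar>u x\<bar> powr r) \<partial>M)
    \<le> ennreal (t powr r) * (\<integral>\<^sup>+x. ennreal 1 \<partial>M) + ennreal (t powr r / t powr p) * power_int u"
    unfolding power_int_def
  proof (rule nn_integral_real_lincomb_le)
    show "\<bar>u x\<bar> powr r \<le> t powr r * 1 + t powr r / t powr p * \<bar>u x\<bar> powr p" for x
      using *[of "u x"] by (simp add: algebra_simps)
  qed auto
  also have "\<dots> \<le> ennreal (t powr r) * emeasure M (space M) + ennreal (t powr r / t powr p) * ennreal (t powr p)"
    by (intro add_mono mult_left_mono t) auto
  also have "ennreal (t powr r / t powr p) * ennreal (t powr p) = ennreal (t powr r)"
    using t by (simp add: ennreal_mult' [symmetric])
  also have "ennreal (t powr r) * emeasure M (space M) + ennreal (t powr r) = ennreal (t powr r * (measure M (space M) + 1))"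
    by (simp add: emeasure_eq_measure ennreal_mult' [symmetric] ennreal_plus [symmetric] algebra_simps del: ennreal_plus)
  finally show ?thesis .
qed

text \<open>The constant is 3 * 32: by the choice of t, each of w, u and v contributes at most 32
  t^2.\<close>

lemma power_int_half_sum:
  assumes [measurable]: "u \<in> borel_measurable M" "v \<in> borel_measurable M"
    and 1: "power_int u = 1" "power_int v = 1"
    and t: "0 < t" "power_int (\<lambda>x. (u x - v x) / 2) \<le> ennreal (t powr p)"
  shows "1 \<le> power_int (\<lambda>x. (u x + v x) / 2) + ennreal (96 * t\<^sup>2)"
proof -
  let ?v = "\<lambda>x. (u x + v x) / 2" and ?w = "\<lambda>x. (u x - v x) / 2"
  have q: "1 < p / 2" "p / 2 \<le> 4" using p by auto
  have "ennreal (1/2) + ennreal (1/2) = 1" by (subst ennreal_plus [symmetric]) auto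
  then have "1 = ennreal (1/2) * power_int u + ennreal (1/2) * power_int v"
    unfolding 1 mult_1_right by (rule sym)
  also have "\<dots> = (\<integral>\<^sup>+x. ennreal ((1/2) * \<bar>u x\<bar> powr p + (1/2) * \<bar>v x\<bar> powr p) \<partial>M)"
    unfolding power_int_def by (rule nn_integral_real_lincomb [symmetric]) auto
  also have "\<dots> \<le> ennreal 1 * (\<integral>\<^sup>+x. ennreal (1 * \<bar>?v x\<bar> powr p + (32 * t\<^sup>2 / t powr p) * \<bar>?w x\<bar> powr p) \<partial>M)
      + ennreal (32 * t\<^sup>2) * (\<integral>\<^sup>+x. ennreal (1 * \<bar>u x\<bar> powr p + 1 * \<bar>v x\<bar> powr p) \<partial>M)"
  proof (rule nn_integral_real_lincomb_le)
    show "(1/2) * \<bar>u x\<bar> powr p + (1/2) * \<bar>v x\<bar> powr p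
      \<le> 1 * (1 * \<bar>?v x\<bar> powr p + (32 * t\<^sup>2 / t powr p) * \<bar>?w x\<bar> powr p)
        + 32 * t\<^sup>2 * (1 * \<bar>u x\<bar> powr p + 1 * \<bar>v x\<bar> powr p)" for x
    proof -
      have "(1/2) * A + (1/2) * B \<le> 1 * (1 * V + (32 * T / Q) * W) + 32 * T * (1 * A + 1 * B)"
        if "(A + B) / 2 \<le> V + 32 * T * (W / Q + A + B)" for A B V W T Q :: real
      proof -
        have "32 * T * (W / Q + A + B) = (32 * T / Q) * W + 32 * T * (1 * A + 1 * B)" by (simp add: distrib_left)
        then show ?thesis using that by simp
      qed
      then show ?thesis using powr_half_sum_bound[OF q t(1), of "u x" "v x"] by simp
    qed
  qed auto
  also have "\<dots> = power_int ?v + ennreal (32 * t\<^sup>2 / t powr p) * power_int ?w + ennreal (32 * t\<^sup>2) * (power_int u + power_int v)"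
    unfolding power_int_def by (subst (1 2) nn_integral_real_lincomb) auto
  also have "\<dots> \<le> power_int ?v + ennreal (32 * t\<^sup>2 / t powr p) * ennreal (t powr p) + ennreal (32 * t\<^sup>2) * (power_int u + power_int v)"
    by (intro add_mono mult_left_mono t) auto
  also have "ennreal (32 * t\<^sup>2 / t powr p) * ennreal (t powr p) = ennreal (32 * t\<^sup>2)"
    using t by (simp add: ennreal_mult' [symmetric])
  also have "ennreal (32 * t\<^sup>2) * (power_int u + power_int v) = ennreal (64 * t\<^sup>2)"
  proof -
    have "power_int u + power_int v = ennreal 2" by (simp add: 1)
    then show ?thesis by (simp only: ennreal_mult''[symmetric]) (simp add: ennreal_mult'' [symmetric] del: ennreal_numeral)
  qed
  also have "power_int ?v + ennreal (32 * t\<^sup>2) + ennreal (64 * t\<^sup>2) = power_int ?v + ennreal (96 * t\<^sup>2)"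
    by (simp add: add.assoc ennreal_plus [symmetric] del: ennreal_plus)
  finally show ?thesis .
qed


text \<open>The squared L^p norm. \<open>enn2real\<close> sends an infinite integral to 0, which is
  why upper bounds derived from it come with a finiteness hypothesis.\<close>

definition lp_sq :: "('a \<Rightarrow> real) \<Rightarrow> real" where
  "lp_sq u = (enn2real (power_int u)) powr (2 / p)"

lemma lp_sq_nonneg: "0 \<le> lp_sq u"
  by (simp add: lp_sq_def)

lemma lp_sq_cmult:
  assumes [measurable]: "u \<in> borel_measurable M"
  shows "lp_sq (\<lambda>x. c * u x) = c\<^sup>2 * lp_sq u"
proof -
  have "(\<bar>c\<bar> powr p) powr (2 / p) = c\<^sup>2"
    using p by (cases "c = 0") (auto simp: powr_powr powr_numeral)
  then show ?thesis
    unfolding lp_sq_def power_int_cmult[OF assms] by (simp add: enn2real_mult powr_mult)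
qed

lemma power_int_le_powr:
  assumes "power_int u < \<infinity>" "lp_sq u \<le> t\<^sup>2" "0 < t"
  shows "power_int u \<le> ennreal (t powr p)"
proof -
  define a where "a = enn2real (power_int u)"
  have a: "power_int u = ennreal a" "a \<ge> 0" using assms by (auto simp: a_def)
  have "a = (a powr (2 / p)) powr (p / 2)" using a p by (simp add: powr_powr)
  also have "\<dots> \<le> (t\<^sup>2) powr (p / 2)" using assms p by (intro powr_mono2) (auto simp: lp_sq_def a_def)
  also have "\<dots> = t powr p" using powr_eq_powr_square[of t "p/2"] assms by simp
  finally show ?thesis by (simp add: a(1) ennreal_leI)
qed

text \<open>This is the concentration-compactness step: if the embedding constant \<open>C\<close> beats the
  infimum \<open>l\<close>, then an almost minimizing pair is close in the \<open>L\<^sup>p\<close> norm up to its means.\<close>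
lemma half_difference_bound:
  assumes [measurable]: "u \<in> borel_measurable M" "v \<in> borel_measurable M"
    and 1: "power_int u = 1" "power_int v = 1"
    and E: "energy u \<le> ennreal (l + \<epsilon>)" "energy v \<le> ennreal (l + \<epsilon>)" and nn: "0 \<le> l" "0 \<le> \<epsilon>" "0 \<le> C"
  defines "s \<equiv> \<lambda>x. (u x + v x) / 2" and "w \<equiv> \<lambda>x. (u x - v x) / 2"
  assumes fin: "power_int s < \<infinity>" "power_int w < \<infinity>"
    and low: "l * lp_sq s \<le> enn2real (energy s)"
    and sob: "lp_sq w \<le> C * enn2real (energy w) + R"
    and small: "192 * C * l \<le> 1"
  shows "lp_sq w \<le> 2 * (C * \<epsilon> + R)" "enn2real (energy w) \<le> \<epsilon> + 96 * l * lp_sq w"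
proof -
  have ps: "1 \<le> enn2real (power_int s) + 96 * lp_sq w"
  proof (rule field_le_epsilon)
    fix \<eta> :: real assume "\<eta> > 0"
    \<comment> \<open>t has to be positive, also when w vanishes; the surplus
      \<open>\<eta> / 96\<close> becomes exactly \<open>\<eta>\<close> in the conclusion and is
      removed by \<open>field_le_epsilon\<close>.\<close>
    define t where "t = sqrt (lp_sq w + \<eta> / 96)"
    have pos: "0 < lp_sq w + \<eta> / 96" using \<open>\<eta> > 0\<close> lp_sq_nonneg[of w] by (simp add: add_nonneg_pos)
    then have t: "0 < t" "t\<^sup>2 = lp_sq w + \<eta> / 96" by (auto simp: t_def)
    have "power_int w \<le> ennreal (t powr p)" using t \<open>\<eta> > 0\<close> by (intro power_int_le_powr fin) auto
    then have "1 \<le> power_int s + ennreal (96 * t\<^sup>2)"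
      unfolding s_def w_def by (intro power_int_half_sum 1 t) measurable
    also have "power_int s = ennreal (enn2real (power_int s))" using fin by simp
    also have "\<dots> + ennreal (96 * t\<^sup>2) = ennreal (enn2real (power_int s) + 96 * t\<^sup>2)"
      by (simp add: ennreal_plus)
    finally have "1 \<le> enn2real (power_int s) + 96 * t\<^sup>2" by (simp add: ennreal_ge_1 del: ennreal_plus)
    then show "1 \<le> enn2real (power_int s) + 96 * lp_sq w + \<eta>" by (simp add: t algebra_simps)
  qed
  \<comment> \<open>Since 2/p < 1, taking this power enlarges numbers in [0, 1], and a number above
    1 stays above 1, so the lower bound survives the root.\<close>
  have ls: "1 - 96 * lp_sq w \<le> lp_sq s"
  proof (cases "enn2real (power_int s) \<le> 1")
    case True
    have "enn2real (power_int s) powr 1 \<le> lp_sq s"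
      unfolding lp_sq_def using p True by (intro powr_mono') auto
    then show ?thesis using ps by simp
  next
    case False
    then have "1 \<le> lp_sq s" unfolding lp_sq_def using p by (intro ge_one_powr_ge_zero) auto
    then show ?thesis using lp_sq_nonneg[of w] by simp
  qed
  have para: "energy s + energy w = ennreal (1/2) * energy u + ennreal (1/2) * energy v"
    unfolding s_def w_def by (rule energy_parallelogram) measurable
  also have "\<dots> \<le> ennreal (1/2) * ennreal (l + \<epsilon>) + ennreal (1/2) * ennreal (l + \<epsilon>)"
    by (intro add_mono mult_left_mono E) auto
  also have "\<dots> = ennreal (l + \<epsilon>)"
  proof -
    have "ennreal (1/2) * ennreal c + ennreal (1/2) * ennreal c = ennreal c" if "c \<ge> 0" for c
      using that by (subst (1 2) ennreal_mult' [symmetric], simp, subst ennreal_plus [symmetric]) auto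
    then show ?thesis using nn by (simp del: ennreal_plus)
  qed
  finally have le: "energy s + energy w \<le> ennreal (l + \<epsilon>)" .
  have fs: "energy s < \<infinity>" "energy w < \<infinity>"
    using le_less_trans[OF le, of \<infinity>] by (auto simp: less_top)
  have "ennreal (enn2real (energy s) + enn2real (energy w)) = energy s + energy w"
    using fs by (simp add: ennreal_plus)
  also note le
  finally have Ele: "enn2real (energy s) + enn2real (energy w) \<le> l + \<epsilon>" using nn by (simp del: ennreal_plus)
  have "l * (1 - 96 * lp_sq w) \<le> l * lp_sq s" by (intro mult_left_mono ls nn)
  also note low
  finally show ew: "enn2real (energy w) \<le> \<epsilon> + 96 * l * lp_sq w" using Ele by (simp add: algebra_simps)
  have "lp_sq w \<le> C * (\<epsilon> + 96 * l * lp_sq w) + R"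
    using sob mult_left_mono[OF ew nn(3)] by linarith
  \<comment> \<open>Absorption: 192 is 2 * 96, so the smallness hypothesis bounds this term by half
    of the left-hand side.\<close>
  also have "\<dots> = C * \<epsilon> + (192 * C * l) * (lp_sq w / 2) + R" by (simp add: distrib_left)
  also have "(192 * C * l) * (lp_sq w / 2) \<le> 1 * (lp_sq w / 2)"
    using lp_sq_nonneg[of w] small by (intro mult_right_mono) auto
  finally show "lp_sq w \<le> 2 * (C * \<epsilon> + R)" by simp
qed

lemma integral_bound:
  assumes [measurable]: "u \<in> borel_measurable M" and t: "0 < t" "power_int u \<le> ennreal (t powr p)"
  shows "\<bar>\<integral>x. u x \<partial>M\<bar> \<le> t * (measure M (space M) + 1)"
proof -
  have 1: "(\<integral>\<^sup>+x. ennreal \<bar>u x\<bar> \<partial>M) \<le> ennreal (t * (measure M (space M) + 1))"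
    using young_integral_bound[OF assms, of 1] p t by simp
  then have "integrable M u" by (intro integrableI_bounded) (auto intro: le_less_trans)
  then have "ennreal (\<integral>x. \<bar>u x\<bar> \<partial>M) \<le> ennreal (t * (measure M (space M) + 1))"
    using 1 by (subst nn_integral_eq_integral [symmetric]) auto
  then have "(\<integral>x. \<bar>u x\<bar> \<partial>M) \<le> t * (measure M (space M) + 1)" using t by (simp add: add_nonneg_nonneg)
  then show ?thesis using integral_abs_bound[of M u] by linarith
qed

section \<open>Lower semicontinuity and completeness\<close>

lemma energy_liminf:
  fixes f :: "nat \<Rightarrow> 'a \<Rightarrow> real"
  assumes [measurable]: "\<And>n. f n \<in> borel_measurable M" "u \<in> borel_measurable M"
    and lim: "AE x in M. (\<lambda>n. f n x) \<longlonglongrightarrow> u x"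
  shows "energy u \<le> liminf (\<lambda>n. energy (f n))"
proof -
  interpret pair: pair_sigma_finite M M ..
  have lim2: "AE z in M \<Otimes>\<^sub>M M. (\<lambda>n. f n (fst z)) \<longlonglongrightarrow> u (fst z) \<and> (\<lambda>n. f n (snd z)) \<longlonglongrightarrow> u (snd z)"
  proof (rule pair.AE_pair_measure)
    show "AE x in M. AE y in M. (\<lambda>n. f n (fst (x, y))) \<longlonglongrightarrow> u (fst (x, y)) \<and> (\<lambda>n. f n (snd (x, y))) \<longlonglongrightarrow> u (snd (x, y))"
      using lim
    proof eventually_elim
      case (elim x)
      show ?case using lim by eventually_elim (use elim in simp)
    qed
  qed measurable
  let ?g = "\<lambda>n z. (f n (fst z) - f n (snd z))\<^sup>2 * k z"
  have "energy u \<le> (\<integral>\<^sup>+z. liminf (\<lambda>n. ennreal (?g n z)) \<partial>(M \<Otimes>\<^sub>M M))"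
    unfolding energy_def
  proof (rule nn_integral_mono_AE)
    show "AE z in M \<Otimes>\<^sub>M M. ennreal ((u (fst z) - u (snd z))\<^sup>2 * k z) \<le> liminf (\<lambda>n. ennreal (?g n z))"
      using lim2
    proof eventually_elim
      case (elim z)
      have "(\<lambda>n. ennreal (?g n z)) \<longlonglongrightarrow> ennreal ((u (fst z) - u (snd z))\<^sup>2 * k z)"
        using elim by (intro tendsto_ennrealI tendsto_intros) auto
      from lim_imp_Liminf[OF _ this] show ?case by simp
    qed
  qed
  also have "\<dots> \<le> liminf (\<lambda>n. energy (f n))"
    unfolding energy_def by (rule nn_integral_liminf) measurable
  finally show ?thesis .
qed

lemma power_int_liminf:
  fixes f :: "nat \<Rightarrow> 'a \<Rightarrow> real"
  assumes [measurable]: "\<And>n. f n \<in> borel_measurable M" and lim: "AE x in M. (\<lambda>n. f n x) \<longlonglongrightarrow> u x"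
  shows "power_int u \<le> liminf (\<lambda>n. power_int (f n))"
proof -
  have "power_int u \<le> (\<integral>\<^sup>+x. liminf (\<lambda>n. ennreal (\<bar>f n x\<bar> powr p)) \<partial>M)"
    unfolding power_int_def
  proof (rule nn_integral_mono_AE)
    show "AE x in M. ennreal (\<bar>u x\<bar> powr p) \<le> liminf (\<lambda>n. ennreal (\<bar>f n x\<bar> powr p))"
      using lim
    proof eventually_elim
      case (elim x)
      have "(\<lambda>n. ennreal (\<bar>f n x\<bar> powr p)) \<longlonglongrightarrow> ennreal (\<bar>u x\<bar> powr p)"
        using p by (intro tendsto_ennrealI tendsto_powr' tendsto_intros elim) auto
      from lim_imp_Liminf[OF _ this] show ?case by simp
    qed
  qed
  also have "\<dots> \<le> liminf (\<lambda>n. power_int (f n))"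
    unfolding power_int_def by (rule nn_integral_liminf) measurable
  finally show ?thesis .
qed

text \<open>L^p smallness gives L^1 smallness on a finite measure space, hence a subsequence
  converging almost everywhere, and Fatou's lemma applied to \<open>f m - f (r n)\<close> as n grows
  transfers the Cauchy bounds to the limit. The last conjunct exports lower semicontinuity of the
  energy, since the subsequence itself stays hidden; this is what bounds the energy of the
  minimizer.\<close>

lemma energy_complete:
  fixes f :: "nat \<Rightarrow> 'a \<Rightarrow> real"
  assumes f [measurable]: "\<And>n. f n \<in> borel_measurable M"
    and C: "\<And>e::real. e > 0 \<Longrightarrow> \<exists>N. \<forall>m\<ge>N. \<forall>n\<ge>N. power_int (\<lambda>x. f m x - f n x) \<le> ennreal (e powr p) \<and> energy (\<lambda>x. f m x - f n x) \<le> ennreal e"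
  shows "\<exists>u. u \<in> borel_measurable M \<and>
     (\<forall>e>0. \<exists>N. \<forall>m\<ge>N. power_int (\<lambda>x. f m x - u x) \<le> ennreal (e powr p) \<and> energy (\<lambda>x. f m x - u x) \<le> ennreal e) \<and>
     (\<forall>b. (\<forall>e>0. \<exists>N. \<forall>n\<ge>N. energy (f n) \<le> ennreal (b + e)) \<longrightarrow> energy u \<le> ennreal b)"
proof -
  have "\<exists>N. \<forall>m\<ge>N. \<forall>n\<ge>N. (\<integral>\<^sup>+x. ennreal \<bar>f m x - f n x\<bar> \<partial>M) \<le> ennreal e" if "e > 0" for e
  proof -
    define t where "t = e / (measure M (space M) + 1)"
    have pos: "measure M (space M) + 1 > 0" by (simp add: add_nonneg_pos)
    then have t: "t > 0" "t * (measure M (space M) + 1) = e" using that by (auto simp: t_def)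
    obtain N where N: "\<forall>m\<ge>N. \<forall>n\<ge>N. power_int (\<lambda>x. f m x - f n x) \<le> ennreal (t powr p)" using C[OF t(1)] by blast
    have "(\<integral>\<^sup>+x. ennreal \<bar>f m x - f n x\<bar> \<partial>M) \<le> ennreal e" if "m \<ge> N" "n \<ge> N" for m n
      using young_integral_bound[of "\<lambda>x. f m x - f n x" t 1] N that p t by simp
    then show ?thesis by blast
  qed
  from L1_Cauchy_AE_subsequence[where f = f, OF f this]
  obtain r u where r: "strict_mono r" and u [measurable]: "u \<in> borel_measurable M"
    and lim: "AE x in M. (\<lambda>n. f (r n) x) \<longlonglongrightarrow> u x" by blast
  have ev_r: "\<forall>\<^sub>F n in sequentially. r n \<ge> N" for N
    using seq_suble[OF r] by (intro eventually_sequentiallyI[of N]) (meson order_trans)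
  have "\<exists>N. \<forall>m\<ge>N. power_int (\<lambda>x. f m x - u x) \<le> ennreal (e powr p) \<and> energy (\<lambda>x. f m x - u x) \<le> ennreal e" if "e > 0" for e
  proof -
    obtain N where N: "\<forall>m\<ge>N. \<forall>n\<ge>N. power_int (\<lambda>x. f m x - f n x) \<le> ennreal (e powr p) \<and> energy (\<lambda>x. f m x - f n x) \<le> ennreal e"
      using C[OF \<open>e > 0\<close>] by blast
    have "power_int (\<lambda>x. f m x - u x) \<le> ennreal (e powr p) \<and> energy (\<lambda>x. f m x - u x) \<le> ennreal e" if "m \<ge> N" for m
    proof -
      have lim': "AE x in M. (\<lambda>n. f m x - f (r n) x) \<longlonglongrightarrow> f m x - u x"
        using lim by eventually_elim (intro tendsto_diff tendsto_const)
      have "power_int (\<lambda>x. f m x - u x) \<le> liminf (\<lambda>n. power_int (\<lambda>x. f m x - f (r n) x))"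
        by (rule power_int_liminf[OF _ lim']) measurable
      also have "\<dots> \<le> ennreal (e powr p)"
        using ev_r[of N] N that by (intro Liminf_le) (auto elim!: eventually_mono)
      finally have 1: "power_int (\<lambda>x. f m x - u x) \<le> ennreal (e powr p)" .
      have "energy (\<lambda>x. f m x - u x) \<le> liminf (\<lambda>n. energy (\<lambda>x. f m x - f (r n) x))"
        by (rule energy_liminf[OF _ _ lim']) measurable
      also have "\<dots> \<le> ennreal e"
        using ev_r[of N] N that by (intro Liminf_le) (auto elim!: eventually_mono)
      finally show ?thesis using 1 by blast
    qed
    then show ?thesis by blast
  qed
  moreover have "energy u \<le> ennreal b" if b: "\<forall>e>0. \<exists>N. \<forall>n\<ge>N. energy (f n) \<le> ennreal (b + e)" for b
  proof -
    have le: "energy u \<le> liminf (\<lambda>n. energy (f (r n)))"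
      by (rule energy_liminf[OF _ u lim]) measurable
    have "energy u \<le> ennreal (b + e)" if e: "e > 0" for e
    proof -
      obtain N where "\<forall>n\<ge>N. energy (f n) \<le> ennreal (b + e)" using b e by blast
      then have "liminf (\<lambda>n. energy (f (r n))) \<le> ennreal (b + e)"
        using ev_r[of N] by (intro Liminf_le) (auto elim!: eventually_mono)
      then show ?thesis using le by (rule order_trans[rotated])
    qed
    note bound = this
    have "((\<lambda>e. ennreal (b + e)) \<longlongrightarrow> ennreal (b + 0)) (at_right 0)"
      by (intro tendsto_ennrealI tendsto_intros)
    then show ?thesis
      by (intro tendsto_lowerbound[where F = "at_right (0::real)" and f = "\<lambda>e. ennreal (b + e)"])
         (auto simp: eventually_at_right_field bound intro!: exI[of _ 1])
  qed
  ultimately show ?thesis using u by blast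
qed


text \<open>The test function u0 provides the gap \<open>192 * C * l \<le> 1\<close> that
  \<open>half_difference_bound\<close> asks for. The term with D in \<open>sob\<close> may have any
  size, because the means of the normalized sequence can be made convergent. The hypothesis
  \<open>closed\<close> has the form in which \<open>energy_complete\<close> delivers the
  limit.\<close>

lemma minimizer_exists:
  assumes Vm: "V \<subseteq> borel_measurable M"
    and lin: "\<And>u v a b. u \<in> V \<Longrightarrow> v \<in> V \<Longrightarrow> (\<lambda>x. a * u x + b * v x) \<in> V"
    and Efin: "\<And>u. u \<in> V \<Longrightarrow> energy u < \<infinity>"
    and Pfin: "\<And>u. u \<in> V \<Longrightarrow> power_int u < \<infinity>"
    and sob: "\<And>u. u \<in> V \<Longrightarrow> lp_sq u \<le> C * enn2real (energy u) + D * (\<integral>x. u x \<partial>M)\<^sup>2"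
    and CD: "0 < C" "0 \<le> D"
    and closed: "\<And>(f :: nat \<Rightarrow> _) u. (\<And>n. f n \<in> V) \<Longrightarrow> u \<in> borel_measurable M \<Longrightarrow> energy u < \<infinity> \<Longrightarrow>
       (\<And>e. e > 0 \<Longrightarrow> \<exists>N. \<forall>m\<ge>N. power_int (\<lambda>x. f m x - u x) \<le> ennreal (e powr p) \<and> energy (\<lambda>x. f m x - u x) \<le> ennreal e) \<Longrightarrow> u \<in> V"
    and u0: "u0 \<in> V" "\<not> (AE x in M. u0 x = 0)" "192 * C * (enn2real (energy u0) / lp_sq u0) \<le> 1"
  shows "\<exists>u\<in>V. \<not> (AE x in M. u x = 0) \<and>
     enn2real (energy u) / lp_sq u = Inf {enn2real (energy u) / lp_sq u | u. u \<in> V \<and> \<not> (AE x in M. u x = 0)}"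
proof -
  define R where "R = {enn2real (energy u) / lp_sq u | u. u \<in> V \<and> \<not> (AE x in M. u x = 0)}"
  define l where "l = Inf R"
  have meas: "u \<in> borel_measurable M" if "u \<in> V" for u using that Vm by auto
  have bdd: "bdd_below R" unfolding R_def by (rule bdd_belowI[of _ 0]) (auto simp: lp_sq_nonneg)
  have u0R: "enn2real (energy u0) / lp_sq u0 \<in> R" using u0 by (auto simp: R_def)
  have l0: "0 \<le> l" unfolding l_def using u0R by (intro cInf_greatest) (auto simp: R_def lp_sq_nonneg)
  have lu0: "l \<le> enn2real (energy u0) / lp_sq u0" unfolding l_def by (rule cInf_lower[OF u0R bdd])
  have small: "192 * C * l \<le> 1"
    using mult_left_mono[OF lu0, of "192 * C"] u0(3) CD by simp
  have pos: "lp_sq u > 0" if "u \<in> V" "\<not> (AE x in M. u x = 0)" for u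
  proof -
    have "power_int u \<noteq> 0" using power_int_eq_0_iff[OF meas] that by auto
    then show ?thesis using Pfin[OF that(1)] by (auto simp: lp_sq_def enn2real_eq_0_iff)
  qed
  have low: "l * lp_sq u \<le> enn2real (energy u)" if "u \<in> V" for u
  proof (cases "AE x in M. u x = 0")
    case True
    then have "power_int u = 0" using power_int_eq_0_iff[OF meas] that by auto
    then show ?thesis by (simp add: lp_sq_def)
  next
    case False
    then have "l \<le> enn2real (energy u) / lp_sq u" unfolding l_def using that bdd by (intro cInf_lower) (auto simp: R_def)
    then show ?thesis using pos[OF that False] by (simp add: field_simps)
  qed
  have "\<exists>u\<in>V. power_int u = 1 \<and> energy u \<le> ennreal (l + 1 / real (Suc n))" for n
  proof -
    have "l < l + 1 / real (Suc n)" by simp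
    then obtain y where "y \<in> R" "y < l + 1 / real (Suc n)"
      using cInf_less_iff[of R] u0R bdd unfolding l_def by blast
    then obtain u where u: "u \<in> V" "\<not> (AE x in M. u x = 0)" "enn2real (energy u) / lp_sq u < l + 1 / real (Suc n)"
      by (auto simp: R_def)
    have [measurable]: "u \<in> borel_measurable M" by (rule meas) fact
    define c where "c = 1 / sqrt (lp_sq u)"
    have c: "c > 0" "c\<^sup>2 = 1 / lp_sq u" using pos[OF u(1,2)] by (auto simp: c_def power_divide)
    have V: "(\<lambda>x. c * u x) \<in> V" using lin[OF u(1) u(1), of c 0] by simp
    have "lp_sq (\<lambda>x. c * u x) = 1" using pos[OF u(1,2)] by (simp add: lp_sq_cmult c)
    moreover have "a = 1" if "a powr (2 / p) = 1" "a \<ge> 0" for a :: real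
      using that p powr_eq_one_iff_gen[of a "2 / p"] by (cases "a = 0") auto
    ultimately have "enn2real (power_int (\<lambda>x. c * u x)) = 1"
      unfolding lp_sq_def using enn2real_nonneg by blast
    then have "power_int (\<lambda>x. c * u x) = 1" using Pfin[OF V]
      by (cases "power_int (\<lambda>x. c * u x)" rule: ennreal_cases) auto
    moreover have "energy (\<lambda>x. c * u x) \<le> ennreal (l + 1 / real (Suc n))"
    proof -
      have "energy (\<lambda>x. c * u x) = ennreal (c\<^sup>2) * ennreal (enn2real (energy u))"
        using Efin[OF u(1)] by (simp add: energy_cmult)
      also have "\<dots> = ennreal (enn2real (energy u) / lp_sq u)" by (simp add: c ennreal_mult' [symmetric] lp_sq_nonneg)
      finally show ?thesis using u(3) by (simp add: ennreal_leI less_imp_le)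
    qed
    ultimately show ?thesis using V by blast
  qed
  then obtain f0 where f0: "\<And>n. f0 n \<in> V" "\<And>n. power_int (f0 n) = 1" "\<And>n. energy (f0 n) \<le> ennreal (l + 1 / real (Suc n))"
    by metis
  define B where "B = measure M (space M) + 1"
  have "\<bar>\<integral>x. f0 n x \<partial>M\<bar> \<le> B" for n
    using integral_bound[OF meas[OF f0(1)], of 1] f0(2) by (simp add: B_def)
  then have "bounded (range (\<lambda>n. \<integral>x. f0 n x \<partial>M))" by (auto simp: bounded_iff)
  then obtain a h where h: "strict_mono h" and a: "((\<lambda>n. \<integral>x. f0 n x \<partial>M) \<circ> h) \<longlonglongrightarrow> a"
    using bounded_imp_convergent_subsequence by blast
  define f where "f n = f0 (h n)" for n
  have f: "f n \<in> V" "power_int (f n) = 1" for n using f0 by (auto simp: f_def)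
  have fm [measurable]: "f n \<in> borel_measurable M" for n by (rule meas) (rule f)
  have fE: "energy (f n) \<le> ennreal (l + 1 / real (Suc N))" if "n \<ge> N" for n N
  proof -
    have "N \<le> h n" using that seq_suble[OF h, of n] by simp
    then have "1 / real (Suc (h n)) \<le> 1 / real (Suc N)" by (simp add: frac_le)
    then have "ennreal (l + 1 / real (Suc (h n))) \<le> ennreal (l + 1 / real (Suc N))" by (intro ennreal_leI) simp
    then show ?thesis using f0(3)[of "h n"] by (auto simp: f_def intro: order_trans)
  qed
  have fE': "\<exists>N. \<forall>n\<ge>N. energy (f n) \<le> ennreal (l + e)" if "e > 0" for e
  proof -
    obtain N where "1 / real (Suc N) < e" using \<open>e > 0\<close> nat_approx_posE by blast
    then have "ennreal (l + 1 / real (Suc N)) \<le> ennreal (l + e)" by (intro ennreal_leI) simp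
    then show ?thesis using fE by (meson order_trans)
  qed
  have fint: "integrable M (f n)" for n
  proof (rule integrableI_bounded)
    have "(\<integral>\<^sup>+x. ennreal \<bar>f n x\<bar> \<partial>M) \<le> ennreal (1 * (measure M (space M) + 1))"
      using young_integral_bound[OF fm, of 1 n 1] f(2)[of n] p by simp
    then show "(\<integral>\<^sup>+x. ennreal (norm (f n x)) \<partial>M) < \<infinity>" by (auto intro: le_less_trans)
  qed simp
  have aC: "Cauchy (\<lambda>n. \<integral>x. f n x \<partial>M)" using a unfolding f_def comp_def by (rule LIMSEQ_imp_Cauchy)
  have halfV: "(\<lambda>x. (u x + v x) / 2) \<in> V" "(\<lambda>x. (u x - v x) / 2) \<in> V" if "u \<in> V" "v \<in> V" for u v
    using lin[OF that, of "1/2" "1/2"] lin[OF that, of "1/2" "-1/2"] by (simp_all add: field_simps)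
  have Cau: "\<exists>N. \<forall>m\<ge>N. \<forall>n\<ge>N. power_int (\<lambda>x. f m x - f n x) \<le> ennreal (e powr p) \<and> energy (\<lambda>x. f m x - f n x) \<le> ennreal e"
    if "e > 0" for e
  proof -
    \<comment> \<open>f m - f n is 2w, so its squared norm and its energy are 4 times those of w.
      The first entry of the minimum makes 4 times \<open>lp_sq\<close> of w at most e^2, the second
      makes the term with 96 l at most e/8. Below, \<open>\<epsilon>\<close> and
      \<open>\<eta>\<close> make C times \<open>\<epsilon>\<close> and the mean term at most
      \<open>\<delta> / 4\<close> each, and 2 * (1/4 + 1/4) = 1.\<close>
    define \<delta> where "\<delta> = min (e\<^sup>2 / 4) (e / (8 * (96 * l + 1)))"
    have \<delta>: "\<delta> > 0" using \<open>e > 0\<close> l0 by (auto simp: \<delta>_def add_nonneg_pos)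
    define \<epsilon> where "\<epsilon> = min (\<delta> / (4 * C)) (e / 8)"
    have \<epsilon>: "\<epsilon> > 0" using \<delta> \<open>e > 0\<close> CD by (auto simp: \<epsilon>_def)
    define \<eta> where "\<eta> = sqrt (\<delta> / (D + 1))"
    have \<eta>: "\<eta> > 0" "\<eta>\<^sup>2 = \<delta> / (D + 1)" using \<delta> CD by (auto simp: \<eta>_def)
    obtain N1 where N1: "\<forall>n\<ge>N1. energy (f n) \<le> ennreal (l + \<epsilon>)" using fE'[OF \<epsilon>] by blast
    obtain N2 where N2: "\<forall>m\<ge>N2. \<forall>n\<ge>N2. \<bar>(\<integral>x. f m x \<partial>M) - (\<integral>x. f n x \<partial>M)\<bar> < \<eta>"
      using aC \<eta>(1) unfolding Cauchy_def dist_real_def by blast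
    have "power_int (\<lambda>x. f m x - f n x) \<le> ennreal (e powr p) \<and> energy (\<lambda>x. f m x - f n x) \<le> ennreal e"
      if "m \<ge> max N1 N2" "n \<ge> max N1 N2" for m n
    proof -
      let ?w = "\<lambda>x. (f m x - f n x) / 2"
      have wV: "?w \<in> V" by (intro halfV f)
      define r where "r = D * (\<integral>x. ?w x \<partial>M)\<^sup>2"
      have "(\<integral>x. ?w x \<partial>M) = ((\<integral>x. f m x \<partial>M) - (\<integral>x. f n x \<partial>M)) / 2"
        using fint by simp
      moreover have "\<bar>(\<integral>x. f m x \<partial>M) - (\<integral>x. f n x \<partial>M)\<bar> < \<eta>" using N2 that by auto
      ultimately have "\<bar>\<integral>x. ?w x \<partial>M\<bar> \<le> \<eta> / 2" by simp
      then have "(\<integral>x. ?w x \<partial>M)\<^sup>2 \<le> (\<eta> / 2)\<^sup>2" using abs_le_square_iff[of "\<integral>x. ?w x \<partial>M" "\<eta>/2"] \<eta> by simp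
      also have "\<dots> = \<delta> / (D + 1) / 4" by (simp add: power_divide \<eta>)
      finally have "r \<le> D * (\<delta> / (D + 1) / 4)" unfolding r_def using CD by (intro mult_left_mono)
      also have "\<dots> \<le> \<delta> / 4" using CD \<delta> by (simp add: field_simps)
      finally have r: "r \<le> \<delta> / 4" .
      have *: "lp_sq ?w \<le> 2 * (C * \<epsilon> + r)" "enn2real (energy ?w) \<le> \<epsilon> + 96 * l * lp_sq ?w"
      proof -
        have e1: "energy (f m) \<le> ennreal (l + \<epsilon>)" and e2: "energy (f n) \<le> ennreal (l + \<epsilon>)"
          using N1 that by auto
        have sobw: "lp_sq ?w \<le> C * enn2real (energy ?w) + r" unfolding r_def by (rule sob) (rule wV)
        note hd = half_difference_bound[OF fm fm f(2) f(2) e1 e2 l0 less_imp_le[OF \<epsilon>] less_imp_le[OF CD(1)]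
            Pfin[OF halfV(1)[OF f(1) f(1)]] Pfin[OF wV] low[OF halfV(1)[OF f(1) f(1)]] sobw small]
        show "lp_sq ?w \<le> 2 * (C * \<epsilon> + r)" by (rule hd(1))
        show "enn2real (energy ?w) \<le> \<epsilon> + 96 * l * lp_sq ?w" by (rule hd(2))
      qed
      have "C * \<epsilon> \<le> \<delta> / 4" using CD by (simp add: \<epsilon>_def min_def field_simps)
      then have w: "lp_sq ?w \<le> \<delta>" using * r by simp
      have "energy ?w \<le> ennreal (e / 4)"
      proof -
        have "96 * l * lp_sq ?w \<le> 96 * l * (e / (8 * (96 * l + 1)))" using w l0 by (intro mult_left_mono) (auto simp: \<delta>_def)
        also have "\<dots> \<le> e / 8" using l0 \<open>e > 0\<close> by (simp add: field_simps)
        finally have "enn2real (energy ?w) \<le> e / 8 + e / 8" using *(2) by (simp add: \<epsilon>_def)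
        then have "ennreal (enn2real (energy ?w)) \<le> ennreal (e / 4)" by (intro ennreal_leI) simp
        then show ?thesis using Efin[OF wV] by simp
      qed
      moreover have "energy (\<lambda>x. f m x - f n x) = ennreal 4 * energy ?w"
        using energy_cmult[of ?w 2] by (simp add: diff_divide_distrib)
      ultimately have "energy (\<lambda>x. f m x - f n x) \<le> ennreal 4 * ennreal (e / 4)"
        using mult_left_mono by fastforce
      then have 2: "energy (\<lambda>x. f m x - f n x) \<le> ennreal e" using ennreal_mult[of 4 "e / 4"] \<open>e > 0\<close> by simp
      have "lp_sq (\<lambda>x. f m x - f n x) = 4 * lp_sq ?w" using lp_sq_cmult[of ?w 2] by (simp add: diff_divide_distrib)
      also have "\<dots> \<le> e\<^sup>2" using w by (simp add: \<delta>_def)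
      finally have "power_int (\<lambda>x. f m x - f n x) \<le> ennreal (e powr p)"
        using lin[OF f(1)[of m] f(1)[of n], of 1 "-1"] \<open>e > 0\<close> by (intro power_int_le_powr Pfin) auto
      with 2 show ?thesis by blast
    qed
    then show ?thesis by blast
  qed
  from energy_complete[where f = f, OF fm this]
  obtain u where um [measurable]: "u \<in> borel_measurable M"
    and uc: "\<And>e. e > 0 \<Longrightarrow> \<exists>N. \<forall>m\<ge>N. power_int (\<lambda>x. f m x - u x) \<le> ennreal (e powr p) \<and> energy (\<lambda>x. f m x - u x) \<le> ennreal e"
    and uE: "\<forall>e>0. \<exists>N. \<forall>n\<ge>N. energy (f n) \<le> ennreal (l + e) \<Longrightarrow> energy u \<le> ennreal l"
    by blast
  have uE: "energy u \<le> ennreal l" using uE fE' by blast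
  have uV: "u \<in> V"
    by (rule closed[of f, OF f(1) um _ uc]) (use uE in \<open>simp_all add: le_less_trans\<close>)
  \<comment> \<open>No mass is lost in the limit: convergence in L^p preserves the normalization, up
    to a factor that tends to 1 with \<open>\<theta>\<close>.\<close>
  have split: "1 \<le> enn2real (power_int u) / (1 - \<theta>) powr p" if \<theta>: "0 < \<theta>" "\<theta> < 1" for \<theta>
  proof (rule field_le_epsilon)
    fix \<eta> :: real assume "\<eta> > 0"
    define e where "e = \<theta> * \<eta> powr (1 / p)"
    have e: "e > 0" "e powr p / \<theta> powr p = \<eta>" using \<open>\<eta> > 0\<close> \<theta> p by (auto simp: e_def powr_mult powr_powr)
    obtain m where m: "power_int (\<lambda>x. f m x - u x) \<le> ennreal (e powr p)" using uc[OF e(1)] by blast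
    have "power_int (f m) \<le> ennreal (1 / (1 - \<theta>) powr p) * power_int u + ennreal (1 / \<theta> powr p) * power_int (\<lambda>x. f m x - u x)"
      unfolding power_int_def
    proof (rule nn_integral_real_lincomb_le)
      show "\<bar>f m x\<bar> powr p \<le> 1 / (1 - \<theta>) powr p * \<bar>u x\<bar> powr p + 1 / \<theta> powr p * \<bar>f m x - u x\<bar> powr p" for x
        using abs_powr_le_split[of p \<theta> "f m x" "u x"] \<theta> p by simp
    qed auto
    also have "\<dots> \<le> ennreal (1 / (1 - \<theta>) powr p) * ennreal (enn2real (power_int u)) + ennreal (1 / \<theta> powr p) * ennreal (e powr p)"
      using Pfin[OF uV] by (intro add_mono mult_left_mono m) auto
    also have "\<dots> = ennreal (enn2real (power_int u) / (1 - \<theta>) powr p + \<eta>)"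
      using e(2) \<open>\<eta> > 0\<close> by (subst ennreal_plus) (auto simp: ennreal_mult'' [symmetric])
    finally show "1 \<le> enn2real (power_int u) / (1 - \<theta>) powr p + \<eta>"
      using f(2)[of m] by (simp add: ennreal_ge_1 del: ennreal_plus)
  qed
  have u1: "1 \<le> enn2real (power_int u)"
  proof (rule tendsto_upperbound[where F = "at_right (0::real)" and f = "\<lambda>\<theta>. (1 - \<theta>) powr p"])
    have "((\<lambda>\<theta>::real. (1 - \<theta>) powr p) \<longlongrightarrow> (1 - 0) powr p) (at_right 0)" by (intro tendsto_intros) auto
    then show "((\<lambda>\<theta>::real. (1 - \<theta>) powr p) \<longlongrightarrow> 1) (at_right 0)" by simp
    show "\<forall>\<^sub>F \<theta> in at_right 0. (1 - \<theta>) powr p \<le> enn2real (power_int u)"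
      unfolding eventually_at_right_field
    proof (intro exI[of _ 1] conjI allI impI)
      fix y :: real assume "0 < y" "y < 1"
      then show "(1 - y) powr p \<le> enn2real (power_int u)"
        using split[of y] by (simp add: field_simps)
    qed simp
  qed simp
  then have nz: "\<not> (AE x in M. u x = 0)" using power_int_eq_0_iff[OF um] by auto
  have "1 \<le> lp_sq u" unfolding lp_sq_def using u1 p by (intro ge_one_powr_ge_zero) auto
  moreover have "enn2real (energy u) \<le> l" using uE l0 by (simp add: enn2real_leI)
  ultimately have "enn2real (energy u) / lp_sq u \<le> l"
    using frac_le[of l "enn2real (energy u)" 1 "lp_sq u"] l0 by simp
  moreover have "l \<le> enn2real (energy u) / lp_sq u"
    unfolding l_def using uV nz bdd by (intro cInf_lower) (auto simp: R_def)
  ultimately have "enn2real (energy u) / lp_sq u = Inf R" unfolding l_def by simp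
  then show ?thesis using uV nz unfolding R_def by blast
qed

end

section \<open>The Poincare--Sobolev inequality\<close>

definition average :: "'a measure \<Rightarrow> 'a set \<Rightarrow> ('a \<Rightarrow> real) \<Rightarrow> real" where
  "average M A u = (\<integral>x\<in>A. u x \<partial>M) / measure M A"

context finite_measure
begin

lemma integrable_of_square:
  fixes u :: "'a \<Rightarrow> real"
  assumes [measurable]: "u \<in> borel_measurable M" and "(\<integral>\<^sup>+x. ennreal ((u x)\<^sup>2) \<partial>M) < \<infinity>"
  shows "integrable M (\<lambda>x. (u x)\<^sup>2)" "integrable M u"
proof -
  show 2: "integrable M (\<lambda>x. (u x)\<^sup>2)" using assms by (intro integrableI_bounded) auto
  have *: "\<bar>t\<bar> \<le> 1 + t\<^sup>2" for t :: real
  proof -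
    have "2 * \<bar>t\<bar> \<le> 1 + \<bar>t\<bar>\<^sup>2" using zero_le_power2[of "\<bar>t\<bar> - 1"] unfolding power2_diff by simp
    then show ?thesis unfolding power2_abs using abs_ge_zero[of t] by linarith
  qed
  have "integrable M (\<lambda>x. 1 + (u x)\<^sup>2)" using 2 by simp
  then show "integrable M u"
    by (rule Bochner_Integration.integrable_bound) (simp_all add: * add_nonneg_nonneg)
qed

text \<open>The variance decomposition: over A, the integral of (b - u)^2 exceeds its value at b =
  mean by the measure of A times the squared distance of b from the mean. Multiplying by the measure
  rather than dividing by it makes null sets trivial.\<close>

lemma average_deviation:
  fixes u :: "'a \<Rightarrow> real"
  assumes [measurable]: "u \<in> borel_measurable M" "A \<in> sets M" and sq: "(\<integral>\<^sup>+x. ennreal ((u x)\<^sup>2) \<partial>M) < \<infinity>"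
  shows "ennreal (measure M A * (b - average M A u)\<^sup>2) \<le> (\<integral>\<^sup>+x\<in>A. ennreal ((b - u x)\<^sup>2) \<partial>M)"
proof (cases "measure M A = 0")
  case False
  define \<mu> where "\<mu> = measure M A"
  have \<mu>: "\<mu> > 0" using False by (simp add: \<mu>_def zero_less_measure_iff)
  note int = integrable_of_square[OF assms(1) sq]
  have [simp]: "set_integrable M A u" "set_integrable M A (\<lambda>x. (u x)\<^sup>2)"
    using int unfolding set_integrable_def by (intro integrable_mult_indicator; simp)+
  have [simp]: "set_integrable M A (\<lambda>x. d)" for d :: real
    unfolding set_integrable_def by (rule integrable_mult_indicator) auto
  define I where "I = (\<integral>x\<in>A. u x \<partial>M)"
  define J where "J = (\<integral>x\<in>A. (u x)\<^sup>2 \<partial>M)"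
  have I2: "set_integrable M A (\<lambda>x. (d - u x)\<^sup>2)" for d
  proof -
    have "set_integrable M A (\<lambda>x. d\<^sup>2 - (2 * d) * u x + (u x)\<^sup>2)"
      by (intro set_integral_add set_integral_diff set_integrable_mult_right) auto
    then show ?thesis by (simp add: power2_diff algebra_simps)
  qed
  have exp: "(\<integral>x\<in>A. (d - u x)\<^sup>2 \<partial>M) = d\<^sup>2 * \<mu> - 2 * d * I + J" for d
  proof -
    have "(\<integral>x\<in>A. (d - u x)\<^sup>2 \<partial>M) = (\<integral>x\<in>A. (d\<^sup>2 - (2 * d) * u x) + (u x)\<^sup>2 \<partial>M)"
      by (simp add: power2_diff algebra_simps)
    also have "\<dots> = (\<integral>x\<in>A. d\<^sup>2 - (2 * d) * u x \<partial>M) + J"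
      unfolding J_def by (rule set_integral_add) (auto intro!: set_integral_diff set_integrable_mult_right)
    also have "(\<integral>x\<in>A. d\<^sup>2 - (2 * d) * u x \<partial>M) = (\<integral>x\<in>A. d\<^sup>2 \<partial>M) - (\<integral>x\<in>A. (2 * d) * u x \<partial>M)"
      by (rule set_integral_diff) (auto intro!: set_integrable_mult_right)
    also have "(\<integral>x\<in>A. d\<^sup>2 \<partial>M) = d\<^sup>2 * \<mu>" by (simp add: set_lebesgue_integral_def \<mu>_def)
    also have "(\<integral>x\<in>A. (2 * d) * u x \<partial>M) = 2 * d * I" unfolding I_def by simp
    finally show ?thesis .
  qed
  \<comment> \<open>Nonnegativity at b = mean is the Cauchy-Schwarz inequality; inserted into the
    same expansion at the given b it yields the claim.\<close>
  have "0 \<le> (\<integral>x\<in>A. (I / \<mu> - u x)\<^sup>2 \<partial>M)" unfolding set_lebesgue_integral_def by (rule integral_nonneg_AE) auto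
  then have "I\<^sup>2 / \<mu> \<le> J" unfolding exp using \<mu> by (simp add: field_simps power2_eq_square)
  then have "\<mu> * (b - I / \<mu>)\<^sup>2 \<le> (\<integral>x\<in>A. (b - u x)\<^sup>2 \<partial>M)" unfolding exp using \<mu> by (simp add: field_simps power2_eq_square)
  then have "ennreal (\<mu> * (b - I / \<mu>)\<^sup>2) \<le> ennreal (\<integral>x\<in>A. (b - u x)\<^sup>2 \<partial>M)" by (rule ennreal_leI)
  also have "\<dots> = (\<integral>\<^sup>+x\<in>A. ennreal ((b - u x)\<^sup>2) \<partial>M)"
    using I2[of b] unfolding set_lebesgue_integral_def set_integrable_def
    by (subst nn_integral_eq_integral [symmetric]) (auto intro!: nn_integral_cong simp: indicator_def)
  finally show ?thesis by (simp add: average_def \<mu>_def I_def)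
qed simp

lemma average_difference:
  fixes u :: "'a \<Rightarrow> real"
  assumes [measurable]: "u \<in> borel_measurable M" "A \<in> sets M" "B \<in> sets M" and sq: "(\<integral>\<^sup>+x. ennreal ((u x)\<^sup>2) \<partial>M) < \<infinity>"
  shows "ennreal (measure M A * measure M B * (average M A u - average M B u)\<^sup>2)
    \<le> (\<integral>\<^sup>+x\<in>A. (\<integral>\<^sup>+y\<in>B. ennreal ((u x - u y)\<^sup>2) \<partial>M) \<partial>M)"
proof -
  have "ennreal (measure M A * measure M B * (average M A u - average M B u)\<^sup>2)
    = ennreal (measure M B) * ennreal (measure M A * (average M B u - average M A u)\<^sup>2)"
    by (simp add: ennreal_mult' [symmetric] power2_commute mult_ac)
  also have "\<dots> \<le> ennreal (measure M B) * (\<integral>\<^sup>+x\<in>A. ennreal ((average M B u - u x)\<^sup>2) \<partial>M)"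
    by (intro mult_left_mono average_deviation sq) auto
  also have "\<dots> = (\<integral>\<^sup>+x\<in>A. ennreal (measure M B * (u x - average M B u)\<^sup>2) \<partial>M)"
    by (subst nn_integral_cmult [symmetric]) (auto simp: ennreal_mult' mult_ac power2_commute)
  also have "\<dots> \<le> (\<integral>\<^sup>+x\<in>A. (\<integral>\<^sup>+y\<in>B. ennreal ((u x - u y)\<^sup>2) \<partial>M) \<partial>M)"
    by (intro nn_integral_mono mult_right_mono average_deviation sq) auto
  finally show ?thesis .
qed

end

text \<open>Optimizing over the dyadic radii \<open>r\<^sub>j = R / 2\<^sup>j\<close>, which is where the critical exponent comes from.\<close>
lemma dyadic_optimization:
  fixes X L R s n \<gamma> e :: real
  assumes pos: "0 \<le> L" "0 < R" "0 \<le> \<gamma>" "0 < e" "0 < s" "2 * s < n"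
    and X0: "X \<le> L * (R powr s * sqrt \<gamma>)"
    and X: "\<And>j. X \<le> L * ((R / 2 ^ j) powr s * sqrt \<gamma> + (R / 2 ^ j) powr (s - n / 2) * sqrt e)"
  shows "X \<le> 2 * 2 powr n * L * (e powr (s / n) * \<gamma> powr (1 / 2 - s / n))"
\<comment> \<open>In the first case the balancing radius (e / \<gamma>)^(1/n) is at least R, at the
  edge of or outside the admissible range, and \<open>X0\<close>, the bound at the largest radius
  free of the second term, already suffices.\<close>
proof (cases "\<gamma> * R powr n \<le> e")
  case True
  show ?thesis
  proof (cases "\<gamma> = 0")
    case False
    then have \<gamma>: "\<gamma> > 0" using pos by simp
    have "R powr s * sqrt \<gamma> = (\<gamma> * R powr n) powr (s / n) * \<gamma> powr (1 / 2 - s / n)"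
      using \<gamma> pos by (simp add: powr_mult powr_powr powr_half_sqrt [symmetric] powr_diff)
    also have "\<dots> \<le> e powr (s / n) * \<gamma> powr (1 / 2 - s / n)"
      using True pos by (intro mult_right_mono powr_mono2) auto
    finally have "L * (R powr s * sqrt \<gamma>) \<le> 1 * (L * (e powr (s / n) * \<gamma> powr (1 / 2 - s / n)))"
      using pos by (simp add: mult_left_mono)
    also have "\<dots> \<le> (2 * 2 powr n) * (L * (e powr (s / n) * \<gamma> powr (1 / 2 - s / n)))"
      using pos ge_one_powr_ge_zero[of 2 n] by (intro mult_right_mono) auto
    finally show ?thesis using X0 by (simp add: mult_ac)
  qed (use X0 in simp)
next
  case False
  then have \<gamma>: "\<gamma> > 0" using pos by (cases "\<gamma> = 0") auto
  \<comment> \<open>Solves \<open>\<rho> powr s * sqrt \<gamma> = \<rho> powr (s - n / 2) * sqrt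
    e\<close>; both sides then equal the target expression.\<close>
  define \<rho> where "\<rho> = (e / \<gamma>) powr (1 / n)"
  have \<rho>: "\<rho> > 0" using \<gamma> pos by (simp add: \<rho>_def)
  have "e / \<gamma> < R powr n" using False \<gamma> by (simp add: field_simps)
  then have "\<rho> < (R powr n) powr (1 / n)" unfolding \<rho>_def using \<gamma> pos by (intro powr_less_mono2) auto
  then have \<rho>R: "\<rho> < R" using pos by (simp add: powr_powr)
  have "\<exists>j. R / 2 ^ j \<le> \<rho>"
  proof -
    obtain j where "R / \<rho> < 2 ^ j" using real_arch_pow[of 2 "R / \<rho>"] by auto
    then show ?thesis using \<rho> by (intro exI[of _ j]) (simp add: field_simps)
  qed
  \<comment> \<open>Minimality of j keeps the dyadic radius above \<open>\<rho> / 2\<close>, which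
    costs a factor 2^(n/2 - s), at most 2^n, in the term with the negative exponent.\<close>
  define j where "j = (LEAST j. R / 2 ^ j \<le> \<rho>)"
  have j: "R / 2 ^ j \<le> \<rho>" unfolding j_def using \<open>\<exists>j. R / 2 ^ j \<le> \<rho>\<close> by (rule LeastI_ex)
  then obtain i where i: "j = Suc i" using \<rho>R by (cases j) auto
  have "\<not> R / 2 ^ i \<le> \<rho>" using not_less_Least[of i "\<lambda>j. R / 2 ^ j \<le> \<rho>"] i unfolding j_def by auto
  then have j2: "\<rho> / 2 \<le> R / 2 ^ j" using i by (simp add: field_simps)
  have a: "(R / 2 ^ j) powr s * sqrt \<gamma> \<le> \<rho> powr s * sqrt \<gamma>"
    using j pos by (intro mult_right_mono powr_mono2) auto
  have b: "(R / 2 ^ j) powr (s - n / 2) \<le> 2 powr n * \<rho> powr (s - n / 2)"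
  proof -
    have "(R / 2 ^ j) powr (s - n / 2) \<le> (\<rho> / 2) powr (s - n / 2)"
      using j2 \<rho> pos by (intro powr_mono2') auto
    also have "\<dots> = 2 powr (n / 2 - s) * \<rho> powr (s - n / 2)"
      using powr_minus_divide[of 2 "n / 2 - s"] by (simp add: powr_divide)
    also have "\<dots> \<le> 2 powr n * \<rho> powr (s - n / 2)" using pos by (intro mult_right_mono powr_mono) auto
    finally show ?thesis .
  qed
  have sq: "sqrt \<gamma> = \<gamma> powr (1 / 2)" "sqrt e = e powr (1 / 2)" using \<gamma> pos by (simp_all add: powr_half_sqrt)
  have "\<rho> powr s = e powr (s / n) / \<gamma> powr (s / n)" by (simp add: \<rho>_def powr_powr powr_divide)
  then have eq1: "\<rho> powr s * sqrt \<gamma> = e powr (s / n) * \<gamma> powr (1 / 2 - s / n)"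
    unfolding sq powr_diff by simp
  have ne: "(1 / n) * (s - n / 2) = s / n - 1 / 2" using pos by (simp add: field_simps)
  have "\<rho> powr (s - n / 2) = e powr (s / n - 1 / 2) / \<gamma> powr (s / n - 1 / 2)"
    unfolding \<rho>_def powr_powr ne by (rule powr_divide)
  also have "\<dots> = e powr (s / n - 1 / 2) * \<gamma> powr (1 / 2 - s / n)"
    using powr_minus_divide[of \<gamma> "s / n - 1 / 2"] by simp
  finally have "\<rho> powr (s - n / 2) * sqrt e = (e powr (s / n - 1 / 2) * e powr (1 / 2)) * \<gamma> powr (1 / 2 - s / n)"
    unfolding sq by simp
  then have eq2: "\<rho> powr (s - n / 2) * sqrt e = e powr (s / n) * \<gamma> powr (1 / 2 - s / n)"
    unfolding powr_add [symmetric] by simp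
  let ?Z = "e powr (s / n) * \<gamma> powr (1 / 2 - s / n)"
  have one: "1 \<le> 2 powr n" using pos by (intro ge_one_powr_ge_zero) auto
  have "(R / 2 ^ j) powr s * sqrt \<gamma> + (R / 2 ^ j) powr (s - n / 2) * sqrt e
     \<le> ?Z + (2 powr n * \<rho> powr (s - n / 2)) * sqrt e"
    using a eq1 pos b by (intro add_mono mult_right_mono) auto
  also have "\<dots> = ?Z + 2 powr n * ?Z" by (simp only: mult.assoc eq2)
  also have "\<dots> \<le> 2 powr n * ?Z + 2 powr n * ?Z"
  proof -
    have "1 * ?Z \<le> 2 powr n * ?Z" by (intro mult_right_mono one) simp
    then show ?thesis by (intro add_right_mono) (simp only: mult_1_left)
  qed
  finally have "L * ((R / 2 ^ j) powr s * sqrt \<gamma> + (R / 2 ^ j) powr (s - n / 2) * sqrt e) \<le> L * (2 powr n * ?Z + 2 powr n * ?Z)"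
    using pos by (intro mult_left_mono) auto
  with X[of j] show ?thesis by (simp add: mult_ac)
qed

text \<open>The bounds on the increments grow by 2^\<alpha> >= 2^(1/4) >= 7/6 from one scale to the
  next, so the last one dominates the sum. The 6 is what the induction reproduces: 1 + 6 = 6 *
  (7/6). In the application \<alpha> = N/2 - s, and 1/4 comes from N >= 2 and s < 3/4.\<close>

lemma geometric_telescope:
  fixes a :: "nat \<Rightarrow> real"
  assumes step: "\<And>i. \<bar>a (Suc i) - a i\<bar> \<le> K * (R / 2 ^ i) powr (- \<alpha>)" and "1 / 4 \<le> \<alpha>" "0 \<le> K" "0 < R"
  shows "\<bar>a j - a 0\<bar> \<le> 6 * K * (R / 2 ^ j) powr (- \<alpha>)"
proof (induction j)
  case (Suc j)
  have "(7/6 :: real) = ((7/6) powr 4) powr (1/4)" unfolding powr_powr by simp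
  also have "\<dots> \<le> 2 powr (1 / 4)" by (intro powr_mono2) (simp_all add: powr_numeral power_divide)
  also have "\<dots> \<le> 2 powr \<alpha>" using assms by (intro powr_mono) auto
  finally have 7: "7/6 \<le> 2 powr \<alpha>" .
  define q where "q = (R / 2 ^ j) powr (- \<alpha>)"
  have q0: "q \<ge> 0" by (simp add: q_def)
  have "(R / 2 ^ Suc j) powr (- \<alpha>) = ((R / 2 ^ j) / 2) powr (- \<alpha>)" by (simp add: mult.commute)
  also have "\<dots> = q / 2 powr (- \<alpha>)" unfolding q_def by (rule powr_divide)
  also have "\<dots> = 2 powr \<alpha> * q" by (simp add: powr_minus_divide)
  finally have q: "(R / 2 ^ Suc j) powr (- \<alpha>) = 2 powr \<alpha> * q" .
  have "\<bar>a (Suc j) - a 0\<bar> \<le> K * q + 6 * K * q"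
    using Suc.IH step[of j] by (simp add: q_def)
  also have "\<dots> = 6 * K * ((7/6) * q)" by simp
  also have "\<dots> \<le> 6 * K * (2 powr \<alpha> * q)" using 7 q0 assms by (intro mult_left_mono mult_right_mono) auto
  finally show ?case unfolding q .
qed (use assms in simp)

text \<open>On the diagonal \<open>0 powr _\<close> is 0, so the singularity contributes nothing.
  This agrees with the division by zero in \<open>Q_frac\<close>.\<close>

definition riesz_kernel :: "real \<Rightarrow> 'a::euclidean_space \<times> 'a \<Rightarrow> real" where
  "riesz_kernel s z = norm (fst z - snd z) powr (- (real DIM('a) + 2 * s))"

text \<open>The energy without its normalization constant, with the restriction to the domain placed
  in the measure, so that Fubini and the finite-measure lemmas apply directly;
  \<open>Q_frac_eq_gagliardo\<close> ties it to \<open>Q_frac\<close>.\<close>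

definition gagliardo :: "real \<Rightarrow> 'a::euclidean_space set \<Rightarrow> ('a \<Rightarrow> real) \<Rightarrow> ennreal" where
  "gagliardo s \<Omega> u = (\<integral>\<^sup>+z. ennreal ((u (fst z) - u (snd z))\<^sup>2 * riesz_kernel s z) \<partial>(lebesgue_on \<Omega> \<Otimes>\<^sub>M lebesgue_on \<Omega>))"

lemma riesz_kernel_nonneg: "0 \<le> riesz_kernel s z"
  by (simp add: riesz_kernel_def)

lemma norm_diff_measurable:
  "(\<lambda>z. norm (fst z - snd z)) \<in> borel_measurable (lebesgue_on \<Omega> \<Otimes>\<^sub>M lebesgue_on \<Omega>)"
  for \<Omega> :: "'a::euclidean_space set"
proof -
  have id: "(\<lambda>x. x) \<in> borel_measurable (lebesgue_on \<Omega>)"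
    using id_borel_measurable_lebesgue_on[of \<Omega>] by (simp add: id_def)
  have [measurable]: "fst \<in> borel_measurable (lebesgue_on \<Omega> \<Otimes>\<^sub>M lebesgue_on \<Omega>)" "snd \<in> borel_measurable (lebesgue_on \<Omega> \<Otimes>\<^sub>M lebesgue_on \<Omega>)"
    using measurable_compose[OF measurable_fst id] measurable_compose[OF measurable_snd id] by auto
  show ?thesis by measurable
qed

lemma riesz_kernel_measurable:
  "riesz_kernel s \<in> borel_measurable (lebesgue_on \<Omega> \<Otimes>\<^sub>M lebesgue_on \<Omega>)"
proof -
  note norm_diff_measurable [of \<Omega>, measurable]
  show ?thesis unfolding riesz_kernel_def[abs_def] by measurable
qed

lemma square_le_riesz_kernel:
  fixes x y :: "'a::euclidean_space"
  assumes "norm (x - y) \<le> r" "0 < s"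
  shows "(u x - u y)\<^sup>2 \<le> r powr (real DIM('a) + 2 * s) * ((u x - u y)\<^sup>2 * riesz_kernel s (x, y))"
proof (cases "x = y")
  case False
  let ?c = "real DIM('a) + 2 * s"
  have "norm (x - y) powr ?c * (norm (x - y) powr (- ?c)) = 1"
    unfolding powr_add [symmetric] using False by simp
  then have "1 \<le> r powr ?c * riesz_kernel s (x, y)"
    unfolding riesz_kernel_def using assms
    by (metis (no_types, lifting) add_nonneg_nonneg fst_conv less_imp_le mult_nonneg_nonneg mult_right_mono norm_ge_zero of_nat_0_le_iff powr_ge_zero powr_mono2 snd_conv zero_le_numeral)
  then show ?thesis using mult_left_mono[of 1 "r powr ?c * riesz_kernel s (x, y)" "(u x - u y)\<^sup>2"] by (simp add: mult_ac)
qed simp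

lemma average_kernel_bound:
  fixes \<Omega> :: "'a::euclidean_space set" and u :: "'a \<Rightarrow> real"
  defines "M \<equiv> lebesgue_on \<Omega>" and "n \<equiv> real DIM('a)"
  assumes \<Omega>: "\<Omega> \<in> lmeasurable" and x: "x \<in> \<Omega>" and s: "0 < s"
    and A [measurable]: "A \<in> sets M" and near: "\<And>y. y \<in> A \<Longrightarrow> norm (x - y) \<le> r"
    and u [measurable]: "u \<in> borel_measurable M" and sq: "(\<integral>\<^sup>+x. ennreal ((u x)\<^sup>2) \<partial>M) < \<infinity>"
  shows "ennreal (measure M A * (u x - average M A u)\<^sup>2)
    \<le> ennreal (r powr (n + 2 * s)) * (\<integral>\<^sup>+y. ennreal ((u x - u y)\<^sup>2 * riesz_kernel s (x, y)) \<partial>M)"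
proof -
  interpret finite_measure M unfolding M_def by (rule finite_measure_lebesgue_on) fact
  have "riesz_kernel s \<in> borel_measurable (M \<Otimes>\<^sub>M M)" unfolding M_def by (rule riesz_kernel_measurable)
  then have [measurable]: "(\<lambda>y. riesz_kernel s (x, y)) \<in> borel_measurable M"
    using x by (intro measurable_compose_Pair1) (simp_all add: M_def)
  have "ennreal (measure M A * (u x - average M A u)\<^sup>2) \<le> (\<integral>\<^sup>+y\<in>A. ennreal ((u x - u y)\<^sup>2) \<partial>M)"
    by (rule average_deviation) (use sq in auto)
  also have "\<dots> \<le> (\<integral>\<^sup>+y. ennreal (r powr (n + 2 * s)) * ennreal ((u x - u y)\<^sup>2 * riesz_kernel s (x, y)) \<partial>M)"
  proof (rule nn_integral_mono)
    fix y
    show "ennreal ((u x - u y)\<^sup>2) * indicator A y \<le> ennreal (r powr (n + 2 * s)) * ennreal ((u x - u y)\<^sup>2 * riesz_kernel s (x, y))"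
      using square_le_riesz_kernel[OF near s, of y u]
      by (cases "y \<in> A") (simp_all add: ennreal_mult' [symmetric] n_def ennreal_leI)
  qed
  also have "\<dots> = ennreal (r powr (n + 2 * s)) * (\<integral>\<^sup>+y. ennreal ((u x - u y)\<^sup>2 * riesz_kernel s (x, y)) \<partial>M)"
    by (rule nn_integral_cmult) measurable
  finally show ?thesis .
qed

text \<open>The radii shrink from R, where the piece is the whole domain, so \<open>a 0\<close> is
  the global average. Positivity of e is assumed because the optimal radius depends on it;
  \<open>poincare_sobolev\<close> treats e = 0 apart.\<close>

lemma pointwise_average_bound:
  fixes \<Omega> :: "'a::euclidean_space set" and u :: "'a \<Rightarrow> real"
  defines "M \<equiv> lebesgue_on \<Omega>" and "n \<equiv> real DIM('a)"
  assumes \<Omega>: "\<Omega> \<in> lmeasurable" and c: "0 < c" "c \<le> 1" and R: "0 < R" and x: "x \<in> \<Omega>" "\<Omega> \<subseteq> ball x R"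
    and density: "\<And>t. 0 < t \<Longrightarrow> t \<le> R \<Longrightarrow> c * t powr n \<le> measure M (\<Omega> \<inter> ball x t)"
    and N: "2 \<le> DIM('a)" and s: "1/2 < s" "s < 3/4"
    and u [measurable]: "u \<in> borel_measurable M" and sq: "(\<integral>\<^sup>+x. ennreal ((u x)\<^sup>2) \<partial>M) < \<infinity>"
    and g: "(\<integral>\<^sup>+y. ennreal ((u x - u y)\<^sup>2 * riesz_kernel s (x, y)) \<partial>M) = ennreal \<gamma>" "0 \<le> \<gamma>"
    and e: "gagliardo s \<Omega> u = ennreal e" "0 < e"
  shows "\<bar>u x - average M \<Omega> u\<bar> \<le> 24 * 8 powr n / c * (e powr (s / n) * \<gamma> powr (1 / 2 - s / n))"
proof -
  interpret finite_measure M unfolding M_def by (rule finite_measure_lebesgue_on) fact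
  have n: "2 \<le> n" using N by (simp add: n_def)
  have space [simp]: "space M = \<Omega>" by (simp add: M_def)
  have km [measurable]: "riesz_kernel s \<in> borel_measurable (M \<Otimes>\<^sub>M M)" unfolding M_def by (rule riesz_kernel_measurable)
  have B [measurable]: "\<Omega> \<inter> ball x r \<in> sets M" for x r
    unfolding M_def using \<Omega> by (auto simp: sets_restrict_space intro!: image_eqI[of _ _ "ball x r"])
  define r where "r j = R / 2 ^ j" for j :: nat
  have r: "0 < r j" "r j \<le> R" "r (Suc j) = r j / 2" for j
    using R by (auto simp: r_def field_simps)
  define A where "A j = \<Omega> \<inter> ball x (r j)" for j
  define a where "a j = average M (A j) u" for j
  \<comment> \<open>The numerator is the root of 2^n * 2^(n + 2): the first factor comes from the
    halved radius of the inner ball, the second from pairs at distance at most twice the radius, as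
    n + 2s <= n + 2.\<close>
  define K where "K = 2 * 2 powr n / c"
  have K: "K \<ge> 1 / c" "K \<ge> 0" unfolding K_def using c ge_one_powr_ge_zero[of 2 n] n by (auto intro!: divide_right_mono)
  have Am [measurable]: "A j \<in> sets M" for j unfolding A_def by simp
  have dens: "c * r j powr n \<le> measure M (A j)" for j
    unfolding A_def using r by (intro density) auto
  have A0: "A 0 = \<Omega>" using x by (auto simp: A_def r_def)
  have rpos: "r j powr b > 0" for j b using r(1)[of j] by simp
  have first: "\<bar>u x - a j\<bar> \<le> 1 / c * (r j powr s * sqrt \<gamma>)" for j
  proof -
    have "ennreal (measure M (A j) * (u x - a j)\<^sup>2) \<le> ennreal (r j powr (n + 2 * s)) * ennreal \<gamma>"
      unfolding a_def g(1) [symmetric] M_def n_def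
      by (rule average_kernel_bound[OF \<Omega> x(1)]) (use s u sq Am[of j] in \<open>auto simp: M_def A_def dist_norm\<close>)
    then have "measure M (A j) * (u x - a j)\<^sup>2 \<le> r j powr (n + 2 * s) * \<gamma>"
      using g(2) by (simp add: ennreal_mult' [symmetric])
    then have "(c * r j powr n) * (u x - a j)\<^sup>2 \<le> r j powr n * (r j powr (2 * s) * \<gamma>)"
      using mult_right_mono[OF dens[of j], of "(u x - a j)\<^sup>2"] by (simp add: powr_add mult_ac)
    then have "r j powr n * (c * (u x - a j)\<^sup>2) \<le> r j powr n * (r j powr (2 * s) * \<gamma>)"
      by (simp add: mult_ac)
    then have *: "c * (u x - a j)\<^sup>2 \<le> r j powr (2 * s) * \<gamma>" using rpos[of j n] by simp
    \<comment> \<open>As c <= 1, replacing c by its square only weakens the bound and avoids a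
      square root of c.\<close>
    have "(c * (u x - a j))\<^sup>2 \<le> c * (u x - a j)\<^sup>2"
      using c mult_right_mono[of c 1 "c * (u x - a j)\<^sup>2"] by (simp add: power2_eq_square mult_ac)
    also note *
    also have "r j powr (2 * s) * \<gamma> = (r j powr s * sqrt \<gamma>)\<^sup>2"
    proof -
      have "r j powr (2 * s) = (r j powr s)\<^sup>2" by (simp add: power2_eq_square powr_add [symmetric])
      then show ?thesis using g(2) by (simp add: power_mult_distrib)
    qed
    finally have "\<bar>c * (u x - a j)\<bar> \<le> \<bar>r j powr s * sqrt \<gamma>\<bar>" by (simp add: abs_le_square_iff)
    then have "c * \<bar>u x - a j\<bar> \<le> r j powr s * sqrt \<gamma>" using c g(2) by (simp only: abs_mult) simp
    then show ?thesis using c by (simp add: pos_le_divide_eq mult.commute)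
  qed
  have step: "\<bar>a (Suc j) - a j\<bar> \<le> (K * sqrt e) * r j powr (- (n / 2 - s))" for j
  proof -
    have "ennreal (measure M (A (Suc j)) * measure M (A j) * (a (Suc j) - a j)\<^sup>2)
      \<le> (\<integral>\<^sup>+x\<in>A (Suc j). (\<integral>\<^sup>+y\<in>A j. ennreal ((u x - u y)\<^sup>2) \<partial>M) \<partial>M)"
      unfolding a_def by (rule average_difference) (use sq in auto)
    also have "\<dots> \<le> (\<integral>\<^sup>+x. (\<integral>\<^sup>+y. ennreal ((2 * r j) powr (n + 2 * s)) * ennreal ((u x - u y)\<^sup>2 * riesz_kernel s (x, y)) \<partial>M) \<partial>M)"
    proof (intro nn_integral_mono)
      fix x'
      have "(\<integral>\<^sup>+y. ennreal ((u x' - u y)\<^sup>2) * indicator (A j) y \<partial>M)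
        \<le> (\<integral>\<^sup>+y. ennreal ((2 * r j) powr (n + 2 * s)) * ennreal ((u x' - u y)\<^sup>2 * riesz_kernel s (x', y)) \<partial>M)" if "x' \<in> A (Suc j)"
      proof (intro nn_integral_mono)
        fix y
        show "ennreal ((u x' - u y)\<^sup>2) * indicator (A j) y \<le> ennreal ((2 * r j) powr (n + 2 * s)) * ennreal ((u x' - u y)\<^sup>2 * riesz_kernel s (x', y))"
        proof (cases "y \<in> A j")
          case True
          have "dist x x' < r j" "dist x y < r j" using True that r(1)[of j] by (auto simp: A_def r(3))
          then have "norm (x' - y) \<le> 2 * r j" using dist_triangle[of x' y x] by (simp add: dist_norm[symmetric] dist_commute)
          from square_le_riesz_kernel[OF this, of s u] s show ?thesis
            using True by (simp add: ennreal_mult' [symmetric] n_def ennreal_leI)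
        qed simp
      qed
      then show "(\<integral>\<^sup>+y. ennreal ((u x' - u y)\<^sup>2) * indicator (A j) y \<partial>M) * indicator (A (Suc j)) x'
        \<le> (\<integral>\<^sup>+y. ennreal ((2 * r j) powr (n + 2 * s)) * ennreal ((u x' - u y)\<^sup>2 * riesz_kernel s (x', y)) \<partial>M)"
        by (cases "x' \<in> A (Suc j)") auto
    qed
    also have "\<dots> = (\<integral>\<^sup>+z. ennreal ((2 * r j) powr (n + 2 * s)) * ennreal ((u (fst z) - u (snd z))\<^sup>2 * riesz_kernel s z) \<partial>(M \<Otimes>\<^sub>M M))"
    proof -
      have "(\<lambda>z. ennreal ((2 * r j) powr (n + 2 * s)) * ennreal ((u (fst z) - u (snd z))\<^sup>2 * riesz_kernel s z)) \<in> borel_measurable (M \<Otimes>\<^sub>M M)"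
        by measurable
      from nn_integral_fst[OF this] show ?thesis by simp
    qed
    also have "\<dots> = ennreal ((2 * r j) powr (n + 2 * s)) * ennreal e"
      unfolding e(1) [symmetric] gagliardo_def M_def[symmetric]
      by (rule nn_integral_cmult) measurable
    finally have "measure M (A (Suc j)) * measure M (A j) * (a (Suc j) - a j)\<^sup>2 \<le> (2 * r j) powr (n + 2 * s) * e"
      using e(2) by (simp add: ennreal_mult' [symmetric])
    then have "((c * r (Suc j) powr n) * (c * r j powr n)) * (a (Suc j) - a j)\<^sup>2 \<le> (2 * r j) powr (n + 2 * s) * e"
      using c by (intro order_trans[OF mult_right_mono[OF mult_mono[OF dens dens]]]) auto
    also have "(2 * r j) powr (n + 2 * s) = 2 powr (n + 2 * s) * (r j powr n * r j powr (2 * s))"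
      by (simp add: powr_mult powr_add)
    also have "2 powr (n + 2 * s) * (r j powr n * r j powr (2 * s)) * e \<le> 2 powr (n + 2) * (r j powr n * r j powr (2 * s)) * e"
      using s e by (intro mult_right_mono powr_mono) auto
    also have "(c * r (Suc j) powr n) * (c * r j powr n) * (a (Suc j) - a j)\<^sup>2 = r j powr n * ((c * (a (Suc j) - a j))\<^sup>2 * r j powr n / 2 powr n)"
      by (simp add: r(3) powr_divide power2_eq_square)
    finally have "r j powr n * ((c * (a (Suc j) - a j))\<^sup>2 * r j powr n / 2 powr n) \<le> r j powr n * (2 powr (n + 2) * r j powr (2 * s) * e)"
      by (simp add: mult_ac)
    then have "(c * (a (Suc j) - a j))\<^sup>2 * r j powr n / 2 powr n \<le> 2 powr (n + 2) * r j powr (2 * s) * e"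
      unfolding mult_le_cancel_left_pos[OF rpos[of j n]] .
    then have "(c * (a (Suc j) - a j))\<^sup>2 \<le> 2 powr (n + 2) * r j powr (2 * s) * e * 2 powr n / r j powr n"
      using rpos[of j n] by (simp add: field_simps)
    also have "\<dots> = (2 * 2 powr n)\<^sup>2 * (r j powr (2 * s) / r j powr n) * e"
      by (simp add: powr_add power2_eq_square powr_numeral mult_ac)
    also have "r j powr (2 * s) / r j powr n = (r j powr (- (n / 2 - s)))\<^sup>2"
      by (simp add: power2_eq_square powr_add [symmetric] powr_diff [symmetric] algebra_simps)
    also have "(2 * 2 powr n)\<^sup>2 * (r j powr (- (n / 2 - s)))\<^sup>2 * e = (2 * 2 powr n * r j powr (- (n / 2 - s)) * sqrt e)\<^sup>2"
      using e by (simp add: power_mult_distrib)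
    finally have "\<bar>c * (a (Suc j) - a j)\<bar> \<le> \<bar>2 * 2 powr n * r j powr (- (n / 2 - s)) * sqrt e\<bar>" by (simp only: abs_le_square_iff)
    then have "c * \<bar>a (Suc j) - a j\<bar> \<le> 2 * 2 powr n * r j powr (- (n / 2 - s)) * sqrt e"
      using c e by (simp add: abs_mult)
    then show ?thesis using c unfolding K_def by (simp add: field_simps)
  qed
  have tele: "\<bar>a j - a 0\<bar> \<le> 6 * (K * sqrt e) * (R / 2 ^ j) powr (- (n / 2 - s))" for j
    using step n s K e R unfolding r_def by (intro geometric_telescope) auto
  have main: "\<bar>u x - a 0\<bar> \<le> (6 * K) * ((R / 2 ^ j) powr s * sqrt \<gamma> + (R / 2 ^ j) powr (s - n / 2) * sqrt e)" for j
  proof -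
    have "1 / c * (r j powr s * sqrt \<gamma>) \<le> (6 * K) * (r j powr s * sqrt \<gamma>)"
      using K g(2) by (intro mult_right_mono) auto
    then have "\<bar>u x - a 0\<bar> \<le> (6 * K) * (r j powr s * sqrt \<gamma>) + 6 * (K * sqrt e) * (R / 2 ^ j) powr (- (n / 2 - s))"
      using first[of j] tele[of j] by linarith
    then show ?thesis by (simp add: r_def algebra_simps)
  qed
  have main0: "\<bar>u x - a 0\<bar> \<le> (6 * K) * (R powr s * sqrt \<gamma>)"
  proof -
    have "1 / c * (r 0 powr s * sqrt \<gamma>) \<le> (6 * K) * (r 0 powr s * sqrt \<gamma>)"
      using K g(2) by (intro mult_right_mono) auto
    then show ?thesis using first[of 0] by (simp add: r_def)
  qed
  have "\<bar>u x - a 0\<bar> \<le> 2 * 2 powr n * (6 * K) * (e powr (s / n) * \<gamma> powr (1 / 2 - s / n))"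
    by (rule dyadic_optimization[OF _ R g(2) e(2) _ _ main0 main]) (use K s n in auto)
  also have "2 * 2 powr n * (6 * K) = 24 * 4 powr n / c"
    by (simp add: K_def powr_mult [symmetric])
  also have "24 * 4 powr n / c * (e powr (s / n) * \<gamma> powr (1 / 2 - s / n)) \<le> 24 * 8 powr n / c * (e powr (s / n) * \<gamma> powr (1 / 2 - s / n))"
    using c n by (intro mult_right_mono divide_right_mono mult_left_mono powr_mono2) auto
  finally show ?thesis by (simp add: a_def A0)
qed

lemma poincare_sobolev:
  fixes \<Omega> :: "'a::euclidean_space set" and u :: "'a \<Rightarrow> real"
  defines "M \<equiv> lebesgue_on \<Omega>" and "n \<equiv> real DIM('a)"
  assumes \<Omega>: "\<Omega> \<in> lmeasurable" and c: "0 < c" "c \<le> 1" and R: "0 < R" and x: "\<And>x. x \<in> \<Omega> \<Longrightarrow> \<Omega> \<subseteq> ball x R"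
    and density: "\<And>x t. x \<in> \<Omega> \<Longrightarrow> 0 < t \<Longrightarrow> t \<le> R \<Longrightarrow> c * t powr n \<le> measure M (\<Omega> \<inter> ball x t)"
    and N: "2 \<le> DIM('a)" and s: "1/2 < s" "s < 3/4"
    and u [measurable]: "u \<in> borel_measurable M" and sq: "(\<integral>\<^sup>+x. ennreal ((u x)\<^sup>2) \<partial>M) < \<infinity>"
    and fin: "gagliardo s \<Omega> u < \<infinity>" and p: "p = crit_exp DIM('a) s"
  shows "(\<integral>\<^sup>+x. ennreal (\<bar>u x - average M \<Omega> u\<bar> powr p) \<partial>M)
    \<le> ennreal (((24 * 8 powr n / c)\<^sup>2 * enn2real (gagliardo s \<Omega> u)) powr (p / 2))"
proof -
  interpret finite_measure M unfolding M_def by (rule finite_measure_lebesgue_on) fact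
  define L where "L = 24 * 8 powr n / c"
  have L: "L \<ge> 0" using c by (simp add: L_def)
  have n: "2 \<le> n" using N by (simp add: n_def)
  have pn: "p = 2 * n / (n - 2 * s)" by (simp add: p crit_exp_def n_def)
  have p0: "p > 0" using n s by (simp add: pn)
  define g where "g x = (\<integral>\<^sup>+y. ennreal ((u x - u y)\<^sup>2 * riesz_kernel s (x, y)) \<partial>M)" for x
  have km [measurable]: "riesz_kernel s \<in> borel_measurable (M \<Otimes>\<^sub>M M)" unfolding M_def by (rule riesz_kernel_measurable)
  have Gm: "(\<lambda>z. ennreal ((u (fst z) - u (snd z))\<^sup>2 * riesz_kernel s z)) \<in> borel_measurable (M \<Otimes>\<^sub>M M)" by measurable
  have gm [measurable]: "g \<in> borel_measurable M"
    using borel_measurable_nn_integral_fst[OF Gm] unfolding g_def[abs_def] by simp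
  have gint: "(\<integral>\<^sup>+x. g x \<partial>M) = gagliardo s \<Omega> u"
    using nn_integral_fst[OF Gm] unfolding g_def gagliardo_def M_def[symmetric] by simp
  define e where "e = enn2real (gagliardo s \<Omega> u)"
  have e: "gagliardo s \<Omega> u = ennreal e" "e \<ge> 0" using fin by (auto simp: e_def)
  show ?thesis
  proof (cases "e = 0")
    case False
    then have e0: "e > 0" using e by simp
    \<comment> \<open>The two identities behind p = 2n / (n - 2s). The second makes the power of
      \<open>\<gamma>\<close> linear, so that it integrates to the energy; the first then gives e
      the total exponent p/2, which is the homogeneity of a norm inequality.\<close>
    have e1: "(s / n) * p + 1 = p / 2" "(1 / 2 - s / n) * p = 1" using n s by (auto simp: pn field_simps)
    have "AE x in M. g x \<noteq> \<infinity>" by (rule nn_integral_PInf_AE) (use gint fin in auto)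
    then have "AE x in M. ennreal (\<bar>u x - average M \<Omega> u\<bar> powr p) \<le> ennreal (L powr p * e powr (s / n * p)) * g x"
    proof (rule AE_mp, intro AE_I2 impI)
      fix y assume y: "y \<in> space M" and "g y \<noteq> \<infinity>"
      define \<gamma> where "\<gamma> = enn2real (g y)"
      have \<gamma>: "g y = ennreal \<gamma>" "\<gamma> \<ge> 0" using \<open>g y \<noteq> \<infinity>\<close> by (auto simp: \<gamma>_def less_top)
      have "y \<in> \<Omega>" using y by (simp add: M_def)
      have "\<bar>u y - average M \<Omega> u\<bar> \<le> L * (e powr (s / n) * \<gamma> powr (1 / 2 - s / n))"
        unfolding L_def M_def n_def
        by (rule pointwise_average_bound[OF \<Omega> c R \<open>y \<in> \<Omega>\<close> x[OF \<open>y \<in> \<Omega>\<close>] density[unfolded M_def n_def, OF \<open>y \<in> \<Omega>\<close>] N s])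
           (use u sq \<gamma> e(1) e0 in \<open>auto simp: M_def g_def\<close>)
      then have "\<bar>u y - average M \<Omega> u\<bar> powr p \<le> (L * (e powr (s / n) * \<gamma> powr (1 / 2 - s / n))) powr p"
        using p0 by (intro powr_mono2) auto
      also have "\<dots> = L powr p * (e powr (s / n * p) * \<gamma> powr 1)"
        unfolding powr_mult powr_powr e1(2) ..
      also have "\<dots> = (L powr p * e powr (s / n * p)) * \<gamma>" using \<gamma>(2) by simp
      finally show "ennreal (\<bar>u y - average M \<Omega> u\<bar> powr p) \<le> ennreal (L powr p * e powr (s / n * p)) * g y"
        unfolding \<gamma>(1) by (subst ennreal_mult' [symmetric]) (auto intro: ennreal_leI)
    qed
    then have "(\<integral>\<^sup>+x. ennreal (\<bar>u x - average M \<Omega> u\<bar> powr p) \<partial>M) \<le> (\<integral>\<^sup>+x. ennreal (L powr p * e powr (s / n * p)) * g x \<partial>M)"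
      by (rule nn_integral_mono_AE)
    also have "\<dots> = ennreal (L powr p * e powr (s / n * p)) * ennreal e"
      by (subst nn_integral_cmult) (auto simp: gint e(1))
    also have "\<dots> = ennreal (L powr p * (e powr (s / n * p) * e powr 1))"
      using e by (simp add: ennreal_mult'' [symmetric] mult.assoc)
    also have "e powr (s / n * p) * e powr 1 = e powr (p / 2)"
      unfolding powr_add [symmetric] e1(1) ..
    also have "L powr p * e powr (p / 2) = (L\<^sup>2 * e) powr (p / 2)"
      using powr_eq_powr_square[of L "p / 2"] L by (simp add: powr_mult)
    finally show ?thesis by (simp add: L_def e_def)
  next
    case True
    \<comment> \<open>Zero energy makes the inner integral vanish almost everywhere, and the bound
      at the single scale R forces u to equal its average.\<close>
    have "AE x in M. g x = 0" using gint e True by (subst nn_integral_0_iff_AE [symmetric]) auto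
    then have "AE x in M. ennreal (\<bar>u x - average M \<Omega> u\<bar> powr p) = 0"
    proof (rule AE_mp, intro AE_I2 impI)
      fix y assume y: "y \<in> space M" and gy: "g y = 0"
      have "y \<in> \<Omega>" using y by (simp add: M_def)
      have \<Omega>M: "\<Omega> \<in> sets M" by (simp add: M_def)
      have \<Omega>B: "\<Omega> \<inter> ball y R = \<Omega>" using x[OF \<open>y \<in> \<Omega>\<close>] by auto
      have "ennreal (measure M \<Omega> * (u y - average M \<Omega> u)\<^sup>2) \<le> ennreal (R powr (n + 2 * s)) * g y"
        unfolding g_def M_def n_def
        by (rule average_kernel_bound[OF \<Omega> \<open>y \<in> \<Omega>\<close>])
           (use s u sq \<Omega>M x[OF \<open>y \<in> \<Omega>\<close>] in \<open>auto simp: M_def dist_norm\<close>)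
      then have "measure M \<Omega> * (u y - average M \<Omega> u)\<^sup>2 \<le> 0" unfolding gy by (simp add: ennreal_eq_0_iff)
      moreover have "measure M \<Omega> > 0"
        using less_le_trans[OF _ density[OF \<open>y \<in> \<Omega>\<close> R order_refl]] c R \<Omega>B by simp
      ultimately have "u y = average M \<Omega> u" by (simp add: mult_le_0_iff)
      then show "ennreal (\<bar>u y - average M \<Omega> u\<bar> powr p) = 0" by simp
    qed
    then have "(\<integral>\<^sup>+x. ennreal (\<bar>u x - average M \<Omega> u\<bar> powr p) \<partial>M) = 0"
      by (subst nn_integral_0_iff_AE) auto
    then show ?thesis by simp
  qed
qed

section \<open>Geometry of C1 domains\<close>

text \<open>Two properties are extracted from the chart besides the description of the domain: g is
  Lipschitz near p, and a shift by t along e raises g by exactly t. With them, translation arguments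
  take the place of a change of variables that straightens the boundary.\<close>

lemma C1_domain_chart:
  fixes \<Omega> :: "'a::euclidean_space set"
  assumes "C1_domain \<Omega>" "p \<in> frontier \<Omega>"
  obtains r e g \<Lambda> where "r > 0" "norm e = 1" "\<Lambda> \<ge> (1::real)"
    "\<And>(x::'a) t. g (x + t *\<^sub>R e) = g x + t"
    "\<And>x y. x \<in> ball p r \<Longrightarrow> y \<in> ball p r \<Longrightarrow> \<bar>g x - g y\<bar> \<le> \<Lambda> * norm (x - y)"
    "\<And>x. x \<in> ball p r \<Longrightarrow> x \<in> \<Omega> \<longleftrightarrow> g x > 0"
proof -
  obtain r e \<gamma> \<gamma>' where r: "r > 0" and e: "norm (e::'a) = 1"
    and d: "\<And>x. (\<gamma> has_derivative (\<lambda>h. \<gamma>' x \<bullet> h)) (at x)" and c: "continuous_on UNIV \<gamma>'"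
    and \<Omega>: "\<And>x. x \<in> ball p r \<Longrightarrow> x \<in> \<Omega> \<longleftrightarrow> x \<bullet> e > \<gamma> (x - (x \<bullet> e) *\<^sub>R e)"
    using assms unfolding C1_domain_def by blast
  define P where "P x = x - (x \<bullet> e) *\<^sub>R e" for x
  have ee: "e \<bullet> e = 1" using e by (simp add: norm_eq_1)
  have Pe: "P (x + t *\<^sub>R e) = P x" for x t by (simp add: P_def inner_add_left ee algebra_simps)
  have Plip: "norm (P x) \<le> 2 * norm x" for x
  proof -
    have "norm (P x) \<le> norm x + norm ((x \<bullet> e) *\<^sub>R e)" unfolding P_def by (rule norm_triangle_ineq4)
    also have "norm ((x \<bullet> e) *\<^sub>R e) \<le> norm x" using Cauchy_Schwarz_ineq2[of x e] e by simp
    finally show ?thesis by simp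
  qed
  have Pdiff: "P x - P y = P (x - y)" for x y by (simp add: P_def inner_diff_left algebra_simps)
  \<comment> \<open>Large enough to contain the projections P x of all x in \<open>ball p r\<close>,
    because P at most doubles norms. The gradient is bounded on this compact set, and convexity
    turns that bound into a Lipschitz constant.\<close>
  define K where "K = cball (0::'a) (2 * (norm p + r))"
  have "compact (\<gamma>' ` K)" unfolding K_def
    by (intro compact_continuous_image continuous_on_subset[OF c]) auto
  then obtain L where L: "\<And>x. x \<in> K \<Longrightarrow> norm (\<gamma>' x) \<le> L" using compact_imp_bounded bounded_iff by (metis imageI)
  define L' where "L' = max L 0"
  have \<gamma>: "norm (\<gamma> x - \<gamma> y) \<le> L' * norm (x - y)" if "x \<in> K" "y \<in> K" for x y
  proof (rule differentiable_bound)
    show "convex K" by (simp add: K_def)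
    show "(\<gamma> has_derivative (\<lambda>h. \<gamma>' x \<bullet> h)) (at x within K)" for x by (rule has_derivative_at_withinI) (rule d)
    show "onorm (\<lambda>h. \<gamma>' x \<bullet> h) \<le> L'" if "x \<in> K" for x
    proof (rule onorm_le)
      fix h
      have "norm (\<gamma>' x \<bullet> h) \<le> norm (\<gamma>' x) * norm h" using Cauchy_Schwarz_ineq2 by simp
      also have "\<dots> \<le> L' * norm h" using L[OF that] by (intro mult_right_mono) (auto simp: L'_def)
      finally show "norm (\<gamma>' x \<bullet> h) \<le> L' * norm h" .
    qed
  qed (use that in auto)
  define g where "g x = x \<bullet> e - \<gamma> (P x)" for x
  have PK: "P x \<in> K" if "x \<in> ball p r" for x
  proof -
    have "norm x \<le> norm p + r" using that norm_triangle_ineq[of p "x - p"] by (simp add: dist_norm norm_minus_commute)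
    then show ?thesis using Plip[of x] by (simp add: K_def)
  qed
  show ?thesis
  proof (rule that[of r e "1 + 2 * L'" g])
    show "g (x + t *\<^sub>R e) = g x + t" for x t by (simp add: g_def Pe inner_add_left ee)
    show "\<bar>g x - g y\<bar> \<le> (1 + 2 * L') * norm (x - y)" if "x \<in> ball p r" "y \<in> ball p r" for x y
    proof -
      have "\<bar>\<gamma> (P x) - \<gamma> (P y)\<bar> \<le> L' * norm (P x - P y)" using \<gamma>[OF PK PK] that by simp
      also have "\<dots> \<le> L' * (2 * norm (x - y))" unfolding Pdiff by (intro mult_left_mono Plip) (simp add: L'_def)
      finally have 1: "\<bar>\<gamma> (P x) - \<gamma> (P y)\<bar> \<le> 2 * L' * norm (x - y)" by simp
      have 2: "\<bar>x \<bullet> e - y \<bullet> e\<bar> \<le> norm (x - y)"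
        using Cauchy_Schwarz_ineq2[of "x - y" e] e by (simp add: inner_diff_left)
      have "\<bar>g x - g y\<bar> \<le> norm (x - y) + 2 * L' * norm (x - y)"
        unfolding g_def using 1 2 by linarith
      then show ?thesis by (simp add: algebra_simps)
    qed
  qed (use r e \<Omega> in \<open>auto simp: g_def P_def L'_def\<close>)
qed

section \<open>Volume density and thin boundary layers\<close>

definition ball_vol :: "'a::euclidean_space itself \<Rightarrow> real" where
  "ball_vol _ = measure lebesgue (ball (0::'a) 1)"

lemma ball_vol_pos: "ball_vol TYPE('a::euclidean_space) > 0"
  using content_ball_gt_0_iff[of "0::'a" 1] by (simp add: ball_vol_def measure_completion)

lemma measure_ball_scaling:
  fixes x :: "'a::euclidean_space"
  assumes "0 \<le> r"
  shows "measure lebesgue (ball x r) = ball_vol TYPE('a) * r ^ DIM('a)"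
  using assms by (simp add: ball_vol_def measure_completion content_ball)

lemma emeasure_ball_scaling:
  fixes x :: "'a::euclidean_space"
  assumes "0 \<le> r"
  shows "emeasure lebesgue (ball x r) = ennreal (ball_vol TYPE('a) * r ^ DIM('a))"
  using emeasure_eq_ennreal_measure[OF fmeasurableD2[OF lmeasurable_ball[of x r]]] measure_ball_scaling[OF assms, of x] by simp

text \<open>Going inward from x by t/2 along e raises g by t/2, and on a ball of radius t / (4
  \<Lambda>) around that point g drops by at most t/4, so this ball lies in the domain.\<close>

lemma chart_density:
  fixes \<Omega> :: "'a::euclidean_space set"
  assumes r: "r > 0" "norm e = 1" "\<Lambda> \<ge> (1::real)"
    and g: "\<And>(x::'a) t. g (x + t *\<^sub>R e) = g x + t"
    and lip: "\<And>x y. x \<in> ball p r \<Longrightarrow> y \<in> ball p r \<Longrightarrow> \<bar>g x - g y\<bar> \<le> \<Lambda> * norm (x - y)"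
    and \<Omega>: "\<And>x. x \<in> ball p r \<Longrightarrow> x \<in> \<Omega> \<longleftrightarrow> g x > 0"
    and meas: "\<Omega> \<in> sets lebesgue" and x: "x \<in> \<Omega>" "x \<in> ball p (r / 2)" and t: "0 < t" "t \<le> r / 2"
  shows "ball_vol TYPE('a) / (4 * \<Lambda>) ^ DIM('a) * t ^ DIM('a) \<le> measure lebesgue (\<Omega> \<inter> ball x t)"
proof -
  define z where "z = x + (t / 2) *\<^sub>R e"
  define d where "d = t / (4 * \<Lambda>)"
  have d: "0 < d" "d \<le> t / 4" using r t by (auto simp: d_def field_simps)
  have xz: "dist x z = t / 2" using r t by (simp add: z_def dist_norm)
  have sub: "ball z d \<subseteq> \<Omega> \<inter> ball x t"
  proof
    fix y assume y: "y \<in> ball z d"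
    have yx: "dist x y < t" using dist_triangle[of x y z] y xz d t by simp
    have yp: "y \<in> ball p r" using dist_triangle[of p y x] yx x t by simp
    have zp: "z \<in> ball p r" using dist_triangle[of p z x] xz x t by simp
    have "\<bar>g y - g z\<bar> \<le> \<Lambda> * norm (y - z)" by (rule lip[OF yp zp])
    also have "\<dots> \<le> \<Lambda> * d" using y r by (intro mult_left_mono) (auto simp: dist_norm norm_minus_commute)
    also have "\<dots> = t / 4" using r by (simp add: d_def)
    finally have "g y \<ge> g z - t / 4" by linarith
    moreover have "g z = g x + t / 2" unfolding z_def by (rule g)
    moreover have "g x > 0" using \<Omega>[of x] x r by auto
    ultimately have "g y > 0" using t by simp
    then show "y \<in> \<Omega> \<inter> ball x t" using \<Omega>[OF yp] yx by simp
  qed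
  have "measure lebesgue (ball z d) \<le> measure lebesgue (\<Omega> \<inter> ball x t)"
    using sub meas by (intro measure_mono_fmeasurable fmeasurableI2[OF lmeasurable_ball[of x t]]) auto
  moreover have "measure lebesgue (ball z d) = ball_vol TYPE('a) * d ^ DIM('a)"
    using d by (intro measure_ball_scaling) simp
  ultimately show ?thesis by (simp add: d_def power_divide power_mult_distrib mult_ac)
qed

text \<open>Points of the domain within d of the complement satisfy 0 < g <= \<tau> with \<tau> =
  \<Lambda> d. Shifting A by multiples of \<tau> along e gives copies in disjoint slabs of g, about
  r / (4 \<tau>) of which fit into \<open>ball p r\<close>; comparing volumes bounds A by a multiple
  of d.\<close>

lemma chart_layer:
  fixes \<Omega> :: "'a::euclidean_space set"
  assumes r: "r > 0" "norm e = 1" "\<Lambda> \<ge> (1::real)"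
    and g: "\<And>(x::'a) t. g (x + t *\<^sub>R e) = g x + t"
    and lip: "\<And>x y. x \<in> ball p r \<Longrightarrow> y \<in> ball p r \<Longrightarrow> \<bar>g x - g y\<bar> \<le> \<Lambda> * norm (x - y)"
    and \<Omega>: "\<And>x. x \<in> ball p r \<Longrightarrow> x \<in> \<Omega> \<longleftrightarrow> g x > 0"
    and d: "0 < d" "d \<le> r / (8 * \<Lambda>)"
    and A: "A \<in> sets lebesgue" "A \<subseteq> \<Omega> \<inter> ball p (r / 4)" "\<And>x. x \<in> A \<Longrightarrow> \<exists>z. z \<notin> \<Omega> \<and> dist x z < d"
  shows "measure lebesgue A \<le> 8 * \<Lambda> * ball_vol TYPE('a) * r ^ DIM('a) / r * d"
proof -
  define \<tau> where "\<tau> = \<Lambda> * d"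
  have \<tau>: "0 < \<tau>" "\<tau> \<le> r / 8" "d \<le> \<tau>"
    using d r by (auto simp: \<tau>_def field_simps)
  have gA: "0 < g x \<and> g x \<le> \<tau>" if "x \<in> A" for x
  proof -
    have xp: "x \<in> \<Omega>" "x \<in> ball p (r / 4)" "x \<in> ball p r" using that A r by auto
    obtain z where z: "z \<notin> \<Omega>" "dist x z < d" using A(3) \<open>x \<in> A\<close> by blast
    have zp: "z \<in> ball p r" using dist_triangle[of p z x] xp z \<tau> r by simp
    then have "g z \<le> 0" using \<Omega> z by force
    moreover have "\<bar>g x - g z\<bar> \<le> \<tau>"
      unfolding \<tau>_def using z r by (intro order_trans[OF lip[OF xp(3) zp]] mult_left_mono) (auto simp: dist_norm)
    moreover have "g x > 0" using \<Omega>[OF xp(3)] xp by simp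
    ultimately show ?thesis by linarith
  qed
  \<comment> \<open>The shifts reach at most r/4, so the copies stay in the ball; since \<tau> <=
    r/8, rounding down still leaves m \<tau> >= r/8.\<close>
  define m where "m = nat \<lfloor>r / (4 * \<tau>)\<rfloor>"
  have m: "real m * \<tau> \<le> r / 4" "r / 8 \<le> real m * \<tau>"
  proof -
    have "0 \<le> r / (4 * \<tau>)" using r \<tau> by simp
    then have "real m \<le> r / (4 * \<tau>)" "r / (4 * \<tau>) < real m + 1" unfolding m_def by linarith+
    then show "real m * \<tau> \<le> r / 4" and "r / 8 \<le> real m * \<tau>" using \<tau> by (auto simp: field_simps)
  qed
  define T where "T j = (+) ((real j * \<tau>) *\<^sub>R e) ` A" for j :: nat
  have T: "T j \<in> lmeasurable" "measure lebesgue (T j) = measure lebesgue A" for j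
  proof -
    have "A \<in> lmeasurable" using A(1,2) by (intro fmeasurableI2[OF lmeasurable_ball[of p "r/4"]]) auto
    then show "T j \<in> lmeasurable" "measure lebesgue (T j) = measure lebesgue A"
      unfolding T_def by (auto simp: measurable_translation measure_translation)
  qed
  have gT: "real j * \<tau> < g y \<and> g y \<le> (real j + 1) * \<tau>" if y: "y \<in> T j" for y j
  proof -
    obtain x where x: "x \<in> A" "y = x + (real j * \<tau>) *\<^sub>R e" using y by (auto simp: T_def add.commute)
    then show ?thesis using gA[of x] g[of x "real j * \<tau>"] by (simp add: algebra_simps)
  qed
  have disj: "disjoint_family_on T {..<m}"
    unfolding disjoint_family_on_def
  proof (intro ballI impI)
    fix i j :: nat assume "i \<noteq> j"
    have False if "y \<in> T i" "y \<in> T j" for y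
    proof -
      have "real i * \<tau> < (real j + 1) * \<tau>" "real j * \<tau> < (real i + 1) * \<tau>"
        using gT[OF that(1)] gT[OF that(2)] by linarith+
      then have "real i < real j + 1" "real j < real i + 1" using \<tau>(1) by (simp_all add: mult_less_cancel_right)
      then show False using \<open>i \<noteq> j\<close> by linarith
    qed
    then show "T i \<inter> T j = {}" by blast
  qed
  have sub: "(\<Union>j<m. T j) \<subseteq> ball p r"
  proof
    fix y assume "y \<in> (\<Union>j<m. T j)"
    then obtain j x where j: "j < m" and x: "x \<in> A" "y = x + (real j * \<tau>) *\<^sub>R e" by (auto simp: T_def add.commute)
    have "dist x y = real j * \<tau>" using x r \<tau> by (simp add: dist_norm)
    also have "\<dots> \<le> real m * \<tau>" using j \<tau> by (intro mult_right_mono) auto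
    finally have "dist x y \<le> r / 4" using m by simp
    moreover have "dist p x < r / 4" using x A by auto
    ultimately show "y \<in> ball p r" using dist_triangle[of p y x] r by simp
  qed
  have "real m * measure lebesgue A = (\<Sum>j<m. measure lebesgue (T j))" by (simp add: T)
  also have "\<dots> = measure lebesgue (\<Union>j<m. T j)"
  proof (rule measure_finite_Union [symmetric])
    show "emeasure lebesgue (T j) \<noteq> \<infinity>" for j using fmeasurableD2[OF T(1)[of j]] by simp
  qed (use T(1) disj in \<open>auto simp: fmeasurableD\<close>)
  also have "\<dots> \<le> measure lebesgue (ball p r)"
    by (rule measure_mono_fmeasurable[OF sub]) (use T in \<open>auto intro!: sets.finite_UN fmeasurableD\<close>)
  also have "\<dots> = ball_vol TYPE('a) * r ^ DIM('a)" by (rule measure_ball_scaling) (use r in simp)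
  finally have mA: "real m * measure lebesgue A \<le> ball_vol TYPE('a) * r ^ DIM('a)" .
  have "(r / 8) * measure lebesgue A \<le> (real m * \<tau>) * measure lebesgue A" using m by (intro mult_right_mono) auto
  also have "\<dots> = \<tau> * (real m * measure lebesgue A)" by simp
  also have "\<dots> \<le> \<tau> * (ball_vol TYPE('a) * r ^ DIM('a))" using mA \<tau> by (intro mult_left_mono) auto
  finally show ?thesis using r by (simp add: \<tau>_def field_simps)
qed

text \<open>Compactness of the closure: interior points have a full ball around them, boundary
  points a chart, and finitely many such neighbourhoods give uniform constants.\<close>

lemma C1_domain_measure_density:
  fixes \<Omega> :: "'a::euclidean_space set"
  assumes C1: "C1_domain \<Omega>" and "0 < R"
  shows "\<exists>c. 0 < c \<and> c \<le> 1 \<and> (\<forall>x\<in>\<Omega>. \<forall>t. 0 < t \<and> t \<le> R \<longrightarrow> c * t ^ DIM('a) \<le> measure lebesgue (\<Omega> \<inter> ball x t))"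
proof -
  have op: "open \<Omega>" and bd: "bounded \<Omega>" using C1 by (auto simp: C1_domain_def)
  have meas: "\<Omega> \<in> sets lebesgue" using op bd by (simp add: lmeasurable_open fmeasurableD)
  let ?P = "\<lambda>p \<rho> c. 0 < \<rho> \<and> 0 < c \<and> (\<forall>x\<in>\<Omega> \<inter> ball p \<rho>. \<forall>t. 0 < t \<and> t \<le> \<rho> \<longrightarrow> c * t ^ DIM('a) \<le> measure lebesgue (\<Omega> \<inter> ball x t))"
  have "\<exists>\<rho> c. ?P p \<rho> c" if p: "p \<in> closure \<Omega>" for p
  proof (cases "p \<in> \<Omega>")
    case True
    then obtain \<rho> where \<rho>: "\<rho> > 0" "ball p \<rho> \<subseteq> \<Omega>" using op open_contains_ball by blast
    have "?P p (\<rho> / 2) (ball_vol TYPE('a))"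
    proof (intro conjI ballI allI impI)
      fix x t assume x: "x \<in> \<Omega> \<inter> ball p (\<rho> / 2)" and t: "0 < t \<and> t \<le> \<rho> / 2"
      have "ball x t \<subseteq> ball p \<rho>"
      proof
        fix y assume "y \<in> ball x t"
        then show "y \<in> ball p \<rho>" using dist_triangle[of p y x] x t by simp
      qed
      then have "\<Omega> \<inter> ball x t = ball x t" using \<rho> by auto
      then show "ball_vol TYPE('a) * t ^ DIM('a) \<le> measure lebesgue (\<Omega> \<inter> ball x t)" using t measure_ball_scaling[of t x] by simp
    qed (use \<rho> ball_vol_pos[where 'a = 'a] in auto)
    then show ?thesis by blast
  next
    case False
    then have "p \<in> frontier \<Omega>" using p op by (simp add: frontier_def interior_open)
    from C1_domain_chart[OF C1 this] obtain r e g \<Lambda> where ch: "r > 0" "norm e = 1" "\<Lambda> \<ge> (1::real)"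
      "\<And>(x::'a) t. g (x + t *\<^sub>R e) = g x + t"
      "\<And>x y. x \<in> ball p r \<Longrightarrow> y \<in> ball p r \<Longrightarrow> \<bar>g x - g y\<bar> \<le> \<Lambda> * norm (x - y)"
      "\<And>x. x \<in> ball p r \<Longrightarrow> x \<in> \<Omega> \<longleftrightarrow> g x > 0" by metis
    have "?P p (r / 2) (ball_vol TYPE('a) / (4 * \<Lambda>) ^ DIM('a))"
      using chart_density[OF ch meas] ch(1,3) ball_vol_pos[where 'a = 'a] by (auto intro!: divide_pos_pos)
    then show ?thesis by blast
  qed
  then obtain \<rho> c where \<rho>c: "\<And>p. p \<in> closure \<Omega> \<Longrightarrow> ?P p (\<rho> p) (c p)" by metis
  have "compact (closure \<Omega>)" using bd by (simp add: compact_closure)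
  then obtain D where D: "D \<subseteq> closure \<Omega>" "finite D" "closure \<Omega> \<subseteq> (\<Union>p\<in>D. ball p (\<rho> p))"
    by (rule compactE_image[of "closure \<Omega>" "closure \<Omega>" "\<lambda>p. ball p (\<rho> p)"]) (use \<rho>c in force)+
  define \<rho>0 where "\<rho>0 = Min (insert R (\<rho> ` D))"
  define c0 where "c0 = Min (insert 1 (c ` D))"
  have \<rho>0: "0 < \<rho>0" "\<rho>0 \<le> R" "\<And>p. p \<in> D \<Longrightarrow> \<rho>0 \<le> \<rho> p" using D \<rho>c \<open>0 < R\<close> by (auto simp: \<rho>0_def)
  have c0: "0 < c0" "c0 \<le> 1" "\<And>p. p \<in> D \<Longrightarrow> c0 \<le> c p" using D \<rho>c by (auto simp: c0_def)
  have loc: "c0 * t ^ DIM('a) \<le> measure lebesgue (\<Omega> \<inter> ball x t)" if x: "x \<in> \<Omega>" and t: "0 < t" "t \<le> \<rho>0" for x t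
  proof -
    obtain p where p: "p \<in> D" "x \<in> ball p (\<rho> p)" using D x closure_subset by blast
    have "c0 * t ^ DIM('a) \<le> c p * t ^ DIM('a)" using c0 p t by (intro mult_right_mono) auto
    also have "\<dots> \<le> measure lebesgue (\<Omega> \<inter> ball x t)" using \<rho>c[of p] p D(1) x t \<rho>0(3)[OF p(1)] by auto
    finally show ?thesis .
  qed
  \<comment> \<open>Passes from small radii to all radii up to R: shrinking t by the factor
    \<open>\<rho>0 / R\<close> makes it admissible and costs this power in the constant.\<close>
  define q where "q = (\<rho>0 / R) ^ DIM('a)"
  have q: "0 < q" "q \<le> 1" using \<rho>0 \<open>0 < R\<close> by (auto simp: q_def power_le_one)
  have "c0 * q * t ^ DIM('a) \<le> measure lebesgue (\<Omega> \<inter> ball x t)" if x: "x \<in> \<Omega>" and t: "0 < t" "t \<le> R" for x t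
  proof -
    define t' where "t' = \<rho>0 / R * t"
    have t': "0 < t'" "t' \<le> \<rho>0" "t' \<le> t" using \<rho>0 t \<open>0 < R\<close> by (auto simp: t'_def field_simps mult_right_mono)
    have "c0 * q * t ^ DIM('a) = c0 * t' ^ DIM('a)" by (simp add: q_def t'_def power_mult_distrib power_divide)
    also have "\<dots> \<le> measure lebesgue (\<Omega> \<inter> ball x t')" by (rule loc) (use x t' in auto)
    also have "\<dots> \<le> measure lebesgue (\<Omega> \<inter> ball x t)"
      using t' meas by (intro measure_mono_fmeasurable fmeasurableI2[OF lmeasurable_ball[of x t]]) auto
    finally show ?thesis .
  qed
  moreover have "0 < c0 * q" "c0 * q \<le> 1" using c0 q by (auto simp: mult_le_one)
  ultimately show ?thesis by blast
qed

text \<open>Distance is taken to the complement rather than to the frontier: it is then 0 off the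
  domain, so cutoffs that vanish at small distance vanish there by themselves.\<close>

definition boundary_layer :: "'a::euclidean_space set \<Rightarrow> real \<Rightarrow> 'a set" where
  "boundary_layer \<Omega> d = {x \<in> \<Omega>. infdist x (- \<Omega>) < d}"

lemma boundary_layer_open:
  assumes "open \<Omega>"
  shows "open (boundary_layer \<Omega> d)"
proof -
  have "open {x. infdist x (- \<Omega>) < d}"
    by (intro open_Collect_less continuous_intros)
  moreover have "boundary_layer \<Omega> d = \<Omega> \<inter> {x. infdist x (- \<Omega>) < d}" by (auto simp: boundary_layer_def)
  ultimately show ?thesis using assms by auto
qed

lemma C1_domain_boundary_layer:
  fixes \<Omega> :: "'a::euclidean_space set"
  assumes C1: "C1_domain \<Omega>"
  shows "\<exists>C>0. \<forall>d>0. measure lebesgue (boundary_layer \<Omega> d) \<le> C * d"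
proof -
  have op: "open \<Omega>" and bd: "bounded \<Omega>" using C1 by (auto simp: C1_domain_def)
  have ne: "- \<Omega> \<noteq> {}"
  proof
    assume "- \<Omega> = {}"
    then have "\<Omega> = UNIV" by blast
    then show False using bd not_bounded_UNIV by simp
  qed
  have lm: "\<Omega> \<in> lmeasurable" using op bd by (simp add: lmeasurable_open)
  have bl: "boundary_layer \<Omega> d \<in> sets lebesgue" for d
    by (rule sets_completionI_sets) (simp add: boundary_layer_open[OF op])
  have bl2: "boundary_layer \<Omega> d \<in> lmeasurable" for d
    by (rule fmeasurableI2[OF lm]) (use bl in \<open>auto simp: boundary_layer_def\<close>)
  let ?P = "\<lambda>p \<rho> C. 0 < \<rho> \<and> 0 < C \<and> (\<forall>d. 0 < d \<and> d \<le> \<rho> \<longrightarrow> measure lebesgue (boundary_layer \<Omega> d \<inter> ball p (2 * \<rho>)) \<le> C * d)"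
  have "\<exists>\<rho> C. ?P p \<rho> C" if p: "p \<in> frontier \<Omega>" for p
  proof -
    from C1_domain_chart[OF C1 p] obtain r e g \<Lambda> where ch: "r > 0" "norm e = 1" "\<Lambda> \<ge> (1::real)"
      "\<And>(x::'a) t. g (x + t *\<^sub>R e) = g x + t"
      "\<And>x y. x \<in> ball p r \<Longrightarrow> y \<in> ball p r \<Longrightarrow> \<bar>g x - g y\<bar> \<le> \<Lambda> * norm (x - y)"
      "\<And>x. x \<in> ball p r \<Longrightarrow> x \<in> \<Omega> \<longleftrightarrow> g x > 0" by metis
    have "?P p (r / (8 * \<Lambda>)) (8 * \<Lambda> * ball_vol TYPE('a) * r ^ DIM('a) / r)"
    proof (intro conjI allI impI)
      fix d assume d: "0 < d \<and> d \<le> r / (8 * \<Lambda>)"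
      show "measure lebesgue (boundary_layer \<Omega> d \<inter> ball p (2 * (r / (8 * \<Lambda>)))) \<le> 8 * \<Lambda> * ball_vol TYPE('a) * r ^ DIM('a) / r * d"
      proof (rule chart_layer[OF ch])
        have "2 * (r / (8 * \<Lambda>)) \<le> r / 4" using ch(1,3) by (simp add: field_simps)
        then show "boundary_layer \<Omega> d \<inter> ball p (2 * (r / (8 * \<Lambda>))) \<subseteq> \<Omega> \<inter> ball p (r / 4)" by (auto simp: boundary_layer_def)
        fix x assume "x \<in> boundary_layer \<Omega> d \<inter> ball p (2 * (r / (8 * \<Lambda>)))"
        then have "infdist x (- \<Omega>) < d" by (simp add: boundary_layer_def)
        then show "\<exists>z. z \<notin> \<Omega> \<and> dist x z < d" using ne infdist_attains_inf[of "- \<Omega>" x] op by (metis ComplD closed_Compl)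
      qed (use d bl in auto)
    qed (use ch ball_vol_pos[where 'a = 'a] in auto)
    then show ?thesis by blast
  qed
  then obtain \<rho> C where \<rho>C: "\<And>p. p \<in> frontier \<Omega> \<Longrightarrow> ?P p (\<rho> p) (C p)" by metis
  have "compact (frontier \<Omega>)" using bd by (simp add: compact_frontier_bounded)
  then obtain D where D: "D \<subseteq> frontier \<Omega>" "finite D" "frontier \<Omega> \<subseteq> (\<Union>p\<in>D. ball p (\<rho> p))"
    by (rule compactE_image[of "frontier \<Omega>" "frontier \<Omega>" "\<lambda>p. ball p (\<rho> p)"]) (use \<rho>C in force)+
  define \<rho>0 where "\<rho>0 = Min (insert 1 (\<rho> ` D))"
  have \<rho>0: "0 < \<rho>0" "\<And>p. p \<in> D \<Longrightarrow> \<rho>0 \<le> \<rho> p" using D \<rho>C by (auto simp: \<rho>0_def)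
  have CD: "0 \<le> (\<Sum>p\<in>D. C p)" using D \<rho>C by (intro sum_nonneg) (auto simp: less_imp_le)
  have small: "measure lebesgue (boundary_layer \<Omega> d) \<le> (\<Sum>p\<in>D. C p) * d" if d: "0 < d" "d \<le> \<rho>0" for d
  proof -
    have "boundary_layer \<Omega> d \<subseteq> (\<Union>p\<in>D. boundary_layer \<Omega> d \<inter> ball p (2 * \<rho> p))"
    proof
      fix x assume x: "x \<in> boundary_layer \<Omega> d"
      then have "infdist x (- \<Omega>) < d" "x \<in> \<Omega>" by (auto simp: boundary_layer_def)
      then obtain z where z: "z \<notin> \<Omega>" "dist x z < d" using ne infdist_attains_inf[of "- \<Omega>" x] op by (metis ComplD closed_Compl)
      \<comment> \<open>The charts are centred on the frontier, whereas x is only known to be close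
        to the complement. The segment to a nearby exterior point meets the frontier within d of x;
        the local estimates hold on balls of radius \<open>2 * \<rho> p\<close> to leave room for
        this step.\<close>
      have "closed_segment x z \<inter> frontier \<Omega> \<noteq> {}"
        using z \<open>x \<in> \<Omega>\<close> by (intro connected_Int_frontier) auto
      then obtain w where w: "w \<in> closed_segment x z" "w \<in> frontier \<Omega>" by blast
      have xw: "dist x w < d" using segment_bound(1)[OF w(1)] z(2) by (simp add: dist_norm norm_minus_commute)
      obtain p where p: "p \<in> D" "w \<in> ball p (\<rho> p)" using D w by blast
      have "dist p x < 2 * \<rho> p" using dist_triangle[of p x w] p xw \<rho>0(2)[OF p(1)] d by (simp add: dist_commute)
      then show "x \<in> (\<Union>p\<in>D. boundary_layer \<Omega> d \<inter> ball p (2 * \<rho> p))" using x p by auto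
    qed
    then have "measure lebesgue (boundary_layer \<Omega> d) \<le> measure lebesgue (\<Union>p\<in>D. boundary_layer \<Omega> d \<inter> ball p (2 * \<rho> p))"
      by (rule measure_mono_fmeasurable)
         (use bl2 D(2) in \<open>auto simp: bl intro!: fmeasurable_Int_fmeasurable sets.finite_UN\<close>)
    also have "\<dots> \<le> (\<Sum>p\<in>D. measure lebesgue (boundary_layer \<Omega> d \<inter> ball p (2 * \<rho> p)))"
      using D bl bl2 by (intro measure_UNION_le) auto
    also have "\<dots> \<le> (\<Sum>p\<in>D. C p * d)"
      using D \<rho>C d \<rho>0(2) by (intro sum_mono) (meson order_trans subsetD)
    finally show ?thesis by (simp add: sum_distrib_right)
  qed
  \<comment> \<open>The sum serves small d, the total volume serves d above \<open>\<rho>0\<close>,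
    and the 1 secures positivity.\<close>
  define C0 where "C0 = (\<Sum>p\<in>D. C p) + measure lebesgue \<Omega> / \<rho>0 + 1"
  have "measure lebesgue (boundary_layer \<Omega> d) \<le> C0 * d" if d: "0 < d" for d
  proof (cases "d \<le> \<rho>0")
    case True
    have "(\<Sum>p\<in>D. C p) * d \<le> C0 * d" unfolding C0_def using d \<rho>0 by (intro mult_right_mono) (auto simp: add_nonneg_nonneg)
    then show ?thesis using small[OF d True] by linarith
  next
    case False
    have "measure lebesgue (boundary_layer \<Omega> d) \<le> measure lebesgue \<Omega>"
      by (intro measure_mono_fmeasurable lm bl) (auto simp: boundary_layer_def)
    also have "\<dots> = (measure lebesgue \<Omega> / \<rho>0) * \<rho>0" using \<rho>0 by simp
    also have "\<dots> \<le> C0 * d" unfolding C0_def using False \<rho>0 CD by (intro mult_mono) auto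
    finally show ?thesis .
  qed
  moreover have "C0 > 0" unfolding C0_def using CD \<rho>0 by (simp add: add_nonneg_pos)
  ultimately show ?thesis by blast
qed

section \<open>Smooth cutoffs\<close>

text \<open>Finite-order version of \<open>smooth_fun\<close>: closure properties are proved by
  induction on k and carried to the coinductive predicate by \<open>smooth_fun_iff_Ck\<close>.
  \<open>Ck 0\<close> demands nothing, not even continuity; k counts how often the function may be
  differentiated.\<close>

primrec Ck :: "nat \<Rightarrow> ('a::euclidean_space \<Rightarrow> real) \<Rightarrow> bool" where
  "Ck 0 f = True"
| "Ck (Suc k) f = ((\<forall>x. f differentiable (at x)) \<and> (\<forall>b\<in>Basis. Ck k (\<lambda>x. frechet_derivative f (at x) b)))"

lemma Ck_SucI:
  assumes D: "\<And>x. (f has_derivative D x) (at x)" and "\<And>b. b \<in> Basis \<Longrightarrow> Ck k (\<lambda>x. D x b)"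
  shows "Ck (Suc k) f"
proof -
  have "frechet_derivative f (at x) = D x" for x using frechet_derivative_at[OF D[of x]] by simp
  then show ?thesis using assms by (auto simp: differentiable_def)
qed

lemma Ck_SucE:
  assumes "Ck (Suc k) f"
  obtains D where "\<And>x. (f has_derivative D x) (at x)" "\<And>b. b \<in> Basis \<Longrightarrow> Ck k (\<lambda>x. D x b)"
  using assms that[of "\<lambda>x. frechet_derivative f (at x)"] by (auto simp: frechet_derivative_works)

lemma Ck_mono_Suc: "Ck (Suc k) f \<Longrightarrow> Ck k f"
  by (induction k arbitrary: f) auto

lemma Ck_const: "Ck k (\<lambda>x. c)"
  by (induction k arbitrary: c) (auto simp: frechet_derivative_const)

lemma Ck_lincomb: "Ck k f \<Longrightarrow> Ck k g \<Longrightarrow> Ck k (\<lambda>x. a * f x + b * g x)"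
proof (induction k arbitrary: f g)
  case (Suc k)
  obtain D where D: "\<And>x. (f has_derivative D x) (at x)" "\<And>b. b \<in> Basis \<Longrightarrow> Ck k (\<lambda>x. D x b)"
    using Suc.prems(1) by (rule Ck_SucE) blast
  obtain E where E: "\<And>x. (g has_derivative E x) (at x)" "\<And>b. b \<in> Basis \<Longrightarrow> Ck k (\<lambda>x. E x b)"
    using Suc.prems(2) by (rule Ck_SucE) blast
  show ?case
  proof (rule Ck_SucI)
    show "((\<lambda>x. a * f x + b * g x) has_derivative (\<lambda>h. a * D x h + b * E x h)) (at x)" for x
      by (intro derivative_intros D E)
    show "Ck k (\<lambda>x. a * D x h + b * E x h)" if "h \<in> Basis" for h
      by (intro Suc.IH D E that)
  qed
qed simp

lemma Ck_mult: "Ck k f \<Longrightarrow> Ck k g \<Longrightarrow> Ck k (\<lambda>x. f x * g x)"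
proof (induction k arbitrary: f g)
  case (Suc k)
  obtain D where D: "\<And>x. (f has_derivative D x) (at x)" "\<And>b. b \<in> Basis \<Longrightarrow> Ck k (\<lambda>x. D x b)"
    using Suc.prems(1) by (rule Ck_SucE) blast
  obtain E where E: "\<And>x. (g has_derivative E x) (at x)" "\<And>b. b \<in> Basis \<Longrightarrow> Ck k (\<lambda>x. E x b)"
    using Suc.prems(2) by (rule Ck_SucE) blast
  show ?case
  proof (rule Ck_SucI)
    show "((\<lambda>x. f x * g x) has_derivative (\<lambda>h. f x * E x h + D x h * g x)) (at x)" for x
      by (intro derivative_intros D E)
    have "Ck k (\<lambda>x. 1 * (f x * E x h) + 1 * (D x h * g x))" if "h \<in> Basis" for h
      by (rule Ck_lincomb[OF Suc.IH[OF Ck_mono_Suc[OF Suc.prems(1)] E(2)[OF that]]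
            Suc.IH[OF D(2)[OF that] Ck_mono_Suc[OF Suc.prems(2)]]])
    then show "Ck k (\<lambda>x. f x * E x h + D x h * g x)" if "h \<in> Basis" for h using that by simp
  qed
qed simp

lemma Ck_inner: "Ck k (\<lambda>x. x \<bullet> b)"
proof (cases k)
  case (Suc j)
  show ?thesis unfolding Suc
    by (rule Ck_SucI[where D = "\<lambda>x h. h \<bullet> b"]) (auto intro!: derivative_eq_intros Ck_const)
qed simp

lemma smooth_fun_iff_Ck: "smooth_fun f \<longleftrightarrow> (\<forall>k. Ck k f)"
proof
  have "Ck k f" if "smooth_fun f" for k and f :: "'a \<Rightarrow> real"
    using that by (induction k arbitrary: f) (auto elim: smooth_fun.cases)
  then show "smooth_fun f \<Longrightarrow> \<forall>k. Ck k f" by blast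
  assume "\<forall>k. Ck k f"
  then show "smooth_fun f"
  proof (coinduction arbitrary: f)
    case smooth_fun
    have "f differentiable at x" "b \<in> Basis \<Longrightarrow> Ck k (\<lambda>x. frechet_derivative f (at x) b)" for x b k
      using smooth_fun[rule_format, of "Suc k"] by auto
    then show ?case by auto
  qed
qed

lemma smooth_fun_lincomb: "smooth_fun f \<Longrightarrow> smooth_fun g \<Longrightarrow> smooth_fun (\<lambda>x. a * f x + b * g x)"
  by (auto simp: smooth_fun_iff_Ck intro: Ck_lincomb)

lemma smooth_funD:
  assumes "smooth_fun f"
  shows "(f has_derivative frechet_derivative f (at x)) (at x)"
    and "b \<in> Basis \<Longrightarrow> smooth_fun (\<lambda>x. frechet_derivative f (at x) b)"
    and "continuous_on S f"
proof -
  have d: "f differentiable at x" for x using assms by (auto elim: smooth_fun.cases)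
  then show "(f has_derivative frechet_derivative f (at x)) (at x)" by (simp add: frechet_derivative_works)
  show "b \<in> Basis \<Longrightarrow> smooth_fun (\<lambda>x. frechet_derivative f (at x) b)" using assms by (auto elim: smooth_fun.cases)
  show "continuous_on S f" using d by (intro continuous_at_imp_continuous_on ballI differentiable_imp_continuous_within)
qed

text \<open>The family \<open>t\<^sup>-\<^sup>n exp (-1/t)\<close> is closed under differentiation up to linear combinations.\<close>
definition exp_flat :: "nat \<Rightarrow> real \<Rightarrow> real" where
  "exp_flat n t = (if t > 0 then exp (- (1 / t)) / t ^ n else 0)"

lemma exp_flat_tendsto_0: "((\<lambda>t. exp_flat n t) \<longlongrightarrow> 0) (at 0)"
proof -
  have "((\<lambda>y::real. y ^ n / exp y) \<longlongrightarrow> 0) at_top" by (rule tendsto_power_div_exp_0)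
  then have "((\<lambda>t::real. inverse t ^ n / exp (inverse t)) \<longlongrightarrow> 0) (at_right 0)"
    by (rule filterlim_compose[OF _ filterlim_inverse_at_top_right])
  then have "((\<lambda>t. exp_flat n t) \<longlongrightarrow> 0) (at_right 0)"
  proof (rule Lim_transform_eventually)
    show "\<forall>\<^sub>F t in at_right 0. inverse t ^ n / exp (inverse t) = exp_flat n t"
      by (rule eventually_at_rightI[of 0 1]) (auto simp: exp_flat_def exp_minus field_simps power_inverse)
  qed
  moreover have "((\<lambda>t. exp_flat n t) \<longlongrightarrow> 0) (at_left 0)"
    by (rule Lim_transform_eventually[OF tendsto_const])
       (auto simp: exp_flat_def eventually_at_left_field intro!: exI[of _ "-1"])
  ultimately show ?thesis by (simp add: filterlim_at_split)
qed

lemma exp_flat_derivative: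
  "(exp_flat n has_real_derivative (exp_flat (n + 2) t - real n * exp_flat (n + 1) t)) (at t)"
proof -
  consider "t > 0" | "t < 0" | "t = 0" by linarith
  then show ?thesis
  proof cases
    case 1
    have "((\<lambda>t. exp (- (1 / t)) / t ^ n) has_real_derivative (exp_flat (n + 2) t - real n * exp_flat (n + 1) t)) (at t)"
    proof -
      define E P where "E = exp (- (1 / t))" and "P = t ^ n"
      have P: "P > 0" using 1 by (simp add: P_def)
      have nP: "real n * t ^ (n - 1) = real n * P / t" unfolding P_def using 1 by (cases n) auto
      have "((\<lambda>t. exp (- (1 / t)) / t ^ n) has_real_derivative (E * (1 / t\<^sup>2) * P - E * (real n * t ^ (n - 1))) / (P * P)) (at t)"
        using 1 unfolding E_def P_def by (auto intro!: derivative_eq_intros simp: power2_eq_square)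
      also have "(E * (1 / t\<^sup>2) * P - E * (real n * t ^ (n - 1))) / (P * P) = E / (P * t\<^sup>2) - real n * (E / (P * t))"
        unfolding nP using 1 P by (simp add: field_simps power2_eq_square)
      also have "\<dots> = exp_flat (n + 2) t - real n * exp_flat (n + 1) t"
        using 1 by (simp add: exp_flat_def E_def P_def power_add power2_eq_square mult_ac)
      finally show ?thesis .
    qed
    then show ?thesis
      by (rule has_field_derivative_transform_within_open[of _ _ _ "{0<..}"]) (use 1 in \<open>auto simp: exp_flat_def\<close>)
  next
    case 2
    have "((\<lambda>t::real. 0) has_real_derivative 0) (at t)" by simp
    then have "(exp_flat n has_real_derivative 0) (at t)"
      by (rule has_field_derivative_transform_within_open[of _ _ _ "{..<0}"]) (use 2 in \<open>auto simp: exp_flat_def\<close>)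
    then show ?thesis using 2 by (simp add: exp_flat_def)
  next
    case 3
    \<comment> \<open>At 0 the difference quotient of \<open>exp_flat n\<close> is
      \<open>exp_flat (n + 1)\<close>, which tends to 0.\<close>
    have "((\<lambda>t. (exp_flat n t - exp_flat n 0) / (t - 0)) \<longlongrightarrow> 0) (at 0)"
      by (rule Lim_transform_eventually[OF exp_flat_tendsto_0[of "n + 1"]])
         (auto simp: exp_flat_def eventually_at_filter field_simps)
    then show ?thesis using 3 by (simp add: has_field_derivative_iff exp_flat_def)
  qed
qed

text \<open>The induction runs over all n at once, because the derivative of
  \<open>exp_flat n\<close> involves the orders n + 1 and n + 2.\<close>

lemma smooth_bump: "smooth_fun (\<lambda>x::'a::euclidean_space. exp_flat n (r - x \<bullet> x))"
proof -
  have "Ck k (\<lambda>x::'a. exp_flat n (r - x \<bullet> x))" for k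
  proof (induction k arbitrary: n)
    case (Suc k)
    let ?d = "\<lambda>x::'a. exp_flat (n + 2) (r - x \<bullet> x) - real n * exp_flat (n + 1) (r - x \<bullet> x)"
    show ?case
    proof (rule Ck_SucI)
      fix x :: 'a
      have q: "((\<lambda>x. r - x \<bullet> x) has_derivative (\<lambda>h. - 2 * (x \<bullet> h))) (at x)"
        by (auto intro!: derivative_eq_intros simp: inner_commute)
      show "((\<lambda>x. exp_flat n (r - x \<bullet> x)) has_derivative (\<lambda>h. ?d x * (- 2 * (x \<bullet> h)))) (at x)"
        using has_derivative_compose[OF q exp_flat_derivative[unfolded has_field_derivative_def]] by simp
    next
      fix b :: 'a
      \<comment> \<open>Trivial coefficients bring the derivative into the shape of
        \<open>Ck_mult\<close> and \<open>Ck_lincomb\<close>.\<close>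
      have "Ck k (\<lambda>x::'a. (1 * exp_flat (n + 2) (r - x \<bullet> x) + (- real n) * exp_flat (n + 1) (r - x \<bullet> x)) * ((- 2) * (x \<bullet> b) + 0 * (x \<bullet> b)))"
        by (intro Ck_mult Ck_lincomb Suc.IH Ck_inner)
      then show "Ck k (\<lambda>x. ?d x * (- 2 * (x \<bullet> b)))" by simp
    qed
  qed simp
  then show ?thesis by (simp add: smooth_fun_iff_Ck)
qed

section \<open>Convolution with a smooth kernel\<close>

definition mollify :: "('a::euclidean_space \<Rightarrow> real) \<Rightarrow> ('a \<Rightarrow> real) \<Rightarrow> 'a \<Rightarrow> real" where
  "mollify \<eta> a x = (\<integral>y. \<eta> (x - y) * a y \<partial>lborel)"

lemma mollify_integrable:
  fixes a \<eta> :: "'a::euclidean_space \<Rightarrow> real"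
  assumes \<eta>: "continuous_on UNIV \<eta>" and a: "integrable lborel a" "\<And>y. y \<notin> cball 0 B \<Longrightarrow> a y = 0"
  shows "integrable lborel (\<lambda>y. \<eta> (x - y) * a y)"
proof -
  have "compact ((\<lambda>y. \<eta> (x - y)) ` cball 0 B)"
    by (intro compact_continuous_image continuous_on_compose2[OF \<eta>] continuous_intros) auto
  then obtain K where K: "\<And>y. y \<in> cball 0 B \<Longrightarrow> norm (\<eta> (x - y)) \<le> K"
    using compact_imp_bounded bounded_iff by (metis imageI)
  have [measurable]: "\<eta> \<in> borel_measurable borel" using \<eta> by (rule borel_measurable_continuous_onI)
  have [measurable]: "a \<in> borel_measurable borel" using a(1) by (auto dest: borel_measurable_integrable)
  show ?thesis
  proof (rule Bochner_Integration.integrable_bound)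
    show "integrable lborel (\<lambda>y. K * a y)" using a by simp
    show "AE y in lborel. norm (\<eta> (x - y) * a y) \<le> norm (K * a y)"
    proof (rule AE_I2)
      fix y
      show "norm (\<eta> (x - y) * a y) \<le> norm (K * a y)"
      proof (cases "y \<in> cball 0 B")
        case True
        then have "\<bar>\<eta> (x - y)\<bar> \<le> \<bar>K\<bar>" using K[OF True] by simp
        then show ?thesis by (simp add: abs_mult mult_right_mono)
      qed (simp add: a)
    qed
  qed simp
qed

text \<open>The derivative falls on the kernel. As a lives on a bounded set, only values of the
  kernel on a compact set matter; its partial derivatives are uniformly continuous there, which
  makes the first-order remainder small uniformly in y.\<close>

lemma mollify_has_derivative:
  fixes a \<eta> :: "'a::euclidean_space \<Rightarrow> real"
  assumes \<eta>: "smooth_fun \<eta>" and a: "integrable lborel a" "\<And>y. y \<notin> cball 0 B \<Longrightarrow> a y = 0"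
  shows "(mollify \<eta> a has_derivative (\<lambda>h. \<Sum>b\<in>Basis. (h \<bullet> b) * mollify (\<lambda>z. frechet_derivative \<eta> (at z) b) a x)) (at x)"
proof -
  define D where "D z = frechet_derivative \<eta> (at z)" for z
  have \<eta>D: "(\<eta> has_derivative D z) (at z)" for z unfolding D_def by (rule smooth_funD(1)[OF \<eta>])
  have Dc: "continuous_on S (\<lambda>z. D z b)" if "b \<in> Basis" for b S
    unfolding D_def using smooth_funD(2)[OF \<eta> that] by (rule smooth_funD(3))
  have Dh: "D z h = (\<Sum>b\<in>Basis. (h \<bullet> b) * D z b)" for z h
  proof -
    interpret bounded_linear "D z" using \<eta>D by (rule has_derivative_bounded_linear)
    have "D z h = D z (\<Sum>b\<in>Basis. (h \<bullet> b) *\<^sub>R b)" by (simp add: euclidean_representation)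
    then show ?thesis by (simp add: sum scaleR)
  qed
  have i0: "integrable lborel (\<lambda>y. \<eta> (x - y) * a y)" for x
    by (rule mollify_integrable[OF smooth_funD(3)[OF \<eta>] a])
  have ib: "integrable lborel (\<lambda>y. D (x - y) b * a y)" if "b \<in> Basis" for x b
    by (rule mollify_integrable[OF Dc[OF that] a])
  have iD: "integrable lborel (\<lambda>y. D (x - y) h * a y)" for x h
  proof -
    have "integrable lborel (\<lambda>y. \<Sum>b\<in>Basis. (h \<bullet> b) * (D (x - y) b * a y))"
      by (intro Bochner_Integration.integrable_sum integrable_mult_right ib)
    then show ?thesis by (subst Dh) (simp add: sum_distrib_right mult.assoc)
  qed
  have Dint: "(\<Sum>b\<in>Basis. (h \<bullet> b) * mollify (\<lambda>z. D z b) a x) = (\<integral>y. D (x - y) h * a y \<partial>lborel)" for h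
  proof -
    have "(\<integral>y. D (x - y) h * a y \<partial>lborel) = (\<integral>y. (\<Sum>b\<in>Basis. (h \<bullet> b) * (D (x - y) b * a y)) \<partial>lborel)"
      by (subst Dh) (simp add: sum_distrib_right mult.assoc)
    also have "\<dots> = (\<Sum>b\<in>Basis. (h \<bullet> b) * mollify (\<lambda>z. D z b) a x)"
      unfolding mollify_def by (subst Bochner_Integration.integral_sum) (auto intro!: integrable_mult_right ib)
    finally show ?thesis by simp
  qed
  have "(mollify \<eta> a has_derivative (\<lambda>h. \<Sum>b\<in>Basis. (h \<bullet> b) * mollify (\<lambda>z. D z b) a x)) (at x)"
    unfolding has_derivative_at_alt
  proof (intro conjI allI impI)
    show "bounded_linear (\<lambda>h. \<Sum>b\<in>Basis. (h \<bullet> b) * mollify (\<lambda>z. D z b) a x)"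
      by (intro bounded_linear_sum bounded_linear_mult_const bounded_linear_inner_left)
    fix e :: real assume "e > 0"
    define A where "A = (\<integral>y. \<bar>a y\<bar> \<partial>lborel)"
    have A: "A \<ge> 0" by (simp add: A_def)
    \<comment> \<open>The L^1 norm A of a and one factor per basis vector enter the remainder; A + 1
      keeps the quotient meaningful for A = 0.\<close>
    define e' where "e' = e / ((A + 1) * DIM('a))"
    have e': "e' > 0" using \<open>e > 0\<close> A by (simp add: e'_def)
    define K where "K = cball (0::'a) (norm x + 1 + B)"
    have "\<exists>d>0. \<forall>u\<in>K. \<forall>v\<in>K. dist v u < d \<longrightarrow> \<bar>D v b - D u b\<bar> < e'" if "b \<in> Basis" for b
      using compact_uniformly_continuous[OF Dc[OF that, of K]] e' unfolding uniformly_continuous_on_def K_def dist_real_def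
      by auto
    then obtain d0 where d0: "\<And>b. b \<in> Basis \<Longrightarrow> d0 b > 0" "\<And>b u v. b \<in> Basis \<Longrightarrow> u \<in> K \<Longrightarrow> v \<in> K \<Longrightarrow> dist v u < d0 b \<Longrightarrow> \<bar>D v b - D u b\<bar> < e'"
      by metis
    define d where "d = Min (insert 1 (d0 ` Basis))"
    have d: "d > 0" "d \<le> 1" using d0 by (auto simp: d_def)
    have d_le: "d \<le> d0 b" if "b \<in> Basis" for b unfolding d_def using that by (intro Min_le) auto
    have rem: "\<bar>\<eta> (x' - y) - \<eta> (x - y) - D (x - y) (x' - x)\<bar> \<le> (DIM('a) * e') * norm (x' - x)"
      if x': "norm (x' - x) < d" and y: "y \<in> cball 0 B" for x' y
    proof -
      define f where "f w = \<eta> (w - y) - D (x - y) w" for w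
      interpret bounded_linear "D (x - y)" using \<eta>D by (rule has_derivative_bounded_linear)
      have "norm (f x' - f x) \<le> (DIM('a) * e') * norm (x' - x)"
      proof (rule differentiable_bound)
        show "convex (ball x d)" by simp
        fix w assume w: "w \<in> ball x d"
        have "((\<lambda>w. \<eta> (w - y)) has_derivative (\<lambda>h. D (w - y) h)) (at w)"
          by (rule has_derivative_compose[OF _ \<eta>D, of "\<lambda>w. w - y" "\<lambda>h. h"]) (auto intro!: derivative_eq_intros)
        then show "(f has_derivative (\<lambda>h. D (w - y) h - D (x - y) h)) (at w within ball x d)"
          unfolding f_def
          by (rule has_derivative_at_withinI[OF has_derivative_diff[OF _ bounded_linear_imp_has_derivative[OF bounded_linear_axioms]]])
        show "onorm (\<lambda>h. D (w - y) h - D (x - y) h) \<le> DIM('a) * e'"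
        proof (rule onorm_le)
          fix h
          have nx: "norm w \<le> norm x + 1" using w d norm_triangle_ineq[of x "w - x"] by (simp add: dist_norm norm_minus_commute)
          have K: "w - y \<in> K" "x - y \<in> K" using nx y norm_triangle_ineq4[of w y] norm_triangle_ineq4[of x y] by (auto simp: K_def)
          have dd: "dist (w - y) (x - y) < d" using w by (simp add: dist_norm norm_minus_commute)
          have "\<bar>D (w - y) h - D (x - y) h\<bar> = \<bar>\<Sum>b\<in>Basis. (h \<bullet> b) * (D (w - y) b - D (x - y) b)\<bar>"
            by (subst (1 2) Dh) (simp add: sum_subtractf algebra_simps)
          also have "\<dots> \<le> (\<Sum>b\<in>Basis. \<bar>(h \<bullet> b) * (D (w - y) b - D (x - y) b)\<bar>)" by (rule sum_abs)
          also have "\<dots> \<le> (\<Sum>b\<in>(Basis::'a set). norm h * e')"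
          proof (rule sum_mono)
            fix b :: 'a assume b: "b \<in> Basis"
            have "\<bar>D (w - y) b - D (x - y) b\<bar> \<le> e'"
              using d0(2)[OF b K(2) K(1)] dd d_le[OF b] by simp
            then show "\<bar>(h \<bullet> b) * (D (w - y) b - D (x - y) b)\<bar> \<le> norm h * e'"
              unfolding abs_mult by (intro mult_mono Basis_le_norm b) auto
          qed
          finally show "norm (D (w - y) h - D (x - y) h) \<le> DIM('a) * e' * norm h" by (simp add: mult_ac)
        qed
      qed (use x' d in \<open>auto simp: dist_norm norm_minus_commute\<close>)
      then show ?thesis by (simp add: f_def diff algebra_simps)
    qed
    have "norm (mollify \<eta> a x' - mollify \<eta> a x - (\<Sum>b\<in>Basis. ((x' - x) \<bullet> b) * mollify (\<lambda>z. D z b) a x)) \<le> e * norm (x' - x)"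
      if x': "norm (x' - x) < d" for x'
    proof -
      have eq: "mollify \<eta> a x' - mollify \<eta> a x - (\<Sum>b\<in>Basis. ((x' - x) \<bullet> b) * mollify (\<lambda>z. D z b) a x)
        = (\<integral>y. (\<eta> (x' - y) - \<eta> (x - y) - D (x - y) (x' - x)) * a y \<partial>lborel)"
        unfolding Dint unfolding mollify_def using i0[of x'] i0[of x] iD[of x "x' - x"]
        by (simp add: left_diff_distrib)
      have int: "integrable lborel (\<lambda>y. (\<eta> (x' - y) - \<eta> (x - y) - D (x - y) (x' - x)) * a y)"
        using i0[of x'] i0[of x] iD[of x "x' - x"] by (simp add: left_diff_distrib)
      have "\<bar>\<integral>y. (\<eta> (x' - y) - \<eta> (x - y) - D (x - y) (x' - x)) * a y \<partial>lborel\<bar>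
        \<le> (\<integral>y. \<bar>(\<eta> (x' - y) - \<eta> (x - y) - D (x - y) (x' - x)) * a y\<bar> \<partial>lborel)"
        by (rule integral_abs_bound)
      also have "\<dots> \<le> (\<integral>y. (DIM('a) * e') * norm (x' - x) * \<bar>a y\<bar> \<partial>lborel)"
      proof (rule integral_mono)
        fix y
        show "\<bar>(\<eta> (x' - y) - \<eta> (x - y) - D (x - y) (x' - x)) * a y\<bar> \<le> (DIM('a) * e') * norm (x' - x) * \<bar>a y\<bar>"
          using rem[OF x', of y] a(2)[of y] by (cases "y \<in> cball 0 B") (auto simp: abs_mult intro!: mult_right_mono)
      qed (use int a in auto)
      also have "\<dots> = (DIM('a) * e') * norm (x' - x) * A" by (simp add: A_def)
      also have "\<dots> = (A / (A + 1)) * e * norm (x' - x)" using A by (simp add: e'_def)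
      also have "\<dots> \<le> 1 * e * norm (x' - x)" using A \<open>e > 0\<close> by (intro mult_right_mono) auto
      finally show ?thesis unfolding eq by simp
    qed
    then show "\<exists>d>0. \<forall>y. norm (y - x) < d \<longrightarrow> norm (mollify \<eta> a y - mollify \<eta> a x - (\<Sum>b\<in>Basis. ((y - x) \<bullet> b) * mollify (\<lambda>z. D z b) a x)) \<le> e * norm (y - x)"
      using d by blast
  qed
  then show ?thesis by (simp add: D_def)
qed

lemma smooth_fun_mollify:
  fixes a \<eta> :: "'a::euclidean_space \<Rightarrow> real"
  assumes \<eta>: "smooth_fun \<eta>" and a: "integrable lborel a" "\<And>y. y \<notin> cball 0 B \<Longrightarrow> a y = 0"
  shows "smooth_fun (mollify \<eta> a)"
proof -
  have "Ck k (mollify \<eta> a)" if "smooth_fun \<eta>" for k \<eta>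
    using that
  proof (induction k arbitrary: \<eta>)
    case (Suc k)
    show ?case
    proof (rule Ck_SucI)
      show "(mollify \<eta> a has_derivative (\<lambda>h. \<Sum>b\<in>Basis. (h \<bullet> b) * mollify (\<lambda>z. frechet_derivative \<eta> (at z) b) a x)) (at x)" for x
        by (rule mollify_has_derivative[OF Suc.prems a])
      fix c :: 'a assume c: "c \<in> Basis"
      have "(\<Sum>b\<in>Basis. (c \<bullet> b) * mollify (\<lambda>z. frechet_derivative \<eta> (at z) b) a x) = mollify (\<lambda>z. frechet_derivative \<eta> (at z) c) a x" for x
        using c by (simp add: inner_Basis if_distrib[of "\<lambda>t. t * _"] cong: if_cong)
      moreover have "Ck k (mollify (\<lambda>z. frechet_derivative \<eta> (at z) c) a)"
        by (rule Suc.IH) (rule smooth_funD(2)[OF Suc.prems c])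
      ultimately show "Ck k (\<lambda>x. \<Sum>b\<in>Basis. (c \<bullet> b) * mollify (\<lambda>z. frechet_derivative \<eta> (at z) b) a x)" by simp
    qed
  qed simp
  then show ?thesis using \<eta> by (simp add: smooth_fun_iff_Ck)
qed

text \<open>Here translates of a are averaged against the kernel, so bounds and Lipschitz constants
  of a pass to the convolution, while smoothness is read off the other form.\<close>

lemma mollify_commute:
  fixes a \<eta> :: "'a::euclidean_space \<Rightarrow> real"
  assumes [measurable]: "a \<in> borel_measurable borel" "\<eta> \<in> borel_measurable borel"
  shows "mollify \<eta> a x = (\<integral>y. \<eta> y * a (x - y) \<partial>lborel)"
proof -
  have "(lborel :: 'a measure) = distr lborel borel (\<lambda>y. x - y)"
    using lborel_affine[of "-1" x] by (simp add: density_1)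
  then have "mollify \<eta> a x = (\<integral>y. \<eta> (x - y) * a y \<partial>(distr lborel borel (\<lambda>y. x - y)))"
    unfolding mollify_def by simp
  also have "\<dots> = (\<integral>y. \<eta> y * a (x - y) \<partial>lborel)"
    by (subst integral_distr) auto
  finally show ?thesis .
qed

lemma normalized_bump:
  assumes "\<delta> > 0"
  obtains \<eta> :: "'a::euclidean_space \<Rightarrow> real" where "smooth_fun \<eta>" "\<And>y. 0 \<le> \<eta> y" "\<And>y. \<delta> \<le> norm y \<Longrightarrow> \<eta> y = 0"
    "integrable lborel \<eta>" "(\<integral>y. \<eta> y \<partial>lborel) = 1"
proof -
  define h where "h y = exp_flat 0 (\<delta>\<^sup>2 - y \<bullet> y)" for y :: 'a
  have h: "smooth_fun h" unfolding h_def by (rule smooth_bump)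
  have hpos: "h y > 0" if "norm y < \<delta>" for y
    using power_strict_mono[OF that, of 2] by (simp add: h_def exp_flat_def dot_square_norm)
  have hz: "h y = 0" if "\<delta> \<le> norm y" for y
  proof -
    have "\<delta>\<^sup>2 \<le> (norm y)\<^sup>2" using that assms by (intro power_mono) auto
    then show ?thesis by (simp add: h_def exp_flat_def dot_square_norm)
  qed
  have h0: "h y \<ge> 0" for y using hpos[of y] hz[of y] by (cases "norm y < \<delta>") auto
  have "integrable lborel (\<lambda>y. h (0 - y) * indicator (cball 0 \<delta>) y)"
    by (rule mollify_integrable[where B = \<delta>]) (use smooth_funD(3)[OF h] in \<open>auto intro!: integrable_real_indicator emeasure_lborel_cball_finite\<close>)
  moreover have "(\<lambda>y. h (0 - y) * indicator (cball 0 \<delta>) y) = h"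
  proof
    fix y show "h (0 - y) * indicator (cball 0 \<delta>) y = h y"
      using hz[of y] by (cases "norm y \<le> \<delta>") (auto simp: h_def)
  qed
  ultimately have int: "integrable lborel h" by simp
  define I where "I = (\<integral>y. h y \<partial>lborel)"
  have "I \<noteq> 0"
  proof
    assume "I = 0"
    then have "AE y in lborel. h y = 0"
      unfolding I_def using integral_nonneg_eq_0_iff_AE[OF int] h0 by simp
    then have "AE y in lborel. y \<notin> ball (0::'a) \<delta>"
      by eventually_elim (use hpos in \<open>force simp: dist_norm\<close>)
    then have "ball (0::'a) \<delta> \<in> null_sets lborel" by (subst (asm) AE_iff_null_sets [symmetric]) auto
    then have "measure lborel (ball (0::'a) \<delta>) = 0" by (auto simp: null_sets_def measure_def)
    then show False using content_ball_gt_0_iff[of "0::'a" \<delta>] assms by simp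
  qed
  moreover have "I \<ge> 0" unfolding I_def by (simp add: h0)
  ultimately have I: "I > 0" by simp
  show ?thesis
  proof (rule that[of "\<lambda>y. (1 / I) * h y + 0 * h y"])
    show "smooth_fun (\<lambda>y. (1 / I) * h y + 0 * h y)" by (rule smooth_fun_lincomb[OF h h])
  qed (use I h0 hz int in \<open>auto simp: I_def\<close>)
qed

text \<open>The distance to the complement is turned into a ramp from 0 at 3 \<delta> to 1 at 4
  \<delta> and mollified at scale \<delta>. Mollification moves the thresholds by at most \<delta>,
  giving 2 \<delta> and 5 \<delta>, and keeps the Lipschitz constant 1 / \<delta>; the zero zone
  keeps the closed support inside the open set.\<close>

lemma smooth_cutoff:
  fixes \<Omega> :: "'a::euclidean_space set"
  assumes \<Omega>: "open \<Omega>" "bounded \<Omega>" and \<delta>: "\<delta> > 0"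
  obtains f where "f \<in> Cc_inf \<Omega>" "\<And>x. 0 \<le> f x" "\<And>x. f x \<le> 1" "\<And>x y. \<bar>f x - f y\<bar> \<le> norm (x - y) / \<delta>"
    "\<And>x. 5 * \<delta> \<le> infdist x (- \<Omega>) \<Longrightarrow> f x = 1" "\<And>x. infdist x (- \<Omega>) < \<delta> \<Longrightarrow> f x = 0"
proof -
  obtain \<eta> :: "'a \<Rightarrow> real" where \<eta>: "smooth_fun \<eta>" "\<And>y. 0 \<le> \<eta> y" "\<And>y. \<delta> \<le> norm y \<Longrightarrow> \<eta> y = 0"
    "integrable lborel \<eta>" "(\<integral>y. \<eta> y \<partial>lborel) = 1"
    using normalized_bump[OF \<delta>] by blast
  have [measurable]: "\<eta> \<in> borel_measurable borel" using \<eta>(4) by (auto dest: borel_measurable_integrable)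
  define D where "D x = infdist x (- \<Omega>)" for x
  have Dlip: "\<bar>D x - D y\<bar> \<le> norm (x - y)" for x y
    unfolding D_def using infdist_triangle_abs[of x "- \<Omega>" y] by (simp add: dist_norm)
  have Dc: "continuous_on S D" for S unfolding D_def by (intro continuous_intros)
  define a where "a y = max 0 (min 1 (D y / \<delta> - 3))" for y
  have a01: "0 \<le> a y" "a y \<le> 1" for y by (auto simp: a_def)
  have alip: "\<bar>a x - a y\<bar> \<le> norm (x - y) / \<delta>" for x y
  proof -
    have "\<bar>a x - a y\<bar> \<le> \<bar>D x / \<delta> - D y / \<delta>\<bar>" unfolding a_def by linarith
    also have "\<dots> = \<bar>D x - D y\<bar> / \<delta>" using \<delta> by (simp add: diff_divide_distrib [symmetric])
    also have "\<dots> \<le> norm (x - y) / \<delta>" using Dlip \<delta> by (intro divide_right_mono) auto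
    finally show ?thesis .
  qed
  have a1: "a y = 1" if "4 * \<delta> \<le> D y" for y using that \<delta> by (simp add: a_def pos_le_divide_eq)
  have a0: "a y = 0" if "D y \<le> 3 * \<delta>" for y using that \<delta> by (simp add: a_def pos_divide_le_eq)
  have "continuous_on UNIV a" unfolding a_def by (intro continuous_intros Dc) (use \<delta> in auto)
  then have am [measurable]: "a \<in> borel_measurable borel" by (rule borel_measurable_continuous_onI)
  obtain B where "\<And>x. x \<in> \<Omega> \<Longrightarrow> norm x \<le> B" using \<Omega>(2) by (auto simp: bounded_iff)
  then have B: "\<Omega> \<subseteq> cball 0 B" by auto
  have aB: "a y = 0" if "y \<notin> cball 0 B" for y
  proof -
    have "y \<notin> \<Omega>" using that B by auto
    then show ?thesis using \<delta> by (intro a0) (simp add: D_def)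
  qed
  have aint: "integrable lborel a"
  proof (rule Bochner_Integration.integrable_bound[of _ "indicator (cball 0 B)"])
    show "integrable lborel (indicator (cball (0::'a) B) :: 'a \<Rightarrow> real)"
      by (intro integrable_real_indicator emeasure_lborel_cball_finite) simp
    show "AE y in lborel. norm (a y) \<le> norm (indicator (cball 0 B) y :: real)"
      using a01 aB by (intro AE_I2) (auto simp: indicator_def)
  qed simp
  define f where "f = mollify \<eta> a"
  have f: "f x = (\<integral>y. \<eta> y * a (x - y) \<partial>lborel)" for x unfolding f_def by (rule mollify_commute) measurable
  have int: "integrable lborel (\<lambda>y. \<eta> y * a (x - y))" for x
  proof (rule Bochner_Integration.integrable_bound[OF \<eta>(4)])
    show "AE y in lborel. norm (\<eta> y * a (x - y)) \<le> norm (\<eta> y)"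
      using a01 by (intro AE_I2) (auto simp: abs_mult intro: mult_left_le)
  qed simp
  have Dxy: "D x - \<delta> < D (x - y) \<and> D (x - y) < D x + \<delta>" if "norm y < \<delta>" for x y
    using Dlip[of x "x - y"] that by (simp add: abs_le_iff)
  have one: "f x = 1" if "5 * \<delta> \<le> D x" for x
  proof -
    have eq: "\<eta> y * a (x - y) = \<eta> y" for y
      using \<eta>(3)[of y] a1[of "x - y"] Dxy[of y x] that by (cases "norm y < \<delta>") auto
    show ?thesis unfolding f eq by (rule \<eta>)
  qed
  have zero: "f x = 0" if "D x \<le> 2 * \<delta>" for x
  proof -
    have eq: "\<eta> y * a (x - y) = 0" for y
      using \<eta>(3)[of y] a0[of "x - y"] Dxy[of y x] that by (cases "norm y < \<delta>") auto
    show ?thesis unfolding f eq by simp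
  qed
  have sm: "smooth_fun f" unfolding f_def by (rule smooth_fun_mollify[OF \<eta>(1) aint aB])
  have cl: "closure {x. f x \<noteq> 0} \<subseteq> {x. 2 * \<delta> \<le> D x}"
  proof (rule closure_minimal)
    show "{x. f x \<noteq> 0} \<subseteq> {x. 2 * \<delta> \<le> D x}" using zero by force
    show "closed {x. 2 * \<delta> \<le> D x}" by (intro closed_Collect_le continuous_intros Dc)
  qed
  also have sub: "{x. 2 * \<delta> \<le> D x} \<subseteq> \<Omega>"
    using \<delta> by (auto simp: D_def intro: ccontr)
  finally have cl\<Omega>: "closure {x. f x \<noteq> 0} \<subseteq> \<Omega>" .
  have "f \<in> Cc_inf \<Omega>"
    unfolding Cc_inf_def using sm cl\<Omega> bounded_subset[OF \<Omega>(2) cl\<Omega>] by (auto simp: compact_eq_bounded_closed)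
  moreover have "0 \<le> f x" for x unfolding f using \<eta> a01 by simp
  moreover have "f x \<le> 1" for x
  proof -
    have "f x \<le> (\<integral>y. \<eta> y \<partial>lborel)" unfolding f by (intro integral_mono int \<eta>) (use \<eta> a01 in \<open>auto intro: mult_left_le\<close>)
    then show ?thesis by (simp add: \<eta>)
  qed
  moreover have "\<bar>f x - f x'\<bar> \<le> norm (x - x') / \<delta>" for x x'
  proof -
    have "f x - f x' = (\<integral>y. \<eta> y * (a (x - y) - a (x' - y)) \<partial>lborel)"
      unfolding f using int by (simp add: right_diff_distrib)
    then have "\<bar>f x - f x'\<bar> \<le> (\<integral>y. \<bar>\<eta> y * (a (x - y) - a (x' - y))\<bar> \<partial>lborel)"
      using integral_abs_bound by simp
    also have "\<dots> \<le> (\<integral>y. \<eta> y * (norm (x - x') / \<delta>) \<partial>lborel)"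
    proof (rule integral_mono)
      show "integrable lborel (\<lambda>y. \<bar>\<eta> y * (a (x - y) - a (x' - y))\<bar>)"
        using int[of x] int[of x'] by (simp add: right_diff_distrib)
      show "\<bar>\<eta> y * (a (x - y) - a (x' - y))\<bar> \<le> \<eta> y * (norm (x - x') / \<delta>)" for y
        using mult_left_mono[OF alip[of "x - y" "x' - y"] \<eta>(2)[of y]] by (simp add: abs_mult \<eta>(2))
    qed (use \<eta> in auto)
    also have "\<dots> = norm (x - x') / \<delta>" using \<eta> by simp
    finally show ?thesis .
  qed
  ultimately show ?thesis using that[of f] one zero \<delta> unfolding D_def by force
qed

section \<open>Test functions of small energy\<close>

text \<open>Dyadic decomposition of |x - y| around \<delta>, with a truncation factor at most 4^-j
  inside and at most 1 outside. Each annulus is enlarged to a ball, whose volume is known.\<close>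

lemma riesz_truncated_pointwise:
  fixes x y :: "'a::euclidean_space"
  assumes "0 < s" "0 < \<delta>"
  defines "\<alpha> \<equiv> real DIM('a) + 2 * s"
  shows "ennreal (min 1 ((norm (x - y) / \<delta>)\<^sup>2) * riesz_kernel s (x, y))
    \<le> (\<Sum>j. ennreal ((1/4) ^ j * (\<delta> / 2 ^ Suc j) powr (- \<alpha>)) * indicator (ball x (\<delta> / 2 ^ j)) y
          + ennreal ((\<delta> * 2 ^ j) powr (- \<alpha>)) * indicator (ball x (\<delta> * 2 ^ Suc j)) y)"
    (is "?f \<le> (\<Sum>j. ?g j)")
proof (cases "x = y")
  case False
  have single: "?g j \<le> (\<Sum>j. ?g j)" for j
    using sum_le_suminf[OF summableI, of "{j}" ?g] by simp
  have \<alpha>: "\<alpha> > 0" using assms by (simp add: \<alpha>_def)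
  define t where "t = norm (x - y)"
  have t: "t > 0" using False by (simp add: t_def)
  have kern: "riesz_kernel s (x, y) = t powr (- \<alpha>)" by (simp add: riesz_kernel_def t_def \<alpha>_def)
  show ?thesis
  proof (cases "t < \<delta>")
    case True
    have ex: "\<exists>j. \<delta> / 2 ^ j \<le> t"
    proof -
      obtain j where "\<delta> / t < 2 ^ j" using real_arch_pow[of 2 "\<delta> / t"] by auto
      then show ?thesis using t by (intro exI[of _ j]) (simp add: field_simps)
    qed
    define i where "i = (LEAST j. \<delta> / 2 ^ j \<le> t)"
    have i: "\<delta> / 2 ^ i \<le> t" unfolding i_def using ex by (rule LeastI_ex)
    then obtain j where j: "i = Suc j" using True by (cases i) auto
    have j2: "t < \<delta> / 2 ^ j" using not_less_Least[of j "\<lambda>j. \<delta> / 2 ^ j \<le> t"] j unfolding i_def by auto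
    have "min 1 ((t / \<delta>)\<^sup>2) \<le> (1/4) ^ j"
    proof -
      have "t / \<delta> \<le> (1/2) ^ j" using j2 assms by (simp add: field_simps power_divide)
      then have "(t / \<delta>)\<^sup>2 \<le> ((1/2) ^ j)\<^sup>2" using t assms by (intro power_mono) auto
      also have "\<dots> = (1/4) ^ j" by (simp add: power_mult [symmetric] power_divide mult.commute[of j] power_mult)
      finally show ?thesis by simp
    qed
    moreover have "t powr (- \<alpha>) \<le> (\<delta> / 2 ^ Suc j) powr (- \<alpha>)"
      using i j assms \<alpha> by (intro powr_mono2') auto
    ultimately have "min 1 ((t / \<delta>)\<^sup>2) * t powr (- \<alpha>) \<le> (1/4) ^ j * (\<delta> / 2 ^ Suc j) powr (- \<alpha>)"
      by (intro mult_mono) auto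
    then have "?f \<le> ennreal ((1/4) ^ j * (\<delta> / 2 ^ Suc j) powr (- \<alpha>))"
      unfolding kern t_def [symmetric] by (rule ennreal_leI)
    also have "\<dots> \<le> ?g j" using j2 by (simp add: t_def dist_norm)
    also note single[of j]
    finally show ?thesis .
  next
    case False
    have ex: "\<exists>j. t < \<delta> * 2 ^ Suc j"
    proof -
      obtain j where "t / \<delta> < 2 ^ j" using real_arch_pow[of 2 "t / \<delta>"] by auto
      then show ?thesis using assms t by (intro exI[of _ j]) (simp add: field_simps)
    qed
    define j where "j = (LEAST j. t < \<delta> * 2 ^ Suc j)"
    have j: "t < \<delta> * 2 ^ Suc j" unfolding j_def using ex by (rule LeastI_ex)
    have j2: "\<delta> * 2 ^ j \<le> t"
    proof (cases j)
      case (Suc i)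
      then show ?thesis using not_less_Least[of i "\<lambda>j. t < \<delta> * 2 ^ Suc j"] unfolding j_def by auto
    qed (use False in simp)
    have "t powr (- \<alpha>) \<le> (\<delta> * 2 ^ j) powr (- \<alpha>)"
      using j2 assms \<alpha> by (intro powr_mono2') auto
    then have "min 1 ((t / \<delta>)\<^sup>2) * t powr (- \<alpha>) \<le> 1 * (\<delta> * 2 ^ j) powr (- \<alpha>)"
      by (intro mult_mono) auto
    then have "?f \<le> ennreal ((\<delta> * 2 ^ j) powr (- \<alpha>))"
      unfolding kern t_def [symmetric] mult_1_left by (rule ennreal_leI)
    also have "\<dots> \<le> ?g j" using j by (simp add: t_def dist_norm)
    also note single[of j]
    finally show ?thesis .
  qed
qed (simp add: riesz_kernel_def)

text \<open>Two geometric series take the place of polar coordinates: the ratio \<open>q1\<close> is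
  below 1 because s < 1, which is integrability near the singularity, and \<open>q2\<close> because
  s > 0, which is integrability at infinity.\<close>

lemma riesz_truncated_integral:
  assumes s: "0 < s" "s < 1"
  shows "\<exists>C>0. \<forall>\<delta>>0. \<forall>x::'a::euclidean_space.
    (\<integral>\<^sup>+y. ennreal (min 1 ((norm (x - y) / \<delta>)\<^sup>2) * riesz_kernel s (x, y)) \<partial>lebesgue) \<le> ennreal (C * \<delta> powr (- 2 * s))"
proof -
  define n where "n = real DIM('a)"
  define \<alpha> where "\<alpha> = n + 2 * s"
  define \<omega> where "\<omega> = ball_vol TYPE('a)"
  have \<omega>: "\<omega> > 0" unfolding \<omega>_def by (rule ball_vol_pos)
  define q1 where "q1 = (2::real) powr (2 * s - 2)"
  define q2 where "q2 = (2::real) powr (- 2 * s)"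
  have q: "0 < q1" "q1 < 1" "0 < q2" "q2 < 1"
    using s powr_less_mono[of "2 * s - 2" 0 2] powr_less_mono[of "- 2 * s" 0 2] by (auto simp: q1_def q2_def)
  define C where "C = \<omega> * 2 powr \<alpha> / (1 - q1) + \<omega> * 2 powr n / (1 - q2)"
  have C: "C > 0" unfolding C_def using \<omega> q by (intro add_pos_pos divide_pos_pos mult_pos_pos) auto
  have "(\<integral>\<^sup>+y. ennreal (min 1 ((norm (x - y) / \<delta>)\<^sup>2) * riesz_kernel s (x, y)) \<partial>lebesgue) \<le> ennreal (C * \<delta> powr (- 2 * s))"
    if \<delta>: "\<delta> > 0" for \<delta> and x :: 'a
  proof -
    let ?a = "\<lambda>j::nat. (1/4) ^ j * (\<delta> / 2 ^ Suc j) powr (- \<alpha>)" and ?b = "\<lambda>j::nat. (\<delta> * 2 ^ j) powr (- \<alpha>)"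
    define g where "g j y = ennreal (?a j) * indicator (ball x (\<delta> / 2 ^ j)) y + ennreal (?b j) * indicator (ball x (\<delta> * 2 ^ Suc j)) y" for j y
    have ind: "(indicator (ball x r) :: 'a \<Rightarrow> ennreal) \<in> borel_measurable lebesgue" for r
      by (rule borel_measurable_indicator) simp
    have gm: "g j \<in> borel_measurable lebesgue" for j
      unfolding g_def[abs_def] by (intro borel_measurable_add borel_measurable_times_ennreal borel_measurable_const ind)
    have pw: "2 ^ j = (2::real) powr real j" for j by (simp add: powr_realpow)
    have pw4: "(1/4) ^ j = (2::real) powr (- 2 * real j)" for j
    proof -
      have "(2::real) powr (- 2 * real j) = (2 powr (-2)) powr real j" by (simp only: powr_powr)
      also have "(2::real) powr (-2) = 1/4" by (simp add: powr_minus powr_numeral)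
      finally show ?thesis by (simp add: powr_realpow)
    qed
    \<comment> \<open>Writing \<open>\<delta>\<close> as a power of 2 reduces the following
      identities to ring identities between exponents.\<close>
    have \<delta>pw: "\<delta> = 2 powr (log 2 \<delta>)" using \<delta> by simp
    have aj: "?a j * (\<omega> * (\<delta> / 2 ^ j) ^ DIM('a)) = (\<omega> * 2 powr \<alpha> * \<delta> powr (- 2 * s)) * q1 ^ j" for j
    proof -
      have "(\<delta> / 2 ^ j) ^ DIM('a) = (\<delta> / 2 ^ j) powr n" using \<delta> by (simp add: n_def powr_realpow)
      also have "\<dots> = 2 powr (n * (log 2 \<delta> - real j))"
        unfolding pw by (subst \<delta>pw) (simp only: powr_diff [symmetric] powr_powr mult.commute)
      finally have 1: "(\<delta> / 2 ^ j) ^ DIM('a) = 2 powr (n * (log 2 \<delta> - real j))" .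
      have 2: "(\<delta> / 2 ^ Suc j) powr (- \<alpha>) = 2 powr (- \<alpha> * (log 2 \<delta> - real (Suc j)))"
        unfolding pw by (subst \<delta>pw) (simp only: powr_diff [symmetric] powr_powr mult.commute)
      have 3: "\<delta> powr (- 2 * s) = 2 powr (- 2 * s * log 2 \<delta>)"
        by (subst \<delta>pw) (simp only: powr_powr mult.commute)
      have 4: "q1 ^ j = 2 powr ((2 * s - 2) * real j)" unfolding q1_def by (simp add: powr_powr[symmetric] powr_realpow)
      have "?a j * (\<omega> * (\<delta> / 2 ^ j) ^ DIM('a)) = \<omega> * (2 powr (- 2 * real j) * 2 powr (- \<alpha> * (log 2 \<delta> - real (Suc j))) * 2 powr (n * (log 2 \<delta> - real j)))"
        unfolding pw4 1 2 by simp
      also have "\<dots> = \<omega> * (2 powr \<alpha> * 2 powr (- 2 * s * log 2 \<delta>) * 2 powr ((2 * s - 2) * real j))"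
        unfolding powr_add [symmetric] by (simp add: \<alpha>_def algebra_simps)
      finally show ?thesis unfolding 3 4 by simp
    qed
    have bj: "?b j * (\<omega> * (\<delta> * 2 ^ Suc j) ^ DIM('a)) = (\<omega> * 2 powr n * \<delta> powr (- 2 * s)) * q2 ^ j" for j
    proof -
      have "(\<delta> * 2 ^ Suc j) ^ DIM('a) = (\<delta> * 2 ^ Suc j) powr n" using \<delta> by (simp add: n_def powr_realpow)
      also have "\<dots> = 2 powr (n * (log 2 \<delta> + real (Suc j)))"
        unfolding pw by (subst \<delta>pw) (simp only: powr_add [symmetric] powr_powr mult.commute add.commute)
      finally have 1: "(\<delta> * 2 ^ Suc j) ^ DIM('a) = 2 powr (n * (log 2 \<delta> + real (Suc j)))" .
      have 2: "(\<delta> * 2 ^ j) powr (- \<alpha>) = 2 powr (- \<alpha> * (log 2 \<delta> + real j))"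
        unfolding pw by (subst \<delta>pw) (simp only: powr_add [symmetric] powr_powr mult.commute add.commute)
      have 3: "\<delta> powr (- 2 * s) = 2 powr (- 2 * s * log 2 \<delta>)"
        by (subst \<delta>pw) (simp only: powr_powr mult.commute)
      have 4: "q2 ^ j = 2 powr ((- 2 * s) * real j)" 
        using powr_realpow[of q2 j] q by (simp add: q2_def powr_powr)
      have "?b j * (\<omega> * (\<delta> * 2 ^ Suc j) ^ DIM('a)) = \<omega> * (2 powr (- \<alpha> * (log 2 \<delta> + real j)) * 2 powr (n * (log 2 \<delta> + real (Suc j))))"
        unfolding 1 2 by simp
      also have "\<dots> = \<omega> * (2 powr n * 2 powr (- 2 * s * log 2 \<delta>) * 2 powr ((- 2 * s) * real j))"
        unfolding powr_add [symmetric] by (simp add: \<alpha>_def algebra_simps)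
      finally show ?thesis unfolding 3 4 by simp
    qed
    have "(\<integral>\<^sup>+y. ennreal (min 1 ((norm (x - y) / \<delta>)\<^sup>2) * riesz_kernel s (x, y)) \<partial>lebesgue) \<le> (\<integral>\<^sup>+y. (\<Sum>j. g j y) \<partial>lebesgue)"
      using riesz_truncated_pointwise[OF s(1) \<delta>, of x] unfolding \<alpha>_def n_def g_def by (rule nn_integral_mono)
    also have "\<dots> = (\<Sum>j. \<integral>\<^sup>+y. g j y \<partial>lebesgue)"
      by (rule nn_integral_suminf[OF gm])
    also have "\<dots> = (\<Sum>j. ennreal ((\<omega> * 2 powr \<alpha> * \<delta> powr (- 2 * s)) * q1 ^ j + (\<omega> * 2 powr n * \<delta> powr (- 2 * s)) * q2 ^ j))"
    proof (rule suminf_cong)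
      fix j
      have "(\<integral>\<^sup>+y. g j y \<partial>lebesgue) = ennreal (?a j) * emeasure lebesgue (ball x (\<delta> / 2 ^ j)) + ennreal (?b j) * emeasure lebesgue (ball x (\<delta> * 2 ^ Suc j))"
      proof -
        have "(\<integral>\<^sup>+y. g j y \<partial>lebesgue) = (\<integral>\<^sup>+y. ennreal (?a j) * indicator (ball x (\<delta> / 2 ^ j)) y \<partial>lebesgue)
           + (\<integral>\<^sup>+y. ennreal (?b j) * indicator (ball x (\<delta> * 2 ^ Suc j)) y \<partial>lebesgue)"
          unfolding g_def by (intro nn_integral_add borel_measurable_times_ennreal borel_measurable_const ind)
        then show ?thesis by (simp only: nn_integral_cmult_indicator[OF lmeasurable_ball[THEN fmeasurableD]])
      qed
      also have "emeasure lebesgue (ball x (\<delta> / 2 ^ j)) = ennreal (\<omega> * (\<delta> / 2 ^ j) ^ DIM('a))"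
        unfolding \<omega>_def by (rule emeasure_ball_scaling) (use \<delta> in simp)
      also have "emeasure lebesgue (ball x (\<delta> * 2 ^ Suc j)) = ennreal (\<omega> * (\<delta> * 2 ^ Suc j) ^ DIM('a))"
        unfolding \<omega>_def by (rule emeasure_ball_scaling) (use \<delta> in simp)
      also have "ennreal (?a j) * ennreal (\<omega> * (\<delta> / 2 ^ j) ^ DIM('a)) = ennreal ((\<omega> * 2 powr \<alpha> * \<delta> powr (- 2 * s)) * q1 ^ j)"
        by (subst ennreal_mult' [symmetric]) (simp, simp only: aj)
      also have "ennreal (?b j) * ennreal (\<omega> * (\<delta> * 2 ^ Suc j) ^ DIM('a)) = ennreal ((\<omega> * 2 powr n * \<delta> powr (- 2 * s)) * q2 ^ j)"
        by (subst ennreal_mult' [symmetric]) (simp, simp only: bj)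
      finally show "(\<integral>\<^sup>+y. g j y \<partial>lebesgue) = ennreal ((\<omega> * 2 powr \<alpha> * \<delta> powr (- 2 * s)) * q1 ^ j + (\<omega> * 2 powr n * \<delta> powr (- 2 * s)) * q2 ^ j)"
        using \<omega> q by (subst ennreal_plus) auto
    qed
    also have "\<dots> = ennreal ((\<omega> * 2 powr \<alpha> * \<delta> powr (- 2 * s)) * (1 / (1 - q1)) + (\<omega> * 2 powr n * \<delta> powr (- 2 * s)) * (1 / (1 - q2)))"
      using \<omega> q by (intro suminf_ennreal_eq sums_add sums_mult geometric_sums) auto
    also have "(\<omega> * 2 powr \<alpha> * \<delta> powr (- 2 * s)) * (1 / (1 - q1)) + (\<omega> * 2 powr n * \<delta> powr (- 2 * s)) * (1 / (1 - q2)) = C * \<delta> powr (- 2 * s)"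
      by (simp add: C_def distrib_right)
    finally show ?thesis .
  qed
  then show ?thesis using C by blast
qed

lemma riesz_kernel_interpolation:
  fixes z :: "'a::euclidean_space \<times> 'a"
  assumes "1/2 \<le> s" "s \<le> 3/4"
  shows "riesz_kernel s z \<le> (3 - 4 * s) * riesz_kernel (1/2) z + (4 * s - 2) * riesz_kernel (3/4) z"
proof -
  \<comment> \<open>\<open>powr_interpolation\<close> takes positive exponents, hence the base 1 /
    |x - y|; on the diagonal the base is 1 / 0 = 0 and both sides vanish. The weight 4 s - 2 is the
    position of s in [1/2, 3/4].\<close>
  have eq: "riesz_kernel r z = (1 / norm (fst z - snd z)) powr (real DIM('a) + 2 * r)" for r
    by (simp only: riesz_kernel_def powr_divide powr_minus_divide powr_one_eq_one)
  show ?thesis unfolding eq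
    using powr_interpolation[of "1 / norm (fst z - snd z)" "real DIM('a) + 2 * (1/2)" "4 * s - 2" "real DIM('a) + 2 * s" "real DIM('a) + 2 * (3/4)"] assms
    by (simp add: algebra_simps)
qed

lemma emeasure_lebesgue_on:
  assumes \<Omega>: "\<Omega> \<in> lmeasurable" and A: "A \<in> sets lebesgue" "A \<subseteq> \<Omega>"
  shows "emeasure (lebesgue_on \<Omega>) A = ennreal (measure lebesgue A)"
proof -
  have "\<Omega> \<inter> space lebesgue \<in> sets lebesgue" using \<Omega> by auto
  then have "emeasure (lebesgue_on \<Omega>) A = emeasure lebesgue A" using A(2) by (rule emeasure_restrict_space)
  also have "\<dots> = ennreal (measure lebesgue A)"
    by (rule emeasure_eq_ennreal_measure[OF fmeasurableD2[OF fmeasurableI2[OF \<Omega> A(2,1)]]])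
  finally show ?thesis .
qed

text \<open>The integrand vanishes unless one of the points lies in L, and there it is at most the
  truncated kernel, so by symmetry twice the measure of L times C bounds the energy. For s = 1/2 and
  a layer of width 5 \<delta>, C is of order 1 / \<delta>, so the bound does not depend on \<delta>;
  with L the whole domain it gives finiteness for every s in (0, 1).\<close>

lemma gagliardo_cutoff_bound:
  fixes \<Omega> :: "'a::euclidean_space set" and f :: "'a \<Rightarrow> real"
  assumes \<Omega>: "\<Omega> \<in> lmeasurable" and L: "L \<in> sets lebesgue" "L \<subseteq> \<Omega>" and \<delta>: "\<delta> > 0" and C: "C \<ge> 0"
    and kern: "\<And>x::'a. (\<integral>\<^sup>+y. ennreal (min 1 ((norm (x - y) / \<delta>)\<^sup>2) * riesz_kernel s (x, y)) \<partial>lebesgue) \<le> ennreal C"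
    and f01: "\<And>x. 0 \<le> f x" "\<And>x. f x \<le> 1" and lip: "\<And>x y. \<bar>f x - f y\<bar> \<le> norm (x - y) / \<delta>"
    and const: "\<And>x y. x \<in> \<Omega> - L \<Longrightarrow> y \<in> \<Omega> - L \<Longrightarrow> f x = f y"
  shows "gagliardo s \<Omega> f \<le> ennreal (2 * measure lebesgue L * C)"
proof -
  define M where "M = lebesgue_on \<Omega>"
  interpret finite_measure M unfolding M_def by (rule finite_measure_lebesgue_on) fact
  interpret pair: pair_sigma_finite M M ..
  have \<Omega>s: "\<Omega> \<inter> space lebesgue \<in> sets lebesgue" using \<Omega> by auto
  define k where "k z = min 1 ((norm (fst z - snd z) / \<delta>)\<^sup>2) * riesz_kernel s z" for z :: "'a \<times> 'a"
  have k0: "k z \<ge> 0" for z by (simp add: k_def riesz_kernel_nonneg)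
  have [measurable]: "riesz_kernel s \<in> borel_measurable (M \<Otimes>\<^sub>M M)" "(\<lambda>z. norm (fst z - snd z)) \<in> borel_measurable (M \<Otimes>\<^sub>M M)"
    unfolding M_def by (rule riesz_kernel_measurable norm_diff_measurable)+
  have km [measurable]: "k \<in> borel_measurable (M \<Otimes>\<^sub>M M)" unfolding k_def[abs_def] by measurable
  have Lm [measurable]: "L \<in> sets M" unfolding M_def using L \<Omega> by (auto simp: sets_restrict_space_iff)
  have mL: "emeasure M L = ennreal (measure lebesgue L)"
    unfolding M_def by (rule emeasure_lebesgue_on) fact+
  have inner: "(\<integral>\<^sup>+y. ennreal (k (x, y)) \<partial>M) \<le> ennreal C" for x
  proof -
    have "(\<integral>\<^sup>+y. ennreal (k (x, y)) \<partial>M) = (\<integral>\<^sup>+y. ennreal (k (x, y)) * indicator \<Omega> y \<partial>lebesgue)"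
      unfolding M_def using \<Omega>s by (rule nn_integral_restrict_space)
    also have "\<dots> \<le> (\<integral>\<^sup>+y. ennreal (k (x, y)) \<partial>lebesgue)" by (intro nn_integral_mono) (auto simp: indicator_def)
    also have "\<dots> \<le> ennreal C" using kern[of x] by (simp add: k_def)
    finally show ?thesis .
  qed
  have ksym: "k (x, y) = k (y, x)" for x y by (simp add: k_def riesz_kernel_def norm_minus_commute)
  have half: "(\<integral>\<^sup>+x. (\<integral>\<^sup>+y. ennreal (k (x, y)) \<partial>M) * indicator L x \<partial>M) \<le> ennreal (measure lebesgue L * C)"
  proof -
    have "(\<integral>\<^sup>+x. (\<integral>\<^sup>+y. ennreal (k (x, y)) \<partial>M) * indicator L x \<partial>M) \<le> (\<integral>\<^sup>+x. ennreal C * indicator L x \<partial>M)"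
      by (intro nn_integral_mono mult_right_mono inner) auto
    also have "\<dots> = ennreal C * ennreal (measure lebesgue L)" using Lm by (simp add: nn_integral_cmult_indicator mL)
    finally show ?thesis using C by (simp add: ennreal_mult' [symmetric] mult.commute)
  qed
  have "gagliardo s \<Omega> f \<le> (\<integral>\<^sup>+z. (ennreal (k z) * indicator L (fst z) + ennreal (k z) * indicator L (snd z)) \<partial>(M \<Otimes>\<^sub>M M))"
    unfolding gagliardo_def M_def [symmetric]
  proof (rule nn_integral_mono)
    fix z assume z: "z \<in> space (M \<Otimes>\<^sub>M M)"
    show "ennreal ((f (fst z) - f (snd z))\<^sup>2 * riesz_kernel s z) \<le> ennreal (k z) * indicator L (fst z) + ennreal (k z) * indicator L (snd z)"
    proof (cases "fst z \<in> L \<or> snd z \<in> L")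
      case True
      have "\<bar>f (fst z) - f (snd z)\<bar> \<le> 1" using f01[of "fst z"] f01[of "snd z"] by linarith
      then have "(f (fst z) - f (snd z))\<^sup>2 \<le> 1" by (simp add: abs_square_le_1)
      moreover have "(f (fst z) - f (snd z))\<^sup>2 \<le> (norm (fst z - snd z) / \<delta>)\<^sup>2"
        using lip[of "fst z" "snd z"] \<delta> by (intro abs_le_square_iff [THEN iffD1]) simp
      ultimately have "(f (fst z) - f (snd z))\<^sup>2 * riesz_kernel s z \<le> k z"
        unfolding k_def by (intro mult_right_mono riesz_kernel_nonneg) simp
      then have "ennreal ((f (fst z) - f (snd z))\<^sup>2 * riesz_kernel s z) \<le> ennreal (k z)" by (rule ennreal_leI)
      also have "\<dots> \<le> ennreal (k z) * indicator L (fst z) + ennreal (k z) * indicator L (snd z)"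
        using True by (auto simp: indicator_def)
      finally show ?thesis .
    next
      case False
      then have "f (fst z) = f (snd z)" using z by (intro const) (auto simp: space_pair_measure M_def)
      then show ?thesis by simp
    qed
  qed
  also have "\<dots> = (\<integral>\<^sup>+z. ennreal (k z) * indicator L (fst z) \<partial>(M \<Otimes>\<^sub>M M)) + (\<integral>\<^sup>+z. ennreal (k z) * indicator L (snd z) \<partial>(M \<Otimes>\<^sub>M M))"
    by (rule nn_integral_add) measurable
  also have "(\<integral>\<^sup>+z. ennreal (k z) * indicator L (fst z) \<partial>(M \<Otimes>\<^sub>M M)) = (\<integral>\<^sup>+x. (\<integral>\<^sup>+y. ennreal (k (x, y)) \<partial>M) * indicator L x \<partial>M)"
  proof -
    have "(\<lambda>z. ennreal (k z) * indicator L (fst z)) \<in> borel_measurable (M \<Otimes>\<^sub>M M)" by measurable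
    from nn_integral_fst[OF this] have "(\<integral>\<^sup>+z. ennreal (k z) * indicator L (fst z) \<partial>(M \<Otimes>\<^sub>M M)) = (\<integral>\<^sup>+x. \<integral>\<^sup>+y. ennreal (k (x, y)) * indicator L x \<partial>M \<partial>M)"
      by simp
    also have "\<dots> = (\<integral>\<^sup>+x. (\<integral>\<^sup>+y. ennreal (k (x, y)) \<partial>M) * indicator L x \<partial>M)"
      by (intro nn_integral_cong nn_integral_multc) (auto intro!: measurable_compose_Pair1[OF _ measurable_compose[OF km measurable_ennreal]])
    finally show ?thesis .
  qed
  also have "(\<integral>\<^sup>+z. ennreal (k z) * indicator L (snd z) \<partial>(M \<Otimes>\<^sub>M M)) = (\<integral>\<^sup>+y. (\<integral>\<^sup>+x. ennreal (k (y, x)) \<partial>M) * indicator L y \<partial>M)"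
  proof -
    have "(\<lambda>z. ennreal (k z) * indicator L (snd z)) \<in> borel_measurable (M \<Otimes>\<^sub>M M)" by measurable
    from pair.nn_integral_snd[OF this] have "(\<integral>\<^sup>+z. ennreal (k z) * indicator L (snd z) \<partial>(M \<Otimes>\<^sub>M M)) = (\<integral>\<^sup>+y. \<integral>\<^sup>+x. ennreal (k (y, x)) * indicator L y \<partial>M \<partial>M)"
      by (simp add: ksym)
    also have "\<dots> = (\<integral>\<^sup>+y. (\<integral>\<^sup>+x. ennreal (k (y, x)) \<partial>M) * indicator L y \<partial>M)"
      by (intro nn_integral_cong nn_integral_multc) (auto intro!: measurable_compose_Pair1[OF _ measurable_compose[OF km measurable_ennreal]])
    finally show ?thesis .
  qed
  also have "(\<integral>\<^sup>+x. (\<integral>\<^sup>+y. ennreal (k (x, y)) \<partial>M) * indicator L x \<partial>M) + (\<integral>\<^sup>+x. (\<integral>\<^sup>+y. ennreal (k (x, y)) \<partial>M) * indicator L x \<partial>M)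
    \<le> ennreal (measure lebesgue L * C) + ennreal (measure lebesgue L * C)"
    by (intro add_mono half)
  also have "\<dots> = ennreal (2 * measure lebesgue L * C)"
    using C by (subst ennreal_plus [symmetric]) auto
  finally show ?thesis .
qed

text \<open>Expanding the square leaves a cross term, for which a one-sided bound suffices. Its
  majorant is integrable by finiteness of the measure, and its integral is small when L is.\<close>

lemma gagliardo_convex_combination:
  fixes \<Omega> :: "'a::euclidean_space set" and f g :: "'a \<Rightarrow> real"
  assumes \<Omega>: "\<Omega> \<in> lmeasurable" and L: "L \<in> sets lebesgue" "L \<subseteq> \<Omega>" and c: "0 \<le> c" and \<theta>: "0 \<le> \<theta>" "\<theta> \<le> 1"
    and m: "f \<in> borel_measurable (lebesgue_on \<Omega>)" "g \<in> borel_measurable (lebesgue_on \<Omega>)"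
    and cross: "\<And>x y. x \<in> \<Omega> \<Longrightarrow> y \<in> \<Omega> \<Longrightarrow> (f x - f y) * (g x - g y) * riesz_kernel s (x, y) \<le> c * (indicator L x + indicator L y)"
    and E: "gagliardo s \<Omega> f \<le> ennreal a" "gagliardo s \<Omega> g \<le> ennreal b" and ab: "0 \<le> a" "0 \<le> b"
  shows "gagliardo s \<Omega> (\<lambda>x. \<theta> * f x + (1 - \<theta>) * g x)
     \<le> ennreal (\<theta>\<^sup>2 * a + (1 - \<theta>)\<^sup>2 * b + 2 * \<theta> * (1 - \<theta>) * (2 * c * measure lebesgue L * measure lebesgue \<Omega>))"
proof -
  define M where "M = lebesgue_on \<Omega>"
  interpret finite_measure M unfolding M_def by (rule finite_measure_lebesgue_on) fact
  interpret pair: pair_sigma_finite M M ..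
  have \<Omega>s: "\<Omega> \<inter> space lebesgue \<in> sets lebesgue" using \<Omega> by auto
  have [measurable]: "riesz_kernel s \<in> borel_measurable (M \<Otimes>\<^sub>M M)"
    unfolding M_def by (rule riesz_kernel_measurable)
  have [measurable]: "f \<in> borel_measurable M" "g \<in> borel_measurable M" using m by (auto simp: M_def)
  have Lm [measurable]: "L \<in> sets M" unfolding M_def using L \<Omega> by (auto simp: sets_restrict_space_iff)
  have mL: "emeasure M A = ennreal (measure lebesgue A)" if "A \<in> sets lebesgue" "A \<subseteq> \<Omega>" for A
    unfolding M_def using \<Omega> that by (rule emeasure_lebesgue_on)
  let ?h = "\<lambda>z. indicator L (fst z) + indicator L (snd z) :: real"
  let ?F = "\<lambda>z. (f (fst z) - f (snd z))\<^sup>2 * riesz_kernel s z"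
  let ?G = "\<lambda>z. (g (fst z) - g (snd z))\<^sup>2 * riesz_kernel s z"
  have sp: "space M = \<Omega>" by (simp add: M_def)
  have hint: "(\<integral>\<^sup>+z. ennreal (?h z) \<partial>(M \<Otimes>\<^sub>M M)) = ennreal (2 * measure lebesgue L * measure lebesgue \<Omega>)"
  proof -
    have "(\<integral>\<^sup>+z. ennreal (?h z) \<partial>(M \<Otimes>\<^sub>M M)) = (\<integral>\<^sup>+z. indicator (L \<times> \<Omega>) z + indicator (\<Omega> \<times> L) z \<partial>(M \<Otimes>\<^sub>M M))"
      by (intro nn_integral_cong) (auto simp: space_pair_measure sp indicator_def)
    also have "\<dots> = emeasure (M \<Otimes>\<^sub>M M) (L \<times> \<Omega>) + emeasure (M \<Otimes>\<^sub>M M) (\<Omega> \<times> L)"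
      using Lm sets.top[of M] unfolding sp by (subst nn_integral_add) (auto intro!: borel_measurable_indicator pair_measureI)
    also have "\<dots> = ennreal (measure lebesgue L) * ennreal (measure lebesgue \<Omega>) + ennreal (measure lebesgue \<Omega>) * ennreal (measure lebesgue L)"
      using Lm sets.top[of M] unfolding sp by (simp add: emeasure_pair_measure_Times mL L \<Omega> fmeasurableD)
    also have "\<dots> = ennreal (2 * measure lebesgue L * measure lebesgue \<Omega>)"
      by (simp add: ennreal_mult' [symmetric] ennreal_plus [symmetric] del: ennreal_plus)
    finally show ?thesis .
  qed
  have "gagliardo s \<Omega> (\<lambda>x. \<theta> * f x + (1 - \<theta>) * g x)
    \<le> ennreal 1 * (\<integral>\<^sup>+z. ennreal (\<theta>\<^sup>2 * ?F z + (1 - \<theta>)\<^sup>2 * ?G z) \<partial>(M \<Otimes>\<^sub>M M)) + ennreal (2 * \<theta> * (1 - \<theta>) * c) * (\<integral>\<^sup>+z. ennreal (?h z) \<partial>(M \<Otimes>\<^sub>M M))"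
    unfolding gagliardo_def M_def [symmetric]
  proof (rule nn_integral_real_lincomb_le)
    fix z assume z: "z \<in> space (M \<Otimes>\<^sub>M M)"
    then have cr: "(f (fst z) - f (snd z)) * (g (fst z) - g (snd z)) * riesz_kernel s z \<le> c * ?h z"
      using cross[of "fst z" "snd z"] by (auto simp: space_pair_measure sp)
    have "(\<theta> * f (fst z) + (1 - \<theta>) * g (fst z) - (\<theta> * f (snd z) + (1 - \<theta>) * g (snd z)))\<^sup>2 * riesz_kernel s z
      = (\<theta>\<^sup>2 * ?F z + (1 - \<theta>)\<^sup>2 * ?G z) + 2 * \<theta> * (1 - \<theta>) * ((f (fst z) - f (snd z)) * (g (fst z) - g (snd z)) * riesz_kernel s z)"
      by (simp add: power2_eq_square algebra_simps)
    also have "\<dots> \<le> (\<theta>\<^sup>2 * ?F z + (1 - \<theta>)\<^sup>2 * ?G z) + 2 * \<theta> * (1 - \<theta>) * (c * ?h z)"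
      using \<theta> by (intro add_left_mono mult_left_mono cr) auto
    finally show "(\<theta> * f (fst z) + (1 - \<theta>) * g (fst z) - (\<theta> * f (snd z) + (1 - \<theta>) * g (snd z)))\<^sup>2 * riesz_kernel s z
      \<le> 1 * (\<theta>\<^sup>2 * ?F z + (1 - \<theta>)\<^sup>2 * ?G z) + 2 * \<theta> * (1 - \<theta>) * c * ?h z" by (simp add: mult.assoc)
  qed (use \<theta> c in \<open>auto simp: riesz_kernel_nonneg\<close>)
  also have "(\<integral>\<^sup>+z. ennreal (\<theta>\<^sup>2 * ?F z + (1 - \<theta>)\<^sup>2 * ?G z) \<partial>(M \<Otimes>\<^sub>M M)) = ennreal (\<theta>\<^sup>2) * gagliardo s \<Omega> f + ennreal ((1 - \<theta>)\<^sup>2) * gagliardo s \<Omega> g"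
    unfolding gagliardo_def M_def [symmetric] by (rule nn_integral_real_lincomb) (auto simp: riesz_kernel_nonneg)
  also have "ennreal 1 * (ennreal (\<theta>\<^sup>2) * gagliardo s \<Omega> f + ennreal ((1 - \<theta>)\<^sup>2) * gagliardo s \<Omega> g) + ennreal (2 * \<theta> * (1 - \<theta>) * c) * (\<integral>\<^sup>+z. ennreal (?h z) \<partial>(M \<Otimes>\<^sub>M M))
    \<le> ennreal 1 * (ennreal (\<theta>\<^sup>2) * ennreal a + ennreal ((1 - \<theta>)\<^sup>2) * ennreal b) + ennreal (2 * \<theta> * (1 - \<theta>) * c) * ennreal (2 * measure lebesgue L * measure lebesgue \<Omega>)"
    unfolding hint by (intro add_mono mult_left_mono E) auto
  also have "\<dots> = ennreal (\<theta>\<^sup>2 * a + (1 - \<theta>)\<^sup>2 * b + 2 * \<theta> * (1 - \<theta>) * (2 * c * measure lebesgue L * measure lebesgue \<Omega>))"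
    using \<theta> c ab by (simp add: ennreal_mult' [symmetric] ennreal_plus [symmetric] mult_ac del: ennreal_plus)
  finally show ?thesis .
qed

lemma Cc_inf_lincomb:
  assumes "f \<in> Cc_inf \<Omega>" "g \<in> Cc_inf \<Omega>"
  shows "(\<lambda>x. a * f x + b * g x) \<in> Cc_inf \<Omega>"
proof -
  have sub: "closure {x. a * f x + b * g x \<noteq> 0} \<subseteq> closure {x. f x \<noteq> 0} \<union> closure {x. g x \<noteq> 0}"
    unfolding closure_Un [symmetric] by (rule closure_mono) auto
  moreover have "compact (closure {x. f x \<noteq> 0} \<union> closure {x. g x \<noteq> 0})"
    using assms by (intro compact_Un) (auto simp: Cc_inf_def)
  ultimately have "compact (closure {x. a * f x + b * g x \<noteq> 0})"
    using compact_eq_bounded_closed bounded_subset by blast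
  then show ?thesis using assms sub smooth_fun_lincomb[of f g a b] by (auto simp: Cc_inf_def)
qed

lemma Cc_inf_measurable:
  assumes "f \<in> Cc_inf \<Omega>"
  shows "f \<in> borel_measurable (lebesgue_on S)"
proof -
  have "f \<in> borel_measurable borel" using assms smooth_funD(3)[of f UNIV] by (auto simp: Cc_inf_def intro: borel_measurable_continuous_onI)
  then show ?thesis by (intro measurable_restrict_space1) (simp add: measurable_completion)
qed

lemma constant_off_boundary_layer:
  assumes "\<And>x. r \<le> infdist x (- \<Omega>) \<Longrightarrow> f x = (1::real)"
    and "x \<in> \<Omega> - boundary_layer \<Omega> r" "y \<in> \<Omega> - boundary_layer \<Omega> r"
  shows "f x = f y"
  using assms by (force simp: boundary_layer_def not_less)

text \<open>The boundary has zero capacity in \<open>H\<^sup>1\<^sup>/\<^sup>2\<close>: the cutoffs at scale \<open>\<delta>\<close> have bounded energy, and cutoffs at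
  very different scales are almost orthogonal, so averages of \<open>n\<close> of them have energy \<open>O(1/n)\<close>.\<close>
lemma half_energy_cutoffs:
  fixes \<Omega> :: "'a::euclidean_space set"
  assumes C1: "C1_domain \<Omega>" and r0: "r0 > 0"
  shows "\<exists>B>0. \<forall>m. \<exists>f\<in>Cc_inf \<Omega>. (\<forall>x. 0 \<le> f x \<and> f x \<le> 1) \<and>
     (\<exists>\<delta>>0. \<forall>x y. \<bar>f x - f y\<bar> \<le> norm (x - y) / \<delta>) \<and> (\<exists>\<rho>>0. \<forall>x. infdist x (- \<Omega>) < \<rho> \<longrightarrow> f x = 0) \<and>
     (\<forall>x. r0 \<le> infdist x (- \<Omega>) \<longrightarrow> f x = 1) \<and> gagliardo (1/2) \<Omega> f \<le> ennreal (2 * B / real (Suc m))"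
proof -
  have op: "open \<Omega>" and bd: "bounded \<Omega>" using C1 by (auto simp: C1_domain_def)
  have \<Omega>: "\<Omega> \<in> lmeasurable" using op bd by (simp add: lmeasurable_open)
  have Lm: "boundary_layer \<Omega> d \<in> sets lebesgue" "boundary_layer \<Omega> d \<subseteq> \<Omega>" for d
    by (rule sets_completionI_sets, simp add: boundary_layer_open[OF op], simp add: boundary_layer_def)
  obtain CL where CL: "CL > 0" "\<And>d. d > 0 \<Longrightarrow> measure lebesgue (boundary_layer \<Omega> d) \<le> CL * d"
    using C1_domain_boundary_layer[OF C1] by blast
  obtain CK where CK: "CK > 0" "\<And>\<delta> x. \<delta> > 0 \<Longrightarrow>
     (\<integral>\<^sup>+y. ennreal (min 1 ((norm (x - y) / \<delta>)\<^sup>2) * riesz_kernel (1/2) (x, y :: 'a)) \<partial>lebesgue) \<le> ennreal (CK * \<delta> powr (- 2 * (1/2)))"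
    using riesz_truncated_integral[of "1/2", where 'a = 'a] by auto
  \<comment> \<open>2 from the two variables and 5 from the width 5 \<delta> of the layer; \<delta>
    cancels against the kernel bound.\<close>
  define B where "B = 10 * CL * CK"
  have B: "B > 0" using CL CK by (simp add: B_def)
  have cut: "\<exists>g\<in>Cc_inf \<Omega>. (\<forall>x. 0 \<le> g x \<and> g x \<le> 1) \<and> (\<forall>x y. \<bar>g x - g y\<bar> \<le> norm (x - y) / \<delta>) \<and>
     (\<forall>x. infdist x (- \<Omega>) < \<delta> \<longrightarrow> g x = 0) \<and> (\<forall>x. 5 * \<delta> \<le> infdist x (- \<Omega>) \<longrightarrow> g x = 1) \<and> gagliardo (1/2) \<Omega> g \<le> ennreal B"
    if \<delta>: "\<delta> > 0" for \<delta>
  proof -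
    obtain g where g: "g \<in> Cc_inf \<Omega>" "\<And>x. 0 \<le> g x" "\<And>x. g x \<le> 1" "\<And>x y. \<bar>g x - g y\<bar> \<le> norm (x - y) / \<delta>"
      "\<And>x. 5 * \<delta> \<le> infdist x (- \<Omega>) \<Longrightarrow> g x = 1" "\<And>x. infdist x (- \<Omega>) < \<delta> \<Longrightarrow> g x = 0"
      using smooth_cutoff[OF op bd \<delta>] by blast
    let ?L = "boundary_layer \<Omega> (5 * \<delta>)"
    have "gagliardo (1/2) \<Omega> g \<le> ennreal (2 * measure lebesgue ?L * (CK * \<delta> powr (- 2 * (1/2))))"
      by (rule gagliardo_cutoff_bound[OF \<Omega> Lm \<delta> _ CK(2)[OF \<delta>] g(2-4) constant_off_boundary_layer[OF g(5)]])
         (use CK \<Omega> in \<open>auto simp: fmeasurableD\<close>)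
    also have "\<dots> \<le> ennreal B"
    proof (rule ennreal_leI)
      have "2 * measure lebesgue ?L * (CK * \<delta> powr (- 2 * (1/2))) \<le> 2 * (CL * (5 * \<delta>)) * (CK * \<delta> powr (- 2 * (1/2)))"
        using CL(2)[of "5 * \<delta>"] \<delta> CK(1) by (intro mult_right_mono mult_left_mono) auto
      also have "\<dots> = B" using \<delta> by (simp add: B_def powr_minus_divide)
      finally show "2 * measure lebesgue ?L * (CK * \<delta> powr (- 2 * (1/2))) \<le> B" .
    qed
    finally show ?thesis using g by (intro bexI[of _ g]) auto
  qed
  have "\<exists>f\<in>Cc_inf \<Omega>. (\<forall>x. 0 \<le> f x \<and> f x \<le> 1) \<and>
     (\<exists>\<delta>>0. \<forall>x y. \<bar>f x - f y\<bar> \<le> norm (x - y) / \<delta>) \<and> (\<exists>\<rho>>0. \<forall>x. infdist x (- \<Omega>) < \<rho> \<longrightarrow> f x = 0) \<and>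
     (\<forall>x. r0 \<le> infdist x (- \<Omega>) \<longrightarrow> f x = 1) \<and> gagliardo (1/2) \<Omega> f \<le> ennreal (2 * B / real (Suc m))" for m
  proof (induction m)
    case 0
    obtain g where g: "g \<in> Cc_inf \<Omega>" "\<forall>x. 0 \<le> g x \<and> g x \<le> 1" "\<forall>x y. \<bar>g x - g y\<bar> \<le> norm (x - y) / (r0 / 5)"
      "\<forall>x. infdist x (- \<Omega>) < r0 / 5 \<longrightarrow> g x = 0" "\<forall>x. 5 * (r0 / 5) \<le> infdist x (- \<Omega>) \<longrightarrow> g x = 1" "gagliardo (1/2) \<Omega> g \<le> ennreal B"
      using cut[of "r0 / 5"] r0 by auto
    have "gagliardo (1/2) \<Omega> g \<le> ennreal (2 * B / real (Suc 0))"
      using g(6) by (rule order_trans) (use B in \<open>auto intro: ennreal_leI\<close>)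
    then show ?case using g r0 by (intro bexI[OF _ g(1)]) (auto intro!: exI[of _ "r0 / 5"])
  next
    case (Suc m)
    define n where "n = real (Suc m)"
    have n: "n \<ge> 1" by (simp add: n_def)
    obtain f \<delta>1 \<rho> where f: "f \<in> Cc_inf \<Omega>" "\<And>x. 0 \<le> f x" "\<And>x. f x \<le> 1"
      and \<delta>1: "\<delta>1 > 0" "\<And>x y. \<bar>f x - f y\<bar> \<le> norm (x - y) / \<delta>1"
      and \<rho>: "\<rho> > 0" "\<And>x. infdist x (- \<Omega>) < \<rho> \<Longrightarrow> f x = 0"
      and f1: "\<And>x. r0 \<le> infdist x (- \<Omega>) \<Longrightarrow> f x = 1" and fE: "gagliardo (1/2) \<Omega> f \<le> ennreal (2 * B / n)"
      using Suc.IH unfolding n_def by auto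
    \<comment> \<open>Bounds the kernel at distances from \<open>\<rho> / 2\<close> on: points where
      f is nonzero have distance at least \<open>\<rho>\<close> from the complement, and points
      where g differs from 1 have distance below 5 \<delta>, hence below
      \<open>\<rho> / 2\<close>.\<close>
    define c where "c = (\<rho> / 2) powr (- (real DIM('a) + 2 * (1/2)))"
    have c: "c > 0" using \<rho> by (simp add: c_def)
    define V where "V = measure lebesgue \<Omega> + 1"
    have V: "V > 0" by (simp add: V_def add_nonneg_pos)
    \<comment> \<open>The first entry separates the two transition zones, the second makes g equal
      to 1 wherever the claim asks for it, the third makes the cross term at most B in the final
      sum.\<close>
    define \<delta> where "\<delta> = min (\<rho> / 10) (min (r0 / 5) (B / (20 * n * c * CL * V)))"
    have \<delta>: "\<delta> > 0" using \<rho> r0 B n c CL V by (auto simp: \<delta>_def)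
    have \<delta>le: "5 * \<delta> \<le> \<rho> / 2" "5 * \<delta> \<le> r0" "\<delta> \<le> B / (20 * n * c * CL * V)" by (auto simp: \<delta>_def)
    obtain g where g: "g \<in> Cc_inf \<Omega>" "\<And>x. 0 \<le> g x" "\<And>x. g x \<le> 1" "\<And>x y. \<bar>g x - g y\<bar> \<le> norm (x - y) / \<delta>"
      "\<And>x. infdist x (- \<Omega>) < \<delta> \<Longrightarrow> g x = 0" "\<And>x. 5 * \<delta> \<le> infdist x (- \<Omega>) \<Longrightarrow> g x = 1" "gagliardo (1/2) \<Omega> g \<le> ennreal B"
      using cut[OF \<delta>] by auto
    let ?L = "boundary_layer \<Omega> (5 * \<delta>)"
    have cross1: "(f x - f y) * (g x - g y) * riesz_kernel (1/2) (x, y) \<le> c * indicator ?L y"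
      if y: "y \<in> \<Omega>" and fx: "f x \<noteq> 0" for x y
    proof (cases "g y = 1")
      case True
      have "infdist x (- \<Omega>) \<ge> \<rho>" using \<rho>(2) fx by force
      then have "g x = 1" using \<delta>le \<rho> by (intro g) linarith
      then show ?thesis using True c by simp
    next
      case False
      have x: "infdist x (- \<Omega>) \<ge> \<rho>" using \<rho>(2) fx by force
      have yL: "infdist y (- \<Omega>) < 5 * \<delta>" using g(6) False by force
      have d: "\<rho> / 2 \<le> norm (x - y)" using x yL \<delta>le infdist_triangle_abs[of x "- \<Omega>" y] by (simp add: dist_norm)
      have "riesz_kernel (1/2) (x, y) \<le> c" unfolding riesz_kernel_def c_def
        using d \<rho> by (intro powr_mono2') auto
      moreover have "(f x - f y) * (g x - g y) \<le> 1"
      proof -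
        have "\<bar>f x - f y\<bar> \<le> 1" "\<bar>g x - g y\<bar> \<le> 1" using f(2,3)[of x] f(2,3)[of y] g(2,3)[of x] g(2,3)[of y] by linarith+
        then have "\<bar>f x - f y\<bar> * \<bar>g x - g y\<bar> \<le> 1 * 1" by (intro mult_mono) auto
        then show ?thesis by (metis abs_le_D1 abs_mult mult_1_right)
      qed
      ultimately have "(f x - f y) * (g x - g y) * riesz_kernel (1/2) (x, y) \<le> 1 * c"
        using c riesz_kernel_nonneg[of "1/2" "(x, y)"]
        by (meson mult_left_mono mult_right_mono order_trans zero_le_one)
      then show ?thesis using yL y by (simp add: boundary_layer_def)
    qed
    have cross: "(f x - f y) * (g x - g y) * riesz_kernel (1/2) (x, y) \<le> c * (indicator ?L x + indicator ?L y)"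
      if "x \<in> \<Omega>" "y \<in> \<Omega>" for x y
    proof -
      have nn: "0 \<le> c * indicator ?L z" for z using c by simp
      consider "f x \<noteq> 0" | "f y \<noteq> 0" | "f x = 0" "f y = 0" by blast
      then show ?thesis
      proof cases
        case 1
        then show ?thesis using cross1[OF that(2) 1] nn[of x] by (simp add: distrib_left)
      next
        case 2
        have "(f x - f y) * (g x - g y) * riesz_kernel (1/2) (x, y) = (f y - f x) * (g y - g x) * riesz_kernel (1/2) (y, x)"
          by (simp add: riesz_kernel_def norm_minus_commute algebra_simps)
        then show ?thesis using cross1[OF that(1) 2] nn[of y] by (simp add: distrib_left)
      next
        case 3
        then show ?thesis using nn[of x] nn[of y] by (simp add: distrib_left)
      qed
    qed
    \<comment> \<open>With this weight h is the arithmetic mean of n + 1 cutoffs. The invariant 2 B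
      / n reproduces itself because 2 B n + B + B = 2 B (n + 1), where the second B pays for the
      cross term.\<close>
    define \<theta> where "\<theta> = n / (n + 1)"
    have \<theta>: "0 \<le> \<theta>" "\<theta> \<le> 1" "1 - \<theta> = 1 / (n + 1)" using n by (auto simp: \<theta>_def field_simps)
    define h where "h x = \<theta> * f x + (1 - \<theta>) * g x" for x
    have hC: "h \<in> Cc_inf \<Omega>" unfolding h_def by (rule Cc_inf_lincomb) fact+
    have hE: "gagliardo (1/2) \<Omega> h \<le> ennreal (2 * B / (n + 1))"
    proof -
      have "gagliardo (1/2) \<Omega> h \<le> ennreal (\<theta>\<^sup>2 * (2 * B / n) + (1 - \<theta>)\<^sup>2 * B + 2 * \<theta> * (1 - \<theta>) * (2 * c * measure lebesgue ?L * measure lebesgue \<Omega>))"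
        unfolding h_def using c B n
        by (intro gagliardo_convex_combination \<Omega> Lm \<theta> Cc_inf_measurable[OF f(1)] Cc_inf_measurable[OF g(1)] cross fE g) auto
      also have "\<dots> \<le> ennreal (2 * B / (n + 1))"
      proof (rule ennreal_leI)
        have "4 * n * c * (measure lebesgue ?L * measure lebesgue \<Omega>) \<le> 4 * n * c * ((CL * (5 * \<delta>)) * V)"
          using CL(2)[of "5 * \<delta>"] CL(1) \<delta> n c V by (intro mult_left_mono mult_mono) (auto simp: V_def)
        also have "\<dots> = (20 * n * c * CL * V) * \<delta>" by simp
        also have "\<dots> \<le> B"
          using \<delta>le(3) n c CL V by (simp add: pos_le_divide_eq mult.commute)
        finally have small: "4 * n * c * (measure lebesgue ?L * measure lebesgue \<Omega>) \<le> B" .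
        have "\<theta>\<^sup>2 * (2 * B / n) + (1 - \<theta>)\<^sup>2 * B + 2 * \<theta> * (1 - \<theta>) * (2 * c * measure lebesgue ?L * measure lebesgue \<Omega>)
          = (2 * B * n + B + 4 * n * c * (measure lebesgue ?L * measure lebesgue \<Omega>)) / (n + 1)\<^sup>2"
          unfolding \<theta>(3) unfolding \<theta>_def using n
          by (simp add: power_divide add_divide_distrib power2_eq_square) (simp add: mult_ac)
        also have "\<dots> \<le> (2 * B * n + B + B) / (n + 1)\<^sup>2"
          using small by (intro divide_right_mono) auto
        also have "\<dots> = 2 * B / (n + 1)" using n by (simp add: power2_eq_square divide_simps) (simp add: algebra_simps)
        finally show "\<theta>\<^sup>2 * (2 * B / n) + (1 - \<theta>)\<^sup>2 * B + 2 * \<theta> * (1 - \<theta>) * (2 * c * measure lebesgue ?L * measure lebesgue \<Omega>) \<le> 2 * B / (n + 1)" .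
      qed
      finally show ?thesis .
    qed
    have h01: "0 \<le> h x \<and> h x \<le> 1" for x
      unfolding h_def using \<theta>(1,2) f(2,3)[of x] g(2,3)[of x] by (auto intro!: add_nonneg_nonneg convex_bound_le)
    have hlip: "\<bar>h x - h y\<bar> \<le> norm (x - y) / min \<delta>1 \<delta>" for x y
    proof -
      have 1: "\<bar>f x - f y\<bar> \<le> norm (x - y) / min \<delta>1 \<delta>"
        using \<delta> \<delta>1 by (intro order_trans[OF \<delta>1(2)] divide_left_mono) auto
      have 2: "\<bar>g x - g y\<bar> \<le> norm (x - y) / min \<delta>1 \<delta>"
        using \<delta> \<delta>1 by (intro order_trans[OF g(4)] divide_left_mono) auto
      have "\<bar>h x - h y\<bar> = \<bar>\<theta> * (f x - f y) + (1 - \<theta>) * (g x - g y)\<bar>" by (simp add: h_def algebra_simps)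
      also have "\<dots> \<le> \<theta> * \<bar>f x - f y\<bar> + (1 - \<theta>) * \<bar>g x - g y\<bar>"
        using \<theta>(1,2) abs_triangle_ineq[of "\<theta> * (f x - f y)" "(1 - \<theta>) * (g x - g y)"] by (simp add: abs_mult)
      also have "\<dots> \<le> norm (x - y) / min \<delta>1 \<delta>"
        using \<theta>(1,2) by (intro convex_bound_le 1 2) auto
      finally show ?thesis .
    qed
    have h0: "h x = 0" if "infdist x (- \<Omega>) < min \<rho> \<delta>" for x
      using \<rho>(2)[of x] g(5)[of x] that by (simp add: h_def)
    have h1: "h x = 1" if "r0 \<le> infdist x (- \<Omega>)" for x
    proof -
      have "g x = 1" using that \<delta>le by (intro g) linarith
      then show ?thesis using f1[OF that] by (simp add: h_def)
    qed
    have nn: "n + 1 = real (Suc (Suc m))" by (simp add: n_def)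
    have "min \<delta>1 \<delta> > 0" "min \<rho> \<delta> > 0" using \<delta> \<delta>1 \<rho> by auto
    moreover have "\<exists>d>0. \<forall>x y. \<bar>h x - h y\<bar> \<le> norm (x - y) / d" using hlip calculation by blast
    moreover have "\<exists>d>0. \<forall>x. infdist x (- \<Omega>) < d \<longrightarrow> h x = 0" using h0 calculation by blast
    ultimately show ?case using h01 h1 hE[unfolded nn] by (intro bexI[OF _ hC] conjI) blast+
  qed
  then show ?thesis using B by blast
qed

text \<open>U is chosen before the accuracy, so the L^p norm of the test functions stays bounded
  below while their energy tends to 0. In turn \<open>s0\<close> depends on f through its energy at
  s = 3/4, which may be large.\<close>

lemma small_energy_test_function:
  fixes \<Omega> :: "'a::euclidean_space set"
  assumes C1: "C1_domain \<Omega>" and ne: "\<Omega> \<noteq> {}"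
  shows "\<exists>U \<in> sets lebesgue. U \<subseteq> \<Omega> \<and> 0 < measure lebesgue U \<and> (\<forall>\<epsilon>>0. \<exists>f\<in>Cc_inf \<Omega>. (\<forall>x. 0 \<le> f x \<and> f x \<le> 1) \<and> (\<forall>x\<in>U. f x = 1) \<and>
     (\<forall>s. 0 < s \<and> s < 1 \<longrightarrow> gagliardo s \<Omega> f < \<infinity>) \<and>
     (\<exists>s0 \<in> {1/2<..<3/4}. \<forall>s \<in> {1/2<..<s0}. gagliardo s \<Omega> f \<le> ennreal \<epsilon>))"
proof -
  have op: "open \<Omega>" and bd: "bounded \<Omega>" using C1 by (auto simp: C1_domain_def)
  have \<Omega>: "\<Omega> \<in> lmeasurable" using op bd by (simp add: lmeasurable_open)
  obtain x0 where "x0 \<in> \<Omega>" using ne by blast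
  then obtain r where r: "r > 0" "ball x0 r \<subseteq> \<Omega>" using op open_contains_ball by blast
  define U where "U = ball x0 (r / 2)"
  have neC: "- \<Omega> \<noteq> {}"
  proof
    assume "- \<Omega> = {}"
    then have "\<Omega> = UNIV" by blast
    then show False using bd not_bounded_UNIV by simp
  qed
  have U: "r / 2 \<le> infdist x (- \<Omega>)" if "x \<in> U" for x
  proof -
    have "r / 2 \<le> dist x z" if "z \<in> - \<Omega>" for z
    proof -
      have "r \<le> dist x0 z" using that r by force
      then show ?thesis using dist_triangle[of x0 z x] \<open>x \<in> U\<close> by (simp add: U_def)
    qed
    then show ?thesis unfolding infdist_notempty[OF neC] using neC by (intro cINF_greatest)
  qed
  obtain B where B: "B > 0" and fB: "\<And>m. \<exists>f\<in>Cc_inf \<Omega>. (\<forall>x. 0 \<le> f x \<and> f x \<le> 1) \<and>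
     (\<exists>\<delta>>0. \<forall>x y. \<bar>f x - f y\<bar> \<le> norm (x - y) / \<delta>) \<and> (\<exists>\<rho>>0. \<forall>x. infdist x (- \<Omega>) < \<rho> \<longrightarrow> f x = 0) \<and>
     (\<forall>x. r / 2 \<le> infdist x (- \<Omega>) \<longrightarrow> f x = 1) \<and> gagliardo (1/2) \<Omega> f \<le> ennreal (2 * B / real (Suc m))"
    using half_energy_cutoffs[OF C1, of "r / 2"] r by auto
  have "\<exists>f\<in>Cc_inf \<Omega>. (\<forall>x. 0 \<le> f x \<and> f x \<le> 1) \<and> (\<forall>x\<in>U. f x = 1) \<and>
     (\<forall>s. 0 < s \<and> s < 1 \<longrightarrow> gagliardo s \<Omega> f < \<infinity>) \<and>
     (\<exists>s0 \<in> {1/2<..<3/4}. \<forall>s \<in> {1/2<..<s0}. gagliardo s \<Omega> f \<le> ennreal \<epsilon>)" if \<epsilon>: "\<epsilon> > 0" for \<epsilon>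
  proof -
    obtain m where m: "1 / real (Suc m) < \<epsilon> / (4 * B)" using nat_approx_posE[of "\<epsilon> / (4 * B)"] \<epsilon> B by auto
    have m': "2 * B / real (Suc m) \<le> \<epsilon> / 2"
      using mult_left_mono[OF less_imp_le[OF m], of "2 * B"] B by simp
    obtain f \<delta> where f: "f \<in> Cc_inf \<Omega>" "\<And>x. 0 \<le> f x" "\<And>x. f x \<le> 1" and \<delta>: "\<delta> > 0" "\<And>x y. \<bar>f x - f y\<bar> \<le> norm (x - y) / \<delta>"
      and f1: "\<And>x. r / 2 \<le> infdist x (- \<Omega>) \<Longrightarrow> f x = 1" and fE: "gagliardo (1/2) \<Omega> f \<le> ennreal (2 * B / real (Suc m))"
      using fB[of m] by blast
    have fin: "gagliardo s \<Omega> f < \<infinity>" if s: "0 < s" "s < 1" for s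
    proof -
      obtain C where C: "C > 0" "\<And>\<delta> x. \<delta> > 0 \<Longrightarrow>
        (\<integral>\<^sup>+y. ennreal (min 1 ((norm (x - y) / \<delta>)\<^sup>2) * riesz_kernel s (x, y :: 'a)) \<partial>lebesgue) \<le> ennreal (C * \<delta> powr (- 2 * s))"
        using riesz_truncated_integral[OF s, where 'a = 'a] by auto
      have "gagliardo s \<Omega> f \<le> ennreal (2 * measure lebesgue \<Omega> * (C * \<delta> powr (- 2 * s)))"
        by (rule gagliardo_cutoff_bound[OF \<Omega> _ _ \<delta>(1) _ C(2)[OF \<delta>(1)] f(2,3) \<delta>(2)]) (use C \<Omega> in \<open>auto simp: fmeasurableD\<close>)
      then show ?thesis by (rule le_less_trans) simp
    qed
    define e where "e = enn2real (gagliardo (3/4) \<Omega> f)"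
    have e: "gagliardo (3/4) \<Omega> f = ennreal e" "e \<ge> 0" using fin[of "3/4"] by (auto simp: e_def)
    \<comment> \<open>The energy at s will be at most
      \<open>\<epsilon> / 2 + (4 * s - 2) * e\<close>; the second entry makes the last term at most
      \<open>\<epsilon> / 2\<close>, the first keeps \<open>s0\<close> below 3/4.\<close>
    define s0 where "s0 = min (5/8) (1/2 + \<epsilon> / (8 * (e + 1)))"
    have "0 < \<epsilon> / (8 * (e + 1))" using \<epsilon> e by simp
    moreover have "s0 \<le> 5/8" unfolding s0_def by (rule min.cobounded1)
    ultimately have s0: "s0 \<in> {1/2<..<3/4}" unfolding s0_def by auto
    have "gagliardo s \<Omega> f \<le> ennreal \<epsilon>" if s: "s \<in> {1/2<..<s0}" for s
    proof -
      have s2: "1/2 \<le> s" "s \<le> 3/4" using s s0 by auto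
      have fm [measurable]: "f \<in> borel_measurable (lebesgue_on \<Omega>)" by (rule Cc_inf_measurable) fact
      note riesz_kernel_measurable[of _ \<Omega>, measurable]
      have "gagliardo s \<Omega> f \<le> ennreal (3 - 4 * s) * gagliardo (1/2) \<Omega> f + ennreal (4 * s - 2) * gagliardo (3/4) \<Omega> f"
        unfolding gagliardo_def
      proof (rule nn_integral_real_lincomb_le)
        fix z
        show "(f (fst z) - f (snd z))\<^sup>2 * riesz_kernel s z \<le> (3 - 4 * s) * ((f (fst z) - f (snd z))\<^sup>2 * riesz_kernel (1/2) z)
          + (4 * s - 2) * ((f (fst z) - f (snd z))\<^sup>2 * riesz_kernel (3/4) z)"
          using mult_left_mono[OF riesz_kernel_interpolation[OF s2, of z], of "(f (fst z) - f (snd z))\<^sup>2"]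
          by (simp add: algebra_simps)
      qed (use s2 in \<open>auto simp: riesz_kernel_nonneg\<close>)
      also have "\<dots> \<le> ennreal 1 * ennreal (\<epsilon> / 2) + ennreal (4 * s - 2) * ennreal e"
      proof -
        have "gagliardo (1/2) \<Omega> f \<le> ennreal (\<epsilon> / 2)" using fE ennreal_leI[OF m'] by (rule order_trans)
        moreover have "ennreal (3 - 4 * s) \<le> ennreal 1" using s2 by (intro ennreal_leI) simp
        ultimately show ?thesis unfolding e(1) by (intro add_right_mono mult_mono) auto
      qed
      also have "\<dots> = ennreal (\<epsilon> / 2 + (4 * s - 2) * e)"
        using s2 e \<epsilon> by (simp add: ennreal_mult' [symmetric] ennreal_plus [symmetric] del: ennreal_plus)
      also have "\<dots> \<le> ennreal \<epsilon>"
      proof (rule ennreal_leI)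
        define q where "q = \<epsilon> / (8 * (e + 1))"
        have "s < 1/2 + q" using s unfolding s0_def q_def by simp
        moreover have "\<epsilon> / (2 * (e + 1)) = 4 * q" using e by (simp add: q_def divide_simps)
        ultimately have "4 * s - 2 \<le> \<epsilon> / (2 * (e + 1))" by linarith
        then have "(4 * s - 2) * e \<le> \<epsilon> / (2 * (e + 1)) * e" using e by (intro mult_right_mono)
        also have "\<dots> \<le> \<epsilon> / 2" using e \<epsilon> by (simp add: field_simps)
        finally show "\<epsilon> / 2 + (4 * s - 2) * e \<le> \<epsilon>" by simp
      qed
      finally show ?thesis .
    qed
    then show ?thesis using f f1 U fin s0 by (intro bexI[OF _ f(1)]) blast
  qed
  moreover have "U \<in> sets lebesgue" "U \<subseteq> \<Omega>" "0 < measure lebesgue U"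
    using r by (auto simp: U_def content_ball_gt_0_iff)
  ultimately show ?thesis by blast
qed

section \<open>The regional fractional energy\<close>

lemma sigma_finite_lebesgue: "sigma_finite_measure (lebesgue :: 'a::euclidean_space measure)"
proof
  let ?A = "range (\<lambda>n::nat. ball (0::'a) (real n))"
  have "\<Union> ?A = space lebesgue"
    by (auto intro: reals_Archimedean2)
  moreover have "emeasure lebesgue a \<noteq> \<infinity>" if "a \<in> ?A" for a
    using that fmeasurableD2[OF lmeasurable_ball] by fastforce
  moreover have "?A \<subseteq> sets lebesgue" by auto
  ultimately show "\<exists>A. countable A \<and> A \<subseteq> sets (lebesgue :: 'a measure) \<and> \<Union> A = space lebesgue \<and> (\<forall>a\<in>A. emeasure lebesgue a \<noteq> \<infinity>)"
    by (intro exI[of _ ?A]) auto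
qed

text \<open>Fubini in both directions: the indicator of the product set becomes a restriction in
  each variable separately.\<close>

lemma Q_frac_eq_gagliardo:
  fixes \<Omega> :: "'a::euclidean_space set" and u :: "'a \<Rightarrow> real"
  assumes \<Omega>: "\<Omega> \<in> lmeasurable" and u: "u \<in> borel_measurable (lebesgue_on \<Omega>)"
  shows "Q_frac s \<Omega> u = ennreal (c_frac DIM('a) s / 2) * gagliardo s \<Omega> u"
proof -
  interpret L: sigma_finite_measure "lebesgue :: 'a measure" by (rule sigma_finite_lebesgue)
  interpret M: finite_measure "lebesgue_on \<Omega>" by (rule finite_measure_lebesgue_on) fact
  have \<Omega>s: "\<Omega> \<inter> space lebesgue \<in> sets lebesgue" using \<Omega> by auto
  \<comment> \<open>u is known to be measurable on the domain alone; its extension by zero is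
    measurable everywhere and gives the same integrand on \<Omega> \<times> \<Omega>.\<close>
  define v where "v x = indicator \<Omega> x *\<^sub>R u x" for x
  have vm [measurable]: "v \<in> borel_measurable lebesgue"
    using u unfolding borel_measurable_restrict_space_iff[OF \<Omega>s] v_def[abs_def] .
  define F where "F z = (u (fst z) - u (snd z))\<^sup>2 / norm (fst z - snd z) powr (real DIM('a) + 2 * s)" for z
  have FG: "(u (fst z) - u (snd z))\<^sup>2 * riesz_kernel s z = F z" for z
    by (simp add: F_def riesz_kernel_def powr_minus_divide[of _ "real DIM('a) + 2 * s", simplified])
  let ?P = "lebesgue \<Otimes>\<^sub>M lebesgue :: ('a \<times> 'a) measure"
  have km: "riesz_kernel s \<in> borel_measurable ?P"
    using riesz_kernel_measurable[of s UNIV] by (simp add: lebesgue_on_UNIV_eq)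
  have \<Omega>\<Omega>: "\<Omega> \<times> \<Omega> \<in> sets ?P" using \<Omega> by (intro pair_measureI) auto
  have Fm: "(\<lambda>z. ennreal (F z) * indicator (\<Omega> \<times> \<Omega>) z) \<in> borel_measurable ?P"
  proof -
    have "(\<lambda>z. ennreal ((v (fst z) - v (snd z))\<^sup>2 * riesz_kernel s z) * indicator (\<Omega> \<times> \<Omega>) z) \<in> borel_measurable ?P"
      using km \<Omega>\<Omega> by measurable
    also have "(\<lambda>z. ennreal ((v (fst z) - v (snd z))\<^sup>2 * riesz_kernel s z) * indicator (\<Omega> \<times> \<Omega>) z) = (\<lambda>z. ennreal (F z) * indicator (\<Omega> \<times> \<Omega>) z)"
      by (auto simp: fun_eq_iff FG[symmetric] v_def indicator_def)
    finally show ?thesis .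
  qed
  have Gm: "(\<lambda>z. ennreal (F z)) \<in> borel_measurable (lebesgue_on \<Omega> \<Otimes>\<^sub>M lebesgue_on \<Omega>)"
    unfolding FG [symmetric] using u riesz_kernel_measurable[of s \<Omega>] by measurable
  have "(\<integral>\<^sup>+z. ennreal (F z) * indicator (\<Omega> \<times> \<Omega>) z \<partial>?P) = (\<integral>\<^sup>+x. \<integral>\<^sup>+y. ennreal (F (x, y)) * indicator (\<Omega> \<times> \<Omega>) (x, y) \<partial>lebesgue \<partial>lebesgue)"
    using L.nn_integral_fst[OF Fm] by simp
  also have "\<dots> = (\<integral>\<^sup>+x. (\<integral>\<^sup>+y. ennreal (F (x, y)) \<partial>lebesgue_on \<Omega>) * indicator \<Omega> x \<partial>lebesgue)"
    unfolding nn_integral_restrict_space[OF \<Omega>s]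
    by (intro nn_integral_cong) (auto simp: indicator_def)
  also have "\<dots> = (\<integral>\<^sup>+x. \<integral>\<^sup>+y. ennreal (F (x, y)) \<partial>lebesgue_on \<Omega> \<partial>lebesgue_on \<Omega>)"
    by (rule nn_integral_restrict_space[OF \<Omega>s, symmetric])
  also have "\<dots> = (\<integral>\<^sup>+z. ennreal (F z) \<partial>(lebesgue_on \<Omega> \<Otimes>\<^sub>M lebesgue_on \<Omega>))"
    by (rule M.nn_integral_fst[OF Gm])
  finally show ?thesis unfolding Q_frac_def gagliardo_def FG by (simp add: F_def)
qed

lemma c_frac_pos:
  assumes "0 < s" "s < 1"
  shows "0 < c_frac N s"
  unfolding c_frac_def using assms
  by (intro divide_pos_pos mult_pos_pos Gamma_real_pos) (auto intro: add_nonneg_pos)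

text \<open>The value 8 is approached for N = 2 and s tending to 3/4; a larger dimension lowers the
  exponent.\<close>

lemma crit_exp_bounds:
  assumes "2 \<le> N" "1/2 < s" "s < 3/4"
  shows "2 < crit_exp N s" "crit_exp N s \<le> 8"
proof -
  have "real N \<ge> 2" using assms by simp
  then show "2 < crit_exp N s" "crit_exp N s \<le> 8" using assms by (auto simp: crit_exp_def field_simps)
qed

lemma powr_add_le_two:
  fixes a b r :: real
  assumes "0 \<le> a" "0 \<le> b" "0 \<le> r" "r \<le> 1"
  shows "(a + b) powr r \<le> 2 * (a powr r + b powr r)"
proof -
  have "(a + b) powr r \<le> (2 * max a b) powr r" using assms by (intro powr_mono2) auto
  also have "\<dots> = 2 powr r * max a b powr r" by (simp add: powr_mult)
  also have "\<dots> \<le> 2 powr 1 * (a powr r + b powr r)"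
    using assms by (intro mult_mono powr_mono) (auto simp: max_def)
  finally show ?thesis by simp
qed

locale regional_fractional =
  fixes \<Omega> :: "'a::euclidean_space set" and s p :: real
  assumes p_eq: "p = crit_exp DIM('a) s" and \<Omega>: "\<Omega> \<in> lmeasurable" and N: "2 \<le> DIM('a)" and s: "1/2 < s" "s < 3/4"
begin

abbreviation "M \<equiv> lebesgue_on \<Omega>"
definition "cf = c_frac DIM('a) s / 2"

lemma cf_pos: "cf > 0"
  using c_frac_pos[of s "DIM('a)"] s by (simp add: cf_def)

lemma \<Omega>_space: "\<Omega> \<inter> space lebesgue \<in> sets lebesgue"
  using \<Omega> by auto

text \<open>The normalization constant is put into the kernel, so that \<open>energy\<close>
  coincides with \<open>Q_frac\<close> on measurable functions.\<close>

sublocale nonlocal_energy M "\<lambda>z. cf * riesz_kernel s z" p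
proof -
  interpret finite_measure M by (rule finite_measure_lebesgue_on) (rule \<Omega>)
  note riesz_kernel_measurable[of s \<Omega>, measurable]
  show "nonlocal_energy M (\<lambda>z. cf * riesz_kernel s z) p"
    by unfold_locales (use crit_exp_bounds[OF N s] cf_pos p_eq in \<open>auto simp: riesz_kernel_nonneg\<close>)
qed

lemma energy_eq_gagliardo:
  assumes u [measurable]: "u \<in> borel_measurable M"
  shows "energy u = ennreal cf * gagliardo s \<Omega> u"
proof -
  note riesz_kernel_measurable[of s \<Omega>, measurable]
  show ?thesis
    unfolding energy_def gagliardo_def
    by (subst nn_integral_real_cmult [symmetric]) (use cf_pos in \<open>auto simp: mult_ac\<close>)
qed

lemma energy_eq_Q_frac: "u \<in> borel_measurable M \<Longrightarrow> energy u = Q_frac s \<Omega> u"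
  using energy_eq_gagliardo[of u] Q_frac_eq_gagliardo[OF \<Omega>, of u s] by (simp only: cf_def)

lemma L2sq_eq: "L2sq \<Omega> u = (\<integral>\<^sup>+x. ennreal ((u x)\<^sup>2) \<partial>M)"
  unfolding L2sq_def by (rule nn_integral_restrict_space[OF \<Omega>_space, symmetric])

lemma lp_sq_eq: "lp_sq u = (Lp_norm p \<Omega> u)\<^sup>2"
proof -
  have "(\<integral>\<^sup>+x\<in>\<Omega>. ennreal (\<bar>u x\<bar> powr p) \<partial>lebesgue) = power_int u"
    unfolding power_int_def by (rule nn_integral_restrict_space[OF \<Omega>_space, symmetric])
  then show ?thesis
    by (simp add: Lp_norm_def lp_sq_def power2_eq_square powr_add [symmetric])
qed

lemma ae_zero_on_iff: "ae_zero_on \<Omega> u \<longleftrightarrow> (AE x in M. u x = 0)"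
  unfolding ae_zero_on_def by (rule AE_restrict_space_iff[OF \<Omega>_space, symmetric])

section \<open>Structure of the Sobolev spaces\<close>

lemma Hs_space_iff: "u \<in> Hs_space s \<Omega> \<longleftrightarrow> u \<in> borel_measurable M \<and> Hs_normsq s \<Omega> u < \<infinity>"
  unfolding Hs_space_def Hs_normsq_def set_borel_measurable_def borel_measurable_restrict_space_iff[OF \<Omega>_space]
  by (auto simp: less_top)

lemma Hs_normsq_eq: "u \<in> borel_measurable M \<Longrightarrow> Hs_normsq s \<Omega> u = (\<integral>\<^sup>+x. ennreal ((u x)\<^sup>2) \<partial>M) + energy u"
  by (simp add: Hs_normsq_def L2sq_eq energy_eq_Q_frac)

lemma Hs_normsq_lincomb:
  assumes [measurable]: "u \<in> borel_measurable M" "v \<in> borel_measurable M"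
  shows "Hs_normsq s \<Omega> (\<lambda>x. a * u x + b * v x) \<le> ennreal (2 * a\<^sup>2) * Hs_normsq s \<Omega> u + ennreal (2 * b\<^sup>2) * Hs_normsq s \<Omega> v"
proof -
  have "(\<integral>\<^sup>+x. ennreal ((a * u x + b * v x)\<^sup>2) \<partial>M) \<le> ennreal (2 * a\<^sup>2) * (\<integral>\<^sup>+x. ennreal ((u x)\<^sup>2) \<partial>M) + ennreal (2 * b\<^sup>2) * (\<integral>\<^sup>+x. ennreal ((v x)\<^sup>2) \<partial>M)"
  proof (rule nn_integral_real_lincomb_le)
    fix x
    show "(a * u x + b * v x)\<^sup>2 \<le> 2 * a\<^sup>2 * (u x)\<^sup>2 + 2 * b\<^sup>2 * (v x)\<^sup>2"
      using zero_le_power2[of "a * u x - b * v x"] by (simp add: power2_eq_square algebra_simps)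
  qed auto
  moreover have "energy (\<lambda>x. a * u x + b * v x) \<le> ennreal (2 * a\<^sup>2) * energy u + ennreal (2 * b\<^sup>2) * energy v"
    using energy_add_le[of "\<lambda>x. a * u x" "\<lambda>x. b * v x"]
    by (simp add: energy_cmult ennreal_mult mult.assoc)
  ultimately have "(\<integral>\<^sup>+x. ennreal ((a * u x + b * v x)\<^sup>2) \<partial>M) + energy (\<lambda>x. a * u x + b * v x)
    \<le> (ennreal (2 * a\<^sup>2) * (\<integral>\<^sup>+x. ennreal ((u x)\<^sup>2) \<partial>M) + ennreal (2 * b\<^sup>2) * (\<integral>\<^sup>+x. ennreal ((v x)\<^sup>2) \<partial>M))
      + (ennreal (2 * a\<^sup>2) * energy u + ennreal (2 * b\<^sup>2) * energy v)"
    by (rule add_mono)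
  also have "\<dots> = ennreal (2 * a\<^sup>2) * Hs_normsq s \<Omega> u + ennreal (2 * b\<^sup>2) * Hs_normsq s \<Omega> v"
    by (simp add: Hs_normsq_eq distrib_left add_ac)
  finally show ?thesis by (simp add: Hs_normsq_eq)
qed

lemma Hs0_measurable: "u \<in> Hs0_space s \<Omega> \<Longrightarrow> u \<in> borel_measurable M"
  by (simp add: Hs0_space_def Hs_space_iff)

lemma Hs0_lincomb:
  assumes u: "u \<in> Hs0_space s \<Omega>" and v: "v \<in> Hs0_space s \<Omega>"
  shows "(\<lambda>x. a * u x + b * v x) \<in> Hs0_space s \<Omega>"
proof -
  have m [measurable]: "u \<in> borel_measurable M" "v \<in> borel_measurable M" using u v by (auto intro: Hs0_measurable)
  obtain \<phi> where \<phi>: "\<And>k. \<phi> k \<in> Cc_inf \<Omega>" "(\<lambda>k. Hs_normsq s \<Omega> (\<lambda>x. \<phi> k x - u x)) \<longlonglongrightarrow> 0"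
    using u by (auto simp: Hs0_space_def)
  obtain \<psi> where \<psi>: "\<And>k. \<psi> k \<in> Cc_inf \<Omega>" "(\<lambda>k. Hs_normsq s \<Omega> (\<lambda>x. \<psi> k x - v x)) \<longlonglongrightarrow> 0"
    using v by (auto simp: Hs0_space_def)
  have [measurable]: "\<phi> k \<in> borel_measurable M" "\<psi> k \<in> borel_measurable M" for k
    using \<phi>(1) \<psi>(1) by (auto intro: Cc_inf_measurable)
  have "Hs_normsq s \<Omega> (\<lambda>x. a * u x + b * v x) \<le> ennreal (2 * a\<^sup>2) * Hs_normsq s \<Omega> u + ennreal (2 * b\<^sup>2) * Hs_normsq s \<Omega> v"
    by (rule Hs_normsq_lincomb) fact+
  also have "\<dots> < \<infinity>" using u v by (auto simp: Hs0_space_def Hs_space_iff ennreal_mult_less_top less_top)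
  finally have "(\<lambda>x. a * u x + b * v x) \<in> Hs_space s \<Omega>" by (simp add: Hs_space_iff)
  moreover have "(\<lambda>k. Hs_normsq s \<Omega> (\<lambda>x. (a * \<phi> k x + b * \<psi> k x) - (a * u x + b * v x))) \<longlonglongrightarrow> 0"
  proof (rule tendsto_sandwich[OF _ _ tendsto_const])
    show "\<forall>\<^sub>F k in sequentially. Hs_normsq s \<Omega> (\<lambda>x. (a * \<phi> k x + b * \<psi> k x) - (a * u x + b * v x))
      \<le> ennreal (2 * a\<^sup>2) * Hs_normsq s \<Omega> (\<lambda>x. \<phi> k x - u x) + ennreal (2 * b\<^sup>2) * Hs_normsq s \<Omega> (\<lambda>x. \<psi> k x - v x)"
    proof (rule always_eventually, rule allI)
      fix k
      have "(\<lambda>x. (a * \<phi> k x + b * \<psi> k x) - (a * u x + b * v x)) = (\<lambda>x. a * (\<phi> k x - u x) + b * (\<psi> k x - v x))"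
        by (simp add: algebra_simps)
      then show "Hs_normsq s \<Omega> (\<lambda>x. (a * \<phi> k x + b * \<psi> k x) - (a * u x + b * v x))
        \<le> ennreal (2 * a\<^sup>2) * Hs_normsq s \<Omega> (\<lambda>x. \<phi> k x - u x) + ennreal (2 * b\<^sup>2) * Hs_normsq s \<Omega> (\<lambda>x. \<psi> k x - v x)"
        using Hs_normsq_lincomb[of "\<lambda>x. \<phi> k x - u x" "\<lambda>x. \<psi> k x - v x" a b] by simp
    qed
    have "(\<lambda>k. ennreal (2 * a\<^sup>2) * Hs_normsq s \<Omega> (\<lambda>x. \<phi> k x - u x) + ennreal (2 * b\<^sup>2) * Hs_normsq s \<Omega> (\<lambda>x. \<psi> k x - v x))
      \<longlonglongrightarrow> ennreal (2 * a\<^sup>2) * 0 + ennreal (2 * b\<^sup>2) * 0"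
      by (intro tendsto_add ennreal_tendsto_cmult \<phi> \<psi>) auto
    then show "(\<lambda>k. ennreal (2 * a\<^sup>2) * Hs_normsq s \<Omega> (\<lambda>x. \<phi> k x - u x) + ennreal (2 * b\<^sup>2) * Hs_normsq s \<Omega> (\<lambda>x. \<psi> k x - v x)) \<longlonglongrightarrow> 0"
      by simp
  qed simp
  ultimately show ?thesis
    unfolding Hs0_space_def using Cc_inf_lincomb[OF \<phi>(1) \<psi>(1)] by (auto intro!: exI[of _ "\<lambda>k x. a * \<phi> k x + b * \<psi> k x"])
qed

text \<open>A diagonal choice of test functions. Finiteness of the norm of u follows by comparison
  with a single v whose squared distance is at most 1.\<close>

lemma Hs0_closed:
  assumes u [measurable]: "u \<in> borel_measurable M"
    and app: "\<And>e. e > 0 \<Longrightarrow> \<exists>v\<in>Hs0_space s \<Omega>. Hs_normsq s \<Omega> (\<lambda>x. v x - u x) \<le> ennreal e"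
  shows "u \<in> Hs0_space s \<Omega>"
proof -
  have ex: "\<exists>\<phi>\<in>Cc_inf \<Omega>. Hs_normsq s \<Omega> (\<lambda>x. \<phi> x - u x) \<le> ennreal e" if e: "e > 0" for e
  proof -
    obtain v where v: "v \<in> Hs0_space s \<Omega>" "Hs_normsq s \<Omega> (\<lambda>x. v x - u x) \<le> ennreal (e / 4)"
      using app[of "e / 4"] e by auto
    obtain \<phi> where \<phi>: "\<And>k. \<phi> k \<in> Cc_inf \<Omega>" "(\<lambda>k. Hs_normsq s \<Omega> (\<lambda>x. \<phi> k x - v x)) \<longlonglongrightarrow> 0"
      using v by (auto simp: Hs0_space_def)
    have "\<forall>\<^sub>F k in sequentially. Hs_normsq s \<Omega> (\<lambda>x. \<phi> k x - v x) < ennreal (e / 4)"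
      using \<phi>(2) e by (intro order_tendstoD) auto
    then obtain k where k: "Hs_normsq s \<Omega> (\<lambda>x. \<phi> k x - v x) < ennreal (e / 4)"
      using eventually_happens by force
    have [measurable]: "v \<in> borel_measurable M" "\<phi> k \<in> borel_measurable M"
      using v \<phi> by (auto intro: Hs0_measurable Cc_inf_measurable)
    have "Hs_normsq s \<Omega> (\<lambda>x. \<phi> k x - u x) \<le> ennreal 2 * Hs_normsq s \<Omega> (\<lambda>x. \<phi> k x - v x) + ennreal 2 * Hs_normsq s \<Omega> (\<lambda>x. v x - u x)"
      using Hs_normsq_lincomb[of "\<lambda>x. \<phi> k x - v x" "\<lambda>x. v x - u x" 1 1] by simp
    also have "\<dots> \<le> ennreal 2 * ennreal (e / 4) + ennreal 2 * ennreal (e / 4)"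
      using k v by (intro add_mono mult_left_mono) auto
    also have "ennreal 2 * ennreal (e / 4) = ennreal (e / 2)"
      using e by (subst ennreal_mult [symmetric]) auto
    also have "ennreal (e / 2) + ennreal (e / 2) = ennreal e"
      using e by (subst ennreal_plus [symmetric]) auto
    finally show ?thesis using \<phi>(1)[of k] by auto
  qed
  have "\<forall>k. \<exists>\<phi>\<in>Cc_inf \<Omega>. Hs_normsq s \<Omega> (\<lambda>x. \<phi> x - u x) \<le> ennreal (1 / real (Suc k))"
    using ex by auto
  then obtain \<phi> where \<phi>: "\<And>k. \<phi> k \<in> Cc_inf \<Omega>" "\<And>k. Hs_normsq s \<Omega> (\<lambda>x. \<phi> k x - u x) \<le> ennreal (1 / real (Suc k))"
    by metis
  have lim: "(\<lambda>k. Hs_normsq s \<Omega> (\<lambda>x. \<phi> k x - u x)) \<longlonglongrightarrow> 0"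
  proof (rule tendsto_sandwich[OF _ _ tendsto_const])
    show "\<forall>\<^sub>F k in sequentially. Hs_normsq s \<Omega> (\<lambda>x. \<phi> k x - u x) \<le> ennreal (1 / real (Suc k))"
      using \<phi>(2) by (intro always_eventually allI)
    have "(\<lambda>k. ennreal (1 / real (Suc k))) \<longlonglongrightarrow> ennreal 0"
      by (intro tendsto_ennrealI LIMSEQ_Suc lim_1_over_n)
    then show "(\<lambda>k. ennreal (1 / real (Suc k))) \<longlonglongrightarrow> 0" by simp
  qed simp
  obtain v where v: "v \<in> Hs0_space s \<Omega>" "Hs_normsq s \<Omega> (\<lambda>x. v x - u x) \<le> ennreal 1"
    using app[of 1] by auto
  have [measurable]: "v \<in> borel_measurable M" using v by (auto intro: Hs0_measurable)
  have "Hs_normsq s \<Omega> u \<le> ennreal 2 * Hs_normsq s \<Omega> v + ennreal 2 * Hs_normsq s \<Omega> (\<lambda>x. v x - u x)"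
    using Hs_normsq_lincomb[of v "\<lambda>x. v x - u x" 1 "-1"] by simp
  also have "\<dots> < \<infinity>"
    using v by (auto simp: Hs0_space_def Hs_space_iff ennreal_mult_less_top less_top le_less_trans[OF v(2)])
  finally show ?thesis unfolding Hs0_space_def using \<phi>(1) lim by (auto simp: Hs_space_iff)
qed

lemma Cc_inf_in_Hs0:
  assumes f: "f \<in> Cc_inf \<Omega>" "\<And>x. \<bar>f x\<bar> \<le> 1" "gagliardo s \<Omega> f < \<infinity>"
  shows "f \<in> Hs0_space s \<Omega>"
proof -
  have [measurable]: "f \<in> borel_measurable M" using f by (auto intro: Cc_inf_measurable)
  have "(\<integral>\<^sup>+x. ennreal ((f x)\<^sup>2) \<partial>M) \<le> (\<integral>\<^sup>+x. 1 \<partial>M)"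
    using f(2) by (intro nn_integral_mono) (simp add: abs_square_le_1)
  also have "\<dots> = ennreal (measure M (space M))" by (simp add: emeasure_eq_measure)
  also have "\<dots> < \<infinity>" by simp
  finally have "Hs_normsq s \<Omega> f < \<infinity>"
    using f(3) by (simp add: Hs_normsq_eq energy_eq_gagliardo ennreal_mult_less_top)
  moreover have "Hs_normsq s \<Omega> (\<lambda>x. f x - f x) = 0"
    by (simp add: Hs_normsq_eq energy_def)
  ultimately show ?thesis unfolding Hs0_space_def using f(1) by (auto simp: Hs_space_iff intro!: exI[of _ "\<lambda>_. f"])
qed

text \<open>Supplies the closedness hypothesis of \<open>minimizer_exists\<close>. On a finite
  measure space L^p smallness also controls the L^2 part of the norm, by
  \<open>young_integral_bound\<close> with exponent 2.\<close>

lemma Hs0_complete: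
  assumes f: "\<And>n::nat. f n \<in> Hs0_space s \<Omega>" and u [measurable]: "u \<in> borel_measurable M"
    and lim: "\<And>e. e > 0 \<Longrightarrow> \<exists>N. \<forall>m\<ge>N. power_int (\<lambda>x. f m x - u x) \<le> ennreal (e powr p) \<and> energy (\<lambda>x. f m x - u x) \<le> ennreal e"
  shows "u \<in> Hs0_space s \<Omega>"
proof (rule Hs0_closed[OF u])
  fix e :: real assume e: "e > 0"
  define V where "V = measure M (space M) + 1"
  have V: "V > 0" by (simp add: V_def add_nonneg_pos)
  \<comment> \<open>t bounds the energy directly, whereas the L^2 part is at most t^2 V; each entry
    keeps one of the two below e / 2.\<close>
  define t where "t = min (e / 2) (sqrt (e / (2 * V)))"
  have t: "t > 0" "t \<le> e / 2" using e V by (auto simp: t_def)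
  have "t\<^sup>2 \<le> (sqrt (e / (2 * V)))\<^sup>2" using t by (intro power_mono) (auto simp: t_def)
  then have t2: "t\<^sup>2 * V \<le> e / 2" using e V by (simp add: field_simps)
  obtain m where m: "power_int (\<lambda>x. f m x - u x) \<le> ennreal (t powr p)" "energy (\<lambda>x. f m x - u x) \<le> ennreal t"
    using lim[OF t(1)] by blast
  have [measurable]: "f m \<in> borel_measurable M" using f by (rule Hs0_measurable)
  have "(\<integral>\<^sup>+x. ennreal (\<bar>f m x - u x\<bar> powr 2) \<partial>M) \<le> ennreal (t powr 2 * V)"
    unfolding V_def using p t m by (intro young_integral_bound) auto
  then have "(\<integral>\<^sup>+x. ennreal ((f m x - u x)\<^sup>2) \<partial>M) \<le> ennreal (t\<^sup>2 * V)"
    using t by (simp add: powr_numeral)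
  also have "\<dots> \<le> ennreal (e / 2)" by (rule ennreal_leI) (rule t2)
  finally have "Hs_normsq s \<Omega> (\<lambda>x. f m x - u x) \<le> ennreal (e / 2) + ennreal (e / 2)"
    using order_trans[OF m(2) ennreal_leI[OF t(2)]] by (simp add: Hs_normsq_eq add_mono)
  also have "\<dots> = ennreal e" using e by (subst ennreal_plus [symmetric]) auto
  finally show "\<exists>v\<in>Hs0_space s \<Omega>. Hs_normsq s \<Omega> (\<lambda>x. v x - u x) \<le> ennreal e" using f by blast
qed

text \<open>Puts the mean back. The factor 8 is (2^p)^(2/p) = 4 from separating the mean, times 2
  from \<open>powr_add_le_two\<close>. The energy term carries the constant that must beat the
  infimum; the mean term is controlled by convergence of means instead.\<close>

lemma sobolev_of_poincare:
  assumes u [measurable]: "u \<in> borel_measurable M" and G: "gagliardo s \<Omega> u < \<infinity>" and C: "0 \<le> C"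
    and poin: "(\<integral>\<^sup>+x. ennreal (\<bar>u x - average M \<Omega> u\<bar> powr p) \<partial>M) \<le> ennreal ((C * enn2real (gagliardo s \<Omega> u)) powr (p / 2))"
  shows "power_int u < \<infinity>"
    and "lp_sq u \<le> (8 * C / cf) * enn2real (energy u) + (8 * measure M \<Omega> powr (2 / p) / (measure M \<Omega>)\<^sup>2) * (\<integral>x. u x \<partial>M)\<^sup>2"
proof -
  define a where "a = average M \<Omega> u"
  define g where "g = enn2real (gagliardo s \<Omega> u)"
  define \<mu> where "\<mu> = measure M \<Omega>"
  have p0: "p > 0" using p by simp
  have "power_int u \<le> ennreal (2 powr p) * (\<integral>\<^sup>+x. ennreal (\<bar>u x - a\<bar> powr p) \<partial>M) + ennreal (2 powr p * \<bar>a\<bar> powr p) * (\<integral>\<^sup>+x. ennreal 1 \<partial>M)"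
    unfolding power_int_def
  proof (rule nn_integral_real_lincomb_le)
    fix x
    show "\<bar>u x\<bar> powr p \<le> 2 powr p * \<bar>u x - a\<bar> powr p + 2 powr p * \<bar>a\<bar> powr p * 1"
      using abs_add_powr_le[OF p0, of "u x - a" a] by (simp add: distrib_left)
  qed auto
  also have "(\<integral>\<^sup>+x. ennreal 1 \<partial>M) = ennreal \<mu>" by (simp add: emeasure_eq_measure \<mu>_def)
  also have "ennreal (2 powr p) * (\<integral>\<^sup>+x. ennreal (\<bar>u x - a\<bar> powr p) \<partial>M) + ennreal (2 powr p * \<bar>a\<bar> powr p) * ennreal \<mu>
    \<le> ennreal (2 powr p) * ennreal ((C * g) powr (p / 2)) + ennreal (2 powr p * \<bar>a\<bar> powr p) * ennreal \<mu>"
    using poin unfolding a_def g_def by (intro add_mono mult_left_mono) auto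
  also have "\<dots> = ennreal (2 powr p * ((C * g) powr (p / 2) + \<bar>a\<bar> powr p * \<mu>))"
    by (simp add: ennreal_mult' [symmetric] ennreal_plus [symmetric] distrib_left mult.assoc \<mu>_def del: ennreal_plus)
  finally have le: "power_int u \<le> ennreal (2 powr p * ((C * g) powr (p / 2) + \<bar>a\<bar> powr p * \<mu>))" .
  then show "power_int u < \<infinity>" by (rule le_less_trans) simp
  have "enn2real (power_int u) \<le> 2 powr p * ((C * g) powr (p / 2) + \<bar>a\<bar> powr p * \<mu>)"
    using le by (rule enn2real_leI[rotated]) (simp add: \<mu>_def)
  then have "lp_sq u \<le> (2 powr p * ((C * g) powr (p / 2) + \<bar>a\<bar> powr p * \<mu>)) powr (2 / p)"
    unfolding lp_sq_def using p0 by (intro powr_mono2) auto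
  also have "\<dots> = (2 powr p) powr (2 / p) * ((C * g) powr (p / 2) + \<bar>a\<bar> powr p * \<mu>) powr (2 / p)"
    by (rule powr_mult)
  also have "(2 powr p) powr (2 / p) = (4 :: real)" using p0 by (simp add: powr_powr powr_numeral)
  also have "4 * ((C * g) powr (p / 2) + \<bar>a\<bar> powr p * \<mu>) powr (2 / p) \<le> 4 * (2 * (((C * g) powr (p / 2)) powr (2 / p) + (\<bar>a\<bar> powr p * \<mu>) powr (2 / p)))"
    using p by (intro mult_left_mono powr_add_le_two) (auto simp: \<mu>_def)
  also have "((C * g) powr (p / 2)) powr (2 / p) = C * g"
    using p0 C by (simp add: powr_powr g_def)
  also have "(\<bar>a\<bar> powr p * \<mu>) powr (2 / p) = a\<^sup>2 * \<mu> powr (2 / p)"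
    using p0 by (cases "a = 0") (auto simp: powr_mult powr_powr powr_numeral)
  finally have 1: "lp_sq u \<le> 8 * C * g + 8 * a\<^sup>2 * \<mu> powr (2 / p)" by (simp add: distrib_left)
  have "a = (\<integral>x. u x \<partial>M) / \<mu>"
  proof -
    have "(\<integral>x\<in>\<Omega>. u x \<partial>M) = (\<integral>x. u x \<partial>M)" unfolding set_lebesgue_integral_def
      by (rule Bochner_Integration.integral_cong) auto
    then show ?thesis by (simp add: a_def average_def \<mu>_def)
  qed
  then have 2: "8 * a\<^sup>2 * \<mu> powr (2 / p) = (8 * \<mu> powr (2 / p) / \<mu>\<^sup>2) * (\<integral>x. u x \<partial>M)\<^sup>2"
    by (simp add: power_divide)
  have 3: "enn2real (energy u) = cf * g"
    using cf_pos by (simp add: energy_eq_gagliardo enn2real_mult g_def)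
  then have "8 * C * g = (8 * C / cf) * enn2real (energy u)" using cf_pos by simp
  then show "lp_sq u \<le> (8 * C / cf) * enn2real (energy u) + (8 * measure M \<Omega> powr (2 / p) / (measure M \<Omega>)\<^sup>2) * (\<integral>x. u x \<partial>M)\<^sup>2"
    using 1 2 by (simp add: \<mu>_def)
qed

text \<open>1536 = 192 * 8, where 8 is the factor from \<open>sobolev_of_poincare\<close>. The
  constant \<open>cf\<close> divides the Sobolev constant and multiplies the energy, so it drops out
  of the smallness condition, which therefore sees s only through the energy of f.\<close>

lemma S_frac_achieved:
  assumes C: "C > 0"
    and poin: "\<And>u. u \<in> borel_measurable M \<Longrightarrow> (\<integral>\<^sup>+x. ennreal ((u x)\<^sup>2) \<partial>M) < \<infinity> \<Longrightarrow> gagliardo s \<Omega> u < \<infinity> \<Longrightarrow>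
      (\<integral>\<^sup>+x. ennreal (\<bar>u x - average M \<Omega> u\<bar> powr p) \<partial>M) \<le> ennreal ((C * enn2real (gagliardo s \<Omega> u)) powr (p / 2))"
    and f: "f \<in> Cc_inf \<Omega>" "\<And>x. 0 \<le> f x \<and> f x \<le> 1" "gagliardo s \<Omega> f \<le> ennreal \<epsilon>" "0 \<le> \<epsilon>"
    and U: "U \<in> sets lebesgue" "U \<subseteq> \<Omega>" "0 < \<beta>" "\<beta> \<le> 1" "\<beta> \<le> measure lebesgue U" "\<And>x. x \<in> U \<Longrightarrow> f x = 1"
    and small: "1536 * C * \<epsilon> \<le> \<beta>"
  shows "\<exists>u \<in> Hs0_space s \<Omega>. \<not> ae_zero_on \<Omega> u \<and>
             enn2real (Q_frac s \<Omega> u) / (Lp_norm p \<Omega> u)\<^sup>2 = S_frac s \<Omega>"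
proof -
  have H0: "u \<in> borel_measurable M \<and> (\<integral>\<^sup>+x. ennreal ((u x)\<^sup>2) \<partial>M) < \<infinity> \<and> energy u < \<infinity> \<and> gagliardo s \<Omega> u < \<infinity>"
    if "u \<in> Hs0_space s \<Omega>" for u
  proof -
    have m: "u \<in> borel_measurable M" and "Hs_normsq s \<Omega> u < \<infinity>" using that by (auto simp: Hs0_space_def Hs_space_iff)
    then have "(\<integral>\<^sup>+x. ennreal ((u x)\<^sup>2) \<partial>M) < \<infinity>" "energy u < \<infinity>" by (auto simp: Hs_normsq_eq less_top)
    moreover have "gagliardo s \<Omega> u < \<infinity>"
      using \<open>energy u < \<infinity>\<close> cf_pos unfolding energy_eq_gagliardo[OF m] by (auto simp: ennreal_mult_less_top)
    ultimately show ?thesis using m by blast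
  qed
  have gf: "gagliardo s \<Omega> f < \<infinity>" using f(3) by (rule le_less_trans) simp
  have fm [measurable]: "f \<in> borel_measurable M" using f(1) by (rule Cc_inf_measurable)
  have f0: "f \<in> Hs0_space s \<Omega>" using f gf by (intro Cc_inf_in_Hs0) (auto simp: abs_le_iff intro: order_trans)
  have Um: "U \<in> sets M" using U \<Omega> by (auto simp: sets_restrict_space_iff)
  have fP: "ennreal \<beta> \<le> power_int f"
  proof -
    have "ennreal \<beta> \<le> emeasure M U" using U by (subst emeasure_lebesgue_on[OF \<Omega> U(1,2)]) (auto intro: ennreal_leI)
    also have "\<dots> = (\<integral>\<^sup>+x. indicator U x \<partial>M)" using Um by simp
    also have "\<dots> \<le> power_int f" unfolding power_int_def
      by (intro nn_integral_mono) (auto simp: indicator_def U(6))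
    finally show ?thesis .
  qed
  note sp = sobolev_of_poincare[OF _ _ less_imp_le[OF C] poin]
  have flp: "\<beta> \<le> lp_sq f"
  proof -
    have "power_int f < \<infinity>" using sp(1)[of f] H0[OF f0] by blast
    then have "\<beta> \<le> enn2real (power_int f)" using fP U by (metis enn2real_ennreal enn2real_mono less_imp_le infinity_ennreal_def)
    then have "\<beta> powr (2 / p) \<le> lp_sq f" unfolding lp_sq_def using U p by (intro powr_mono2) auto
    \<comment> \<open>As \<open>\<beta>\<close> is at most 1 and 2/p < 1, the bound by
      \<open>\<beta>\<close> itself is free of p and hence uniform in s.\<close>
    moreover have "\<beta> powr 1 \<le> \<beta> powr (2 / p)" using U p by (intro powr_mono') auto
    ultimately show ?thesis using U by simp
  qed
  have fnz: "\<not> (AE x in M. f x = 0)"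
    using power_int_eq_0_iff[OF fm] fP U by auto
  have fr: "192 * (8 * C / cf) * (enn2real (energy f) / lp_sq f) \<le> 1"
  proof -
    have "enn2real (gagliardo s \<Omega> f) \<le> \<epsilon>" using f by (intro enn2real_leI) auto
    then have "1536 * C * enn2real (gagliardo s \<Omega> f) \<le> 1536 * C * \<epsilon>" using C by (intro mult_left_mono) auto
    then have "1536 * C * enn2real (gagliardo s \<Omega> f) \<le> lp_sq f" using small flp by linarith
    then have "1536 * C * enn2real (gagliardo s \<Omega> f) / lp_sq f \<le> 1" using flp U by (simp add: divide_le_eq_1)
    moreover have "enn2real (energy f) = cf * enn2real (gagliardo s \<Omega> f)"
      using cf_pos by (simp add: energy_eq_gagliardo enn2real_mult)
    ultimately show ?thesis using cf_pos by simp
  qed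
  have "\<exists>u\<in>Hs0_space s \<Omega>. \<not> (AE x in M. u x = 0) \<and>
     enn2real (energy u) / lp_sq u = Inf {enn2real (energy u) / lp_sq u | u. u \<in> Hs0_space s \<Omega> \<and> \<not> (AE x in M. u x = 0)}"
  proof (rule minimizer_exists[of _ "8 * C / cf" "8 * measure M \<Omega> powr (2 / p) / (measure M \<Omega>)\<^sup>2" f])
    show "Hs0_space s \<Omega> \<subseteq> borel_measurable M" using H0 by blast
    show "power_int u < \<infinity>" if "u \<in> Hs0_space s \<Omega>" for u using sp(1)[of u] H0[OF that] by blast
    show "lp_sq u \<le> (8 * C / cf) * enn2real (energy u) + (8 * measure M \<Omega> powr (2 / p) / (measure M \<Omega>)\<^sup>2) * (\<integral>x. u x \<partial>M)\<^sup>2"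
      if "u \<in> Hs0_space s \<Omega>" for u using sp(2)[of u] H0[OF that] by blast
    show "u \<in> Hs0_space s \<Omega>" if "\<And>n::nat. g n \<in> Hs0_space s \<Omega>" "u \<in> borel_measurable M"
      "\<And>e. e > 0 \<Longrightarrow> \<exists>N. \<forall>m\<ge>N. power_int (\<lambda>x. g m x - u x) \<le> ennreal (e powr p) \<and> energy (\<lambda>x. g m x - u x) \<le> ennreal e" for g u
      using that by (rule Hs0_complete)
  qed (use H0 Hs0_lincomb f0 fnz fr C cf_pos in auto)
  then obtain u where u: "u \<in> Hs0_space s \<Omega>" "\<not> (AE x in M. u x = 0)"
    "enn2real (energy u) / lp_sq u = Inf {enn2real (energy u) / lp_sq u | u. u \<in> Hs0_space s \<Omega> \<and> \<not> (AE x in M. u x = 0)}"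
    by blast
  have eq: "enn2real (energy u) / lp_sq u = enn2real (Q_frac s \<Omega> u) / (Lp_norm p \<Omega> u)\<^sup>2" if "u \<in> Hs0_space s \<Omega>" for u
    using energy_eq_Q_frac[of u] H0[OF that] by (simp add: lp_sq_eq)
  have "{enn2real (energy u) / lp_sq u | u. u \<in> Hs0_space s \<Omega> \<and> \<not> (AE x in M. u x = 0)}
    = {enn2real (Q_frac s \<Omega> u) / (Lp_norm p \<Omega> u)\<^sup>2 | u. u \<in> Hs0_space s \<Omega> \<and> \<not> ae_zero_on \<Omega> u}"
    unfolding ae_zero_on_iff
  proof (intro Collect_cong ex_cong1)
    fix y u
    show "(y = enn2real (energy u) / lp_sq u \<and> u \<in> Hs0_space s \<Omega> \<and> \<not> (AE x in M. u x = 0)) =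
      (y = enn2real (Q_frac s \<Omega> u) / (Lp_norm p \<Omega> u)\<^sup>2 \<and> u \<in> Hs0_space s \<Omega> \<and> \<not> (AE x in M. u x = 0))"
      by (cases "u \<in> Hs0_space s \<Omega>") (simp_all only: eq simp_thms)
  qed
  then show ?thesis using u eq[OF u(1)] unfolding S_frac_def ae_zero_on_iff p_eq [symmetric] by auto
qed

end

theorem theorem1p1:
  fixes \<Omega> :: "'a::euclidean_space set"
  assumes "DIM('a) \<ge> 2"
    and "C1_domain \<Omega>"
    and "\<Omega> \<noteq> {}"
  shows "\<exists>s0 \<in> {1/2<..<1}. \<forall>s \<in> {1/2<..<s0}.
           \<exists>u \<in> Hs0_space s \<Omega>. \<not> ae_zero_on \<Omega> u \<and>
             enn2real (Q_frac s \<Omega> u) / (Lp_norm (crit_exp DIM('a) s) \<Omega> u)\<^sup>2 = S_frac s \<Omega>"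
proof -
  have op: "open \<Omega>" and bd: "bounded \<Omega>" using assms(2) by (auto simp: C1_domain_def)
  have \<Omega>: "\<Omega> \<in> lmeasurable" using op bd by (simp add: lmeasurable_open)
  have \<Omega>s: "\<Omega> \<inter> space lebesgue \<in> sets lebesgue" using \<Omega> by auto
  \<comment> \<open>The added 1 places the domain in the open ball of radius R around each of its
    points.\<close>
  define R where "R = diameter \<Omega> + 1"
  have R: "R > 0" using diameter_ge_0[OF bd] by (simp add: R_def)
  have \<Omega>R: "\<Omega> \<subseteq> ball x R" if "x \<in> \<Omega>" for x
    using diameter_bounded_bound[OF bd that] by (force simp: R_def)
  obtain c where c: "0 < c" "c \<le> 1" and dens: "\<And>x t. x \<in> \<Omega> \<Longrightarrow> 0 < t \<Longrightarrow> t \<le> R \<Longrightarrow> c * t ^ DIM('a) \<le> measure lebesgue (\<Omega> \<inter> ball x t)"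
    using C1_domain_measure_density[OF assms(2) R] by blast
  have dens': "c * t powr real DIM('a) \<le> measure (lebesgue_on \<Omega>) (\<Omega> \<inter> ball x t)" if "x \<in> \<Omega>" "0 < t" "t \<le> R" for x t
    using dens[OF that] that \<Omega>s by (simp add: powr_realpow measure_restrict_space)
  define C where "C = (24 * 8 powr real DIM('a) / c)\<^sup>2"
  have C: "C > 0" using c by (simp add: C_def)
  obtain U where U: "U \<in> sets lebesgue" "U \<subseteq> \<Omega>" "0 < measure lebesgue U"
    and fU: "\<And>\<epsilon>. \<epsilon> > 0 \<Longrightarrow> \<exists>f\<in>Cc_inf \<Omega>. (\<forall>x. 0 \<le> f x \<and> f x \<le> 1) \<and> (\<forall>x\<in>U. f x = 1) \<and>
     (\<forall>s. 0 < s \<and> s < 1 \<longrightarrow> gagliardo s \<Omega> f < \<infinity>) \<and>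
     (\<exists>s0 \<in> {1/2<..<3/4}. \<forall>s \<in> {1/2<..<s0}. gagliardo s \<Omega> f \<le> ennreal \<epsilon>)"
    using small_energy_test_function[OF assms(2,3)] by blast
  define \<beta> where "\<beta> = min 1 (measure lebesgue U)"
  have \<beta>: "0 < \<beta>" "\<beta> \<le> 1" "\<beta> \<le> measure lebesgue U" using U by (auto simp: \<beta>_def)
  \<comment> \<open>Fixed before s: neither C nor U depends on s, so one test function serves all s
    in (1/2, s0).\<close>
  define \<epsilon> where "\<epsilon> = \<beta> / (1536 * C)"
  have \<epsilon>: "\<epsilon> > 0" "1536 * C * \<epsilon> \<le> \<beta>" using \<beta> C by (auto simp: \<epsilon>_def)
  obtain f s0 where f: "f \<in> Cc_inf \<Omega>" "\<And>x. 0 \<le> f x \<and> f x \<le> 1" "\<And>x. x \<in> U \<Longrightarrow> f x = 1"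
    and s0: "s0 \<in> {1/2<..<3/4}" "\<And>s. s \<in> {1/2<..<s0} \<Longrightarrow> gagliardo s \<Omega> f \<le> ennreal \<epsilon>"
    using fU[OF \<epsilon>(1)] by blast
  have "\<exists>u \<in> Hs0_space s \<Omega>. \<not> ae_zero_on \<Omega> u \<and>
             enn2real (Q_frac s \<Omega> u) / (Lp_norm (crit_exp DIM('a) s) \<Omega> u)\<^sup>2 = S_frac s \<Omega>" if s: "s \<in> {1/2<..<s0}" for s
  proof -
    have s2: "1/2 < s" "s < 3/4" using s s0 by auto
    interpret rf: regional_fractional \<Omega> s "crit_exp DIM('a) s" by unfold_locales (use \<Omega> assms(1) s2 in auto)
    show ?thesis
    proof (rule rf.S_frac_achieved[OF C _ f(1,2) s0(2)[OF s] less_imp_le[OF \<epsilon>(1)] U(1,2) \<beta> f(3) \<epsilon>(2)])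
      fix u assume "u \<in> borel_measurable (lebesgue_on \<Omega>)" "(\<integral>\<^sup>+x. ennreal ((u x)\<^sup>2) \<partial>lebesgue_on \<Omega>) < \<infinity>" "gagliardo s \<Omega> u < \<infinity>"
      then show "(\<integral>\<^sup>+x. ennreal (\<bar>u x - average (lebesgue_on \<Omega>) \<Omega> u\<bar> powr crit_exp DIM('a) s) \<partial>lebesgue_on \<Omega>)
         \<le> ennreal ((C * enn2real (gagliardo s \<Omega> u)) powr (crit_exp DIM('a) s / 2))"
        unfolding C_def by (intro poincare_sobolev[OF \<Omega> c R \<Omega>R dens' assms(1) s2] refl)
    qed
  qed
  moreover have "s0 \<in> {1/2<..<1}" using s0(1) by auto
  ultimately show ?thesis by blast
qed

end
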